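(* Let $$q_0=\tfrac14,\qquad q_{r+1}=q_r(1-q_r)\quad(r\ge0).$$ Then, for every integer $m\ge2$, $$c_m^\star\le q_{m-2}.$$ More precisely, for every $\delta>0$ there are a finite irreducible reversible Markov kernel $P$ on exactly $m$ states and a finite window length $n\ge2$ such that $$\frac{n\operatorname{Gap}(\widetilde P_n)}{\operatorname{Gap}(P)}\le q_{m-2}+\delta.$$ The kernels may also be chosen entrywise positive. Furthermore, $$q_r=\frac1{r+\log r+O(1)}\quad(r\to\infty),\qquad q_{m-2}\le\frac1{m+2}.$$ Consequently $C_m^{\mathrm{opt}}\ge q_{m-2}^{-1}$.
   Context: Let $\Omega$ be a finite set with $|\Omega|=m$, and let $P$ be an irreducible Markov kernel (stochastic matrix) on $\Omega$ that is reversible with respect to its stationary law $\pi$, i.e. $\pi_xP(x,y)=\pi_yP(y,x)$. Let $1=\lambda_1>\lambda_2\ge\cdots\ge\lambda_m\ge-1$ be the eigenvalues of $P$ in $L^2(\pi)$. "Gap" always means the right spectral gap: $\operatorname{Gap}(P)=1-\lambda_2$ (one minus the second largest eigenvalue, counted with multiplicity). Let $(X_t)_{t\in\mathbb Z}$ be a stationary two-sided Markov chain with kernel $P$ and marginal law $\pi$. For a window length $n\ge1$ put $K_t=\sum_{j=0}^{n-1}e_{X_{t+j}}\in\mathbb Z_+^\Omega$, where $e_x$ is the coordinate vector indexed by $x$. Let $\mu_n$ be the law of $K_0$ and $\mathsf S_n=\operatorname{supp}(\mu_n)$. The projected count kernel $\widetilde P_n$ is the Markov kernel on $\mathsf S_n$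 defined by $\mu_n(k)\widetilde P_n(k,\ell)=\mathbb P(K_0=k,K_1=\ell)$; it is reversible with respect to $\mu_n$ and irreducible on $\mathsf S_n$. $\operatorname{Gap}(\widetilde P_n)$ is its right spectral gap on $\mathsf S_n$; if $\mathsf S_n$ is a singleton, $\operatorname{Gap}(\widetilde P_n)=1$ by convention. Define $$c_m^\star=\inf\frac{n\operatorname{Gap}(\widetilde P_n)}{\operatorname{Gap}(P)},\qquad C_m^{\mathrm{opt}}=(c_m^\star)^{-1},$$ where the infimum is over all irreducible reversible Markov kernels $P$ on a set $\Omega$ with $|\Omega|=m$ and all integers $n\ge2$. *)

theory Defs
  imports
    "HOL-Probability.Probability"
    "HOL-Library.Landau_Symbols"
    "Jordan_Normal_Form.Char_Poly"
begin

text \<open>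
  A Markov kernel on a finite set \<open>\<Omega>\<close> is a function \<open>P\<close> assigning to each state a
  probability mass function, with \<open>P(x,y) = pmf (P x) y\<close>; its values outside \<open>\<Omega>\<close> are irrelevant.
\<close>

definition markov_kernel :: "'a set \<Rightarrow> ('a \<Rightarrow> 'a pmf) \<Rightarrow> bool" where
  "markov_kernel \<Omega> P \<longleftrightarrow> finite \<Omega> \<and> (\<forall>x\<in>\<Omega>. set_pmf (P x) \<subseteq> \<Omega>)"

definition irreducible_kernel :: "'a set \<Rightarrow> ('a \<Rightarrow> 'a pmf) \<Rightarrow> bool" where
  "irreducible_kernel \<Omega> P \<longleftrightarrow> (\<forall>x\<in>\<Omega>. \<forall>y\<in>\<Omega>. (x, y) \<in> {(a, b). pmf (P a) b > 0}\<^sup>*)"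

definition stationary_law :: "'a set \<Rightarrow> ('a \<Rightarrow> 'a pmf) \<Rightarrow> 'a pmf \<Rightarrow> bool" where
  "stationary_law \<Omega> P \<pi> \<longleftrightarrow> set_pmf \<pi> \<subseteq> \<Omega> \<and> bind_pmf \<pi> P = \<pi>"

definition reversible_kernel :: "'a set \<Rightarrow> ('a \<Rightarrow> 'a pmf) \<Rightarrow> 'a pmf \<Rightarrow> bool" where
  "reversible_kernel \<Omega> P \<pi> \<longleftrightarrow>
     (\<forall>x\<in>\<Omega>. \<forall>y\<in>\<Omega>. pmf \<pi> x * pmf (P x) y = pmf \<pi> y * pmf (P y) x)"

definition irreducible_reversible :: "'a set \<Rightarrow> ('a \<Rightarrow> 'a pmf) \<Rightarrow> 'a pmf \<Rightarrow> bool" where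
  "irreducible_reversible \<Omega> P \<pi> \<longleftrightarrow>
     markov_kernel \<Omega> P \<and> irreducible_kernel \<Omega> P \<and> stationary_law \<Omega> P \<pi> \<and> reversible_kernel \<Omega> P \<pi>"

text \<open>
  The eigenvalues of the operator \<open>f \<mapsto> (x \<mapsto> \<Sum>y\<in>S. Q x y * f y)\<close> on functions on the finite set \<open>S\<close>,
  in decreasing order and with multiplicity. The enumeration of \<open>S\<close> is arbitrary, but the
  characteristic polynomial does not depend on it. Only real roots are listed; if \<open>Q\<close> is reversible
  with respect to a law of full support (a self-adjoint operator), all roots are real, and algebraic
  and geometric multiplicities agree.
\<close>

definition kernel_mat :: "'a set \<Rightarrow> ('a \<Rightarrow> 'a \<Rightarrow> real) \<Rightarrow> real mat" where
  "kernel_mat S Q =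
     (let xs = (SOME xs. distinct xs \<and> set xs = S)
      in mat (length xs) (length xs) (\<lambda>(i, j). Q (xs ! i) (xs ! j)))"

definition kernel_eigenvalues :: "'a set \<Rightarrow> ('a \<Rightarrow> 'a \<Rightarrow> real) \<Rightarrow> real list" where
  "kernel_eigenvalues S Q = rev (sorted_list_of_multiset (proots (char_poly (kernel_mat S Q))))"

text \<open>The right spectral gap, equal to 1 on a singleton by convention. The list index 1 selects
  the second largest eigenvalue.\<close>

definition gap :: "'a set \<Rightarrow> ('a \<Rightarrow> 'a \<Rightarrow> real) \<Rightarrow> real" where
  "gap S Q = (if card S = 1 then 1 else 1 - kernel_eigenvalues S Q ! 1)"

text \<open>
  \<open>chain_law P \<pi> n\<close> is the law of \<open>(X\<^sub>0, \<dots>, X\<^sub>n)\<close>, equivalently of \<open>(X\<^sub>t, \<dots>, X\<^bsub>t+n\<^esub>)\<close> for any \<open>t\<close>, where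
  \<open>(X\<^sub>t)\<close> is the stationary two-sided chain with kernel \<open>P\<close> and marginal \<open>\<pi>\<close>; see
  \<open>stationary_chain_law\<close> below. The counts \<open>K\<^sub>0\<close> and \<open>K\<^sub>1\<close> of a window of length \<open>n\<close> are
  functions of \<open>(X\<^sub>0, \<dots>, X\<^sub>n)\<close>, which is all that their joint law depends on.
\<close>

primrec walk :: "('a \<Rightarrow> 'a pmf) \<Rightarrow> nat \<Rightarrow> 'a \<Rightarrow> 'a list pmf" where
  "walk P 0 x = return_pmf [x]"
| "walk P (Suc n) x = map_pmf ((#) x) (bind_pmf (P x) (walk P n))"

definition chain_law :: "('a \<Rightarrow> 'a pmf) \<Rightarrow> 'a pmf \<Rightarrow> nat \<Rightarrow> 'a list pmf" where
  "chain_law P \<pi> n = bind_pmf \<pi> (walk P n)"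

text \<open>\<open>K\<^sub>t = \<Sum>j<n. e\<^bsub>X\<^bsub>t+j\<^esub>\<^esub>\<close>, where \<open>xs ! i\<close> is the value of \<open>X\<^sub>i\<close>.\<close>

definition window_count :: "nat \<Rightarrow> nat \<Rightarrow> 'a list \<Rightarrow> 'a \<Rightarrow> nat" where
  "window_count n t xs = (\<lambda>x. \<Sum>j<n. of_bool (xs ! (t + j) = x))"

definition count_law :: "('a \<Rightarrow> 'a pmf) \<Rightarrow> 'a pmf \<Rightarrow> nat \<Rightarrow> ('a \<Rightarrow> nat) pmf" where
  "count_law P \<pi> n = map_pmf (window_count n 0) (chain_law P \<pi> n)"

definition count_joint_law ::
    "('a \<Rightarrow> 'a pmf) \<Rightarrow> 'a pmf \<Rightarrow> nat \<Rightarrow> (('a \<Rightarrow> nat) \<times> ('a \<Rightarrow> nat)) pmf" where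
  "count_joint_law P \<pi> n =
     map_pmf (\<lambda>xs. (window_count n 0 xs, window_count n 1 xs)) (chain_law P \<pi> n)"

definition count_kernel ::
    "('a \<Rightarrow> 'a pmf) \<Rightarrow> 'a pmf \<Rightarrow> nat \<Rightarrow> ('a \<Rightarrow> nat) \<Rightarrow> ('a \<Rightarrow> nat) \<Rightarrow> real" where
  "count_kernel P \<pi> n k l = pmf (count_joint_law P \<pi> n) (k, l) / pmf (count_law P \<pi> n) k"

definition gap_ratio :: "'a set \<Rightarrow> ('a \<Rightarrow> 'a pmf) \<Rightarrow> 'a pmf \<Rightarrow> nat \<Rightarrow> real" where
  "gap_ratio \<Omega> P \<pi> n =
     real n * gap (set_pmf (count_law P \<pi> n)) (count_kernel P \<pi> n) / gap \<Omega> (\<lambda>x y. pmf (P x) y)"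

text \<open>
  State spaces are finite sets of natural numbers, without loss of generality by relabelling.
  The values are extended reals, so that \<open>C_opt m = \<infinity>\<close> if \<open>c_star m = 0\<close>.
\<close>

definition c_star :: "nat \<Rightarrow> ereal" where
  "c_star m = Inf {ereal (gap_ratio \<Omega> P \<pi> n) | (\<Omega> :: nat set) P \<pi> n.
                     card \<Omega> = m \<and> irreducible_reversible \<Omega> P \<pi> \<and> n \<ge> 2}"

definition C_opt :: "nat \<Rightarrow> ereal" where
  "C_opt m = inverse (c_star m)"

primrec q_seq :: "nat \<Rightarrow> real" where
  "q_seq 0 = 1 / 4"
| "q_seq (Suc r) = q_seq r * (1 - q_seq r)"

text \<open>
  Stationary two-sided Markov chains on a probability space, and the agreement of their window
  laws with the mass functions above.
\<close>

definition stationary_chain ::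
    "'w measure \<Rightarrow> (int \<Rightarrow> 'w \<Rightarrow> 'a) \<Rightarrow> ('a \<Rightarrow> 'a pmf) \<Rightarrow> 'a pmf \<Rightarrow> bool" where
  "stationary_chain M X P \<pi> \<longleftrightarrow>
     prob_space M \<and>
     (\<forall>t. X t \<in> M \<rightarrow>\<^sub>M count_space UNIV) \<and>
     (\<forall>t. distr M (count_space UNIV) (X t) = measure_pmf \<pi>) \<and>
     (\<forall>t xs x y.
        measure M {\<omega> \<in> space M. (\<forall>i < length xs. X (t + int i) \<omega> = xs ! i) \<and>
                                X (t + int (length xs)) \<omega> = x \<and> X (t + int (length xs) + 1) \<omega> = y} =
        measure M {\<omega> \<in> space M. (\<forall>i < length xs. X (t + int i) \<omega> = xs ! i) \<and>
                                X (t + int (length xs)) \<omega> = x} * pmf (P x) y)"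

lemma pmf_map_Cons: "pmf (map_pmf ((#) x) p) (z # zs) = (if z = x then pmf p zs else 0)"
proof (cases "z = x")
  case True
  then show ?thesis by (simp add: pmf_map_inj')
next
  case False
  then have "z # zs \<notin> set_pmf (map_pmf ((#) x) p)" by auto
  then have "pmf (map_pmf ((#) x) p) (z # zs) = 0" by (simp only: set_pmf_iff not_not)
  then show ?thesis using False by simp
qed

lemma pmf_walk_head: "hd zs \<noteq> x \<Longrightarrow> pmf (walk P n x) zs = 0"
proof -
  assume "hd zs \<noteq> x"
  then have "zs \<notin> set_pmf (walk P n x)" by (cases n) auto
  then show ?thesis by (simp add: set_pmf_iff)
qed

lemma pmf_bind_walk:
  "pmf (bind_pmf p (walk P n)) (z # zs) = pmf p z * pmf (walk P n z) (z # zs)"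
proof -
  have "pmf (bind_pmf p (walk P n)) (z # zs) =
      measure_pmf.expectation p (\<lambda>x. pmf (walk P n z) (z # zs) * indicator {z} x)"
    unfolding pmf_bind
    by (rule Bochner_Integration.integral_cong) (auto simp: indicator_def pmf_walk_head)
  then show ?thesis by (simp add: measure_pmf_single mult.commute)
qed

lemma pmf_walk_snoc:
  "length xs = n \<Longrightarrow>
   pmf (walk P (Suc n) z) (xs @ [x, y]) = pmf (walk P n z) (xs @ [x]) * pmf (P x) y"
proof (induction n arbitrary: xs z)
  case 0
  have "pmf (bind_pmf (P x) (walk P 0)) [y] = pmf (P x) y"
    by (subst pmf_bind_walk) simp
  then show ?case using 0
    by (auto simp: pmf_map_Cons indicator_def simp del: walk.simps(1))
       (auto simp: indicator_def)
next
  case (Suc n)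
  then obtain a as where xs: "xs = a # as" "length as = n" by (cases xs) auto
  obtain b bs where b: "as @ [x] = b # bs" by (cases as) auto
  then have b': "as @ [x, y] = b # (bs @ [y])" by (cases as) auto
  show ?case
    using Suc.IH[OF xs(2), of b] unfolding xs(1) append_Cons walk.simps(2)[of P "Suc n"] walk.simps(2)[of P n z]
    unfolding pmf_map_Cons b b' pmf_bind_walk by simp
qed

lemma pmf_chain_law_snoc:
  assumes "length xs = n"
  shows "pmf (chain_law P \<pi> (Suc n)) (xs @ [x, y]) =
         pmf (chain_law P \<pi> n) (xs @ [x]) * pmf (P x) y"
proof -
  obtain b bs where b: "xs @ [x] = b # bs" by (cases xs) auto
  then have b': "xs @ [x, y] = b # (bs @ [y])" by (cases xs) auto
  show ?thesis
    using pmf_walk_snoc[OF assms, of P b x y] unfolding chain_law_def b b' pmf_bind_walk by simp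
qed

lemma stationary_chain_law:
  assumes "stationary_chain M X P \<pi>"
  shows "measure M {\<omega> \<in> space M. \<forall>i \<le> length xs. X (t + int i) \<omega> = (xs @ [x]) ! i} =
         pmf (chain_law P \<pi> (length xs)) (xs @ [x])"
proof (induction xs arbitrary: x rule: rev_induct)
  case Nil
  have X: "X t \<in> M \<rightarrow>\<^sub>M count_space UNIV"
    and d: "distr M (count_space UNIV) (X t) = measure_pmf \<pi>"
    using assms by (auto simp: stationary_chain_def)
  have "{\<omega> \<in> space M. X t \<omega> = x} = X t -` {x} \<inter> space M" by auto
  then have "measure M {\<omega> \<in> space M. X t \<omega> = x} = measure (distr M (count_space UNIV) (X t)) {x}"
    using measure_distr[OF X, of "{x}"] by simp
  also have "\<dots> = pmf \<pi> x" by (simp add: d measure_pmf_single)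
  also have "\<dots> = pmf (chain_law P \<pi> 0) [x]"
    unfolding chain_law_def by (subst pmf_bind_walk) simp
  finally show ?case by simp
next
  case (snoc z xs)
  have 1: "{\<omega> \<in> space M. \<forall>i \<le> length (xs @ [z]). X (t + int i) \<omega> = ((xs @ [z]) @ [x]) ! i} =
      {\<omega> \<in> space M. (\<forall>i < length xs. X (t + int i) \<omega> = xs ! i) \<and>
         X (t + int (length xs)) \<omega> = z \<and> X (t + int (length xs) + 1) \<omega> = x}"
    by (auto simp: nth_append le_Suc_eq algebra_simps less_Suc_eq_le le_less)
  have 2: "{\<omega> \<in> space M. \<forall>i \<le> length xs. X (t + int i) \<omega> = (xs @ [z]) ! i} =
      {\<omega> \<in> space M. (\<forall>i < length xs. X (t + int i) \<omega> = xs ! i) \<and>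
         X (t + int (length xs)) \<omega> = z}"
    by (auto simp: nth_append le_less)
  show ?case
    using assms snoc.IH[of z] pmf_chain_law_snoc[of xs "length xs" P \<pi> z x]
    unfolding 1 2 stationary_chain_def by simp
qed

end

theory Submission
  imports Defs "HOL-Combinatorics.Permutations" "HOL-Real_Asymp.Real_Asymp"
begin

text \<open>
  Let \<open>N = m - 1\<close>. The extremal kernels live on \<open>{0..N}\<close> and have stationary law proportional to \<open>\<epsilon>\<^bsup>x\<^esup>\<close>:
  each state \<open>x \<ge> 1\<close> is left to its lower neighbour with probability \<open>p\<close>, and all other jumps have tiny
  but positive probability. As \<open>\<epsilon> \<rightarrow> 0\<close> the right gap of the kernel tends to \<open>p\<close>, while a window that meets the top state
  \<open>N\<close> at all sees, with overwhelming conditional probability, a single excursion that climbs through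
  \<open>1, \<dots>, N\<close> and descends again, with geometric stays of mean \<open>1/p\<close>.

  The gap of the count kernel is bounded by the Rayleigh quotient of a test function \<open>f\<close> on counts, which
  is zero unless the window contains \<open>N\<close>, and otherwise the product of \<open>exp (p w\<^sub>x)\<close> (approximately) over
  all visits to states \<open>x \<ge> 1\<close>. While a window of length \<open>n\<close>, long compared with the excursion, slides over
  it, \<open>f\<close> rises to a final value, remains there for about \<open>n\<close> steps, and falls again. So \<open>n Gap / p\<close> is at
  most the ratio of the expected energy of the rise to \<open>p\<^sup>2\<close> times the second moment of the final value, up to
  normalization. A stay in \<open>x\<close> multiplies the second moment by \<open>1/(1 - 2 w\<^sub>x)\<close>. When \<open>w\<^sub>N\<close> approaches the
  critical value \<open>1/2\<close>, the jump of \<open>f\<close> at the first visit to the top and all that precedes it become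
  negligible. What remains is the top stage, which has ratio \<open>1/4\<close>, and the descent: if the part of
  the path before the stage \<open>x\<close> of the descent has ratio \<open>q\<close>, the part up to its end has ratio
  \<open>w\<^sub>x\<^sup>2 + (1 - 2 w\<^sub>x) q\<close>. This is least at \<open>w\<^sub>x = q\<close>, with value \<open>q (1 - q)\<close>. After the \<open>N - 1\<close> descending stages
  the ratio is \<open>q\<^bsub>N-1\<^esub> = q\<^bsub>m-2\<^esub>\<close>.

  The proof takes the limits \<open>\<epsilon> \<rightarrow> 0\<close>, \<open>n \<rightarrow> \<infinity>\<close>, \<open>p \<rightarrow> 0\<close> in this order. The lemma \<open>count_gap_bound\<close> is
  the bound by the Rayleigh quotient at fixed parameters, with expectations over paths evaluated by
  linear recursions; \<open>numerator_limit\<close> and \<open>hit_weight_0_growth\<close> treat the limit in \<open>n\<close>, and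
  \<open>ratio_limit_tendsto\<close> the limit in \<open>p\<close>. The link between the second root of the characteristic polynomial
  and Rayleigh quotients is provided by \<open>gap_ge\<close> and \<open>gap_var_le\<close>, which rest on a spectral theorem
  for matrices that are symmetric with respect to a weight.
\<close>

section \<open>The spectral theorem for reversible matrices\<close>

text \<open>
  A real matrix \<open>Q\<close> on a finite set \<open>S\<close> that is symmetric with respect to a positive weight \<open>\<mu>\<close>. Values
  of functions outside \<open>S\<close> play no role.
\<close>

locale self_adjoint_kernel =
  fixes S :: "'a set" and \<mu> :: "'a \<Rightarrow> real" and Q :: "'a \<Rightarrow> 'a \<Rightarrow> real"
  assumes finite_S: "finite S"
    and \<mu>_pos: "x \<in> S \<Longrightarrow> \<mu> x > 0"
    and detailed_balance: "x \<in> S \<Longrightarrow> y \<in> S \<Longrightarrow> \<mu> x * Q x y = \<mu> y * Q y x"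
begin

text \<open>
  The inner product of \<open>L\<^sup>2(\<mu>)\<close>, the operator of \<open>Q\<close>, and orthonormality of the first \<open>k\<close> members of a
  sequence of functions.
\<close>

definition ip :: "('a \<Rightarrow> real) \<Rightarrow> ('a \<Rightarrow> real) \<Rightarrow> real" where
  "ip f g = (\<Sum>x\<in>S. \<mu> x * f x * g x)"

definition kernel_op :: "('a \<Rightarrow> real) \<Rightarrow> 'a \<Rightarrow> real" where
  "kernel_op f x = (\<Sum>y\<in>S. Q x y * f y)"

definition orthonormal :: "nat \<Rightarrow> (nat \<Rightarrow> 'a \<Rightarrow> real) \<Rightarrow> bool" where
  "orthonormal k \<phi> \<longleftrightarrow> (\<forall>i<k. \<forall>j<k. ip (\<phi> i) (\<phi> j) = of_bool (i = j))"

lemma ip_commute: "ip f g = ip g f"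
  by (simp add: ip_def mult_ac)

lemma ip_add_left: "ip (\<lambda>x. f x + g x) h = ip f h + ip g h"
  and ip_diff_left: "ip (\<lambda>x. f x - g x) h = ip f h - ip g h"
  and ip_scale_left: "ip (\<lambda>x. c * f x) h = c * ip f h"
  by (simp_all add: ip_def algebra_simps sum.distrib sum_subtractf sum_distrib_left)

lemma ip_sum_left: "ip (\<lambda>x. \<Sum>i\<in>I. F i x) h = (\<Sum>i\<in>I. ip (F i) h)"
proof -
  have "ip (\<lambda>x. \<Sum>i\<in>I. F i x) h = (\<Sum>x\<in>S. \<Sum>i\<in>I. \<mu> x * F i x * h x)"
    by (simp add: ip_def sum_distrib_left sum_distrib_right)
  also have "\<dots> = (\<Sum>i\<in>I. ip (F i) h)"
    unfolding ip_def by (rule sum.swap)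
  finally show ?thesis .
qed

lemma ip_add_right: "ip h (\<lambda>x. f x + g x) = ip h f + ip h g"
  and ip_diff_right: "ip h (\<lambda>x. f x - g x) = ip h f - ip h g"
  and ip_scale_right: "ip h (\<lambda>x. c * f x) = c * ip h f"
  and ip_sum_right: "ip h (\<lambda>x. \<Sum>i\<in>I. F i x) = (\<Sum>i\<in>I. ip h (F i))"
  by (simp_all only: ip_commute[of h] ip_add_left ip_diff_left ip_scale_left ip_sum_left)

lemmas ip_lin = ip_add_left ip_diff_left ip_scale_left ip_sum_left
  ip_add_right ip_diff_right ip_scale_right ip_sum_right

lemma kernel_op_lin: "kernel_op (\<lambda>x. f x + g x) = (\<lambda>x. kernel_op f x + kernel_op g x)"
  "kernel_op (\<lambda>x. c * f x) = (\<lambda>x. c * kernel_op f x)"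
  by (auto simp: kernel_op_def algebra_simps sum.distrib sum_distrib_left)

lemma ip_cong: "(\<And>x. x \<in> S \<Longrightarrow> f x = f' x) \<Longrightarrow> (\<And>x. x \<in> S \<Longrightarrow> g x = g' x) \<Longrightarrow> ip f g = ip f' g'"
  by (simp add: ip_def)

lemma kernel_op_cong: "(\<And>x. x \<in> S \<Longrightarrow> f x = f' x) \<Longrightarrow> kernel_op f = kernel_op f'"
  by (simp add: kernel_op_def fun_eq_iff)

lemma kernel_op_self_adjoint: "ip (kernel_op f) g = ip f (kernel_op g)"
proof -
  have "ip (kernel_op f) g = (\<Sum>x\<in>S. \<Sum>y\<in>S. (\<mu> x * Q x y) * f y * g x)"
    by (simp add: ip_def kernel_op_def sum_distrib_left sum_distrib_right mult_ac)
  also have "\<dots> = (\<Sum>x\<in>S. \<Sum>y\<in>S. (\<mu> y * Q y x) * f y * g x)"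
    by (intro sum.cong refl) (simp add: detailed_balance)
  also have "\<dots> = (\<Sum>y\<in>S. \<Sum>x\<in>S. (\<mu> y * Q y x) * f y * g x)"
    by (rule sum.swap)
  also have "\<dots> = ip f (kernel_op g)"
    by (simp add: ip_def kernel_op_def sum_distrib_left sum_distrib_right mult_ac)
  finally show ?thesis .
qed

lemma ip_term_nonneg: "x \<in> S \<Longrightarrow> 0 \<le> \<mu> x * f x * f x"
  using \<mu>_pos[of x] by (simp add: mult.assoc)

lemma ip_nonneg: "ip f f \<ge> 0"
  unfolding ip_def by (intro sum_nonneg ip_term_nonneg)

lemma ip_eq_0D: "ip f f = 0 \<Longrightarrow> x \<in> S \<Longrightarrow> f x = 0"
proof -
  assume *: "ip f f = 0" "x \<in> S"
  have "\<forall>x\<in>S. \<mu> x * f x * f x = 0"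
    using * unfolding ip_def
    by (subst (asm) sum_nonneg_eq_0_iff[OF finite_S]) (auto simp: ip_term_nonneg)
  then show ?thesis using * \<mu>_pos[of x] by auto
qed

lemma ip_zero_cong: "(\<And>x. x \<in> S \<Longrightarrow> f x = 0) \<Longrightarrow> ip f g = 0"
  by (simp add: ip_def)

text \<open>
  On the orthogonal complement of finitely many functions the Rayleigh quotient attains its maximum.
  Functions that vanish off \<open>S\<close> and have norm one lie in a product of compact intervals, which is compact
  in the topology of pointwise convergence.
\<close>

lemma exists_rayleigh_maximizer:
  assumes ne: "\<exists>f. ip f f \<noteq> 0 \<and> (\<forall>i<k. ip f (\<phi> i) = 0)"
  shows "\<exists>f. ip f f = 1 \<and> (\<forall>i<k. ip f (\<phi> i) = 0) \<and>
    (\<forall>h. (\<forall>i<k. ip h (\<phi> i) = 0) \<longrightarrow> ip (kernel_op h) h \<le> ip (kernel_op f) f * ip h h)"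
proof -
  define B where "B x = (if x \<in> S then cball 0 (1 / sqrt (\<mu> x)) else {0::real})" for x
  define C where "C = PiE UNIV B \<inter> {f. ip f f = 1 \<and> (\<forall>i\<in>{..<k}. ip f (\<phi> i) = 0)}"
  have "compactin (product_topology (\<lambda>i. euclidean) UNIV) (PiE UNIV B)"
    by (simp add: compactin_PiE B_def)
  then have "compact (PiE UNIV B)"
    by (simp add: euclidean_product_topology)
  have coord: "continuous_on UNIV (\<lambda>f::'a \<Rightarrow> real. f x)" for x
    by (rule continuous_on_product_coordinates)
  have cT: "continuous_on UNIV (\<lambda>f. ip f f)" "continuous_on UNIV (\<lambda>f. ip (kernel_op f) f)"
    "continuous_on UNIV (\<lambda>f. ip f g)" for g
    unfolding ip_def kernel_op_def by (intro continuous_intros coord)+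
  have "closed ({f. ip f f = 1} \<inter> (\<Inter>i\<in>{..<k}. {f. ip f (\<phi> i) = 0}))"
    by (intro closed_Int closed_INT ballI closed_Collect_eq cT continuous_intros)
  also have "{f. ip f f = 1} \<inter> (\<Inter>i\<in>{..<k}. {f. ip f (\<phi> i) = 0}) =
      {f. ip f f = 1 \<and> (\<forall>i\<in>{..<k}. ip f (\<phi> i) = 0)}" by auto
  finally have "closed {f. ip f f = 1 \<and> (\<forall>i\<in>{..<k}. ip f (\<phi> i) = 0)}" .
  with \<open>compact (PiE UNIV B)\<close> have "compact C"
    unfolding C_def by blast
  have inC: "\<exists>g\<in>C. \<exists>c. (\<forall>x\<in>S. g x = c * h x) \<and> c\<^sup>2 * ip h h = 1"
    if h: "ip h h \<noteq> 0" "\<forall>i<k. ip h (\<phi> i) = 0" for h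
  proof -
    define c where "c = 1 / sqrt (ip h h)"
    define g where "g x = (if x \<in> S then c * h x else 0)" for x
    have pos: "ip h h > 0" using h ip_nonneg[of h] by simp
    have eq: "ip g u = c * ip h u" for u
      unfolding ip_scale_left[symmetric] by (rule ip_cong) (auto simp: g_def)
    have c2: "c\<^sup>2 * ip h h = 1" using pos by (simp add: c_def power_divide)
    have g1: "ip g g = 1"
      using eq[of g] eq[of h] c2 by (simp add: ip_commute[of h g] power2_eq_square mult_ac)
    have "g x \<in> B x" for x
    proof (cases "x \<in> S")
      case True
      have "\<mu> x * g x * g x \<le> ip g g"
        unfolding ip_def using True finite_S
        by (intro member_le_sum) (auto simp: ip_term_nonneg)
      then have "(g x)\<^sup>2 \<le> 1 / \<mu> x"
        using g1 \<mu>_pos[OF True] by (simp add: field_simps power2_eq_square)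
      then have "\<bar>g x\<bar> \<le> sqrt (1 / \<mu> x)"
        using real_le_rsqrt[of "\<bar>g x\<bar>" "1 / \<mu> x"] by simp
      then show ?thesis using True by (simp add: B_def real_sqrt_divide)
    qed (simp add: B_def g_def)
    then have "g \<in> C" using g1 eq h by (auto simp: C_def)
    then show ?thesis using c2 by (auto simp: g_def intro!: bexI[of _ g] exI[of _ c])
  qed
  have "C \<noteq> {}" using ne inC by blast
  obtain f where f: "f \<in> C" "\<And>g. g \<in> C \<Longrightarrow> ip (kernel_op g) g \<le> ip (kernel_op f) f"
    using continuous_attains_sup[OF \<open>compact C\<close> \<open>C \<noteq> {}\<close>, of "\<lambda>f. ip (kernel_op f) f"]
      continuous_on_subset[OF cT(2)] by blast
  have "ip (kernel_op h) h \<le> ip (kernel_op f) f * ip h h" if h: "\<forall>i<k. ip h (\<phi> i) = 0" for h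
  proof (cases "ip h h = 0")
    case True
    then have "ip h (kernel_op h) = 0" using ip_eq_0D by (intro ip_zero_cong) auto
    then show ?thesis using True by (simp add: ip_commute)
  next
    case False
    obtain g c where g: "g \<in> C" "\<forall>x\<in>S. g x = c * h x" "c\<^sup>2 * ip h h = 1"
      using inC[OF False h] by blast
    have "kernel_op g = kernel_op (\<lambda>x. c * h x)" using g by (intro kernel_op_cong) auto
    then have "ip (kernel_op g) g = ip (\<lambda>x. c * kernel_op h x) (\<lambda>x. c * h x)"
      using g(2) by (intro ip_cong) (auto simp: kernel_op_lin)
    also have "\<dots> = c\<^sup>2 * ip (kernel_op h) h" by (simp add: ip_lin power2_eq_square)
    finally have "c\<^sup>2 * ip (kernel_op h) h \<le> ip (kernel_op f) f" using f(2)[OF g(1)] by simp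
    moreover have "ip h h > 0" using False ip_nonneg[of h] by simp
    ultimately have "ip h h * (c\<^sup>2 * ip (kernel_op h) h) \<le> ip h h * ip (kernel_op f) f"
      by (simp add: mult_left_mono)
    moreover have "ip h h * (c\<^sup>2 * ip (kernel_op h) h) = ip (kernel_op h) h * (c\<^sup>2 * ip h h)" by (simp add: mult_ac)
    ultimately show ?thesis using g(3) by (simp only: mult_1_right mult.commute)
  qed
  then show ?thesis using f(1) by (auto simp: C_def)
qed

text \<open>
  The normalized point mass at \<open>y\<close> minus its orthogonal projection onto the span of the first \<open>k\<close>
  members of \<open>\<phi>\<close>. The squared norms of these residuals add up to \<open>|S| - k\<close>. So for \<open>k < |S|\<close> one of them is
  nonzero, and for \<open>k = |S|\<close> all of them vanish; this replaces any count of dimensions.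
\<close>

definition unit_residual :: "nat \<Rightarrow> (nat \<Rightarrow> 'a \<Rightarrow> real) \<Rightarrow> 'a \<Rightarrow> 'a \<Rightarrow> real" where
  "unit_residual k \<phi> y x = of_bool (x = y) / sqrt (\<mu> y) - (\<Sum>i<k. sqrt (\<mu> y) * \<phi> i y * \<phi> i x)"

lemma unit_residual:
  assumes o: "orthonormal k \<phi>" and y: "y \<in> S"
  shows "j < k \<Longrightarrow> ip (unit_residual k \<phi> y) (\<phi> j) = 0"
    and "ip (unit_residual k \<phi> y) (unit_residual k \<phi> y) = 1 - (\<Sum>i<k. \<mu> y * (\<phi> i y)\<^sup>2)"
proof -
  define \<delta> where "\<delta> x = of_bool (x = y) / sqrt (\<mu> y)" for x
  have sq: "sqrt (\<mu> y) * sqrt (\<mu> y) = \<mu> y" "\<mu> y / sqrt (\<mu> y) = sqrt (\<mu> y)" "sqrt (\<mu> y) > 0"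
    using \<mu>_pos[OF y] by (auto simp: real_div_sqrt)
  have \<delta>: "ip \<delta> f = sqrt (\<mu> y) * f y" for f
  proof -
    have "ip \<delta> f = (\<Sum>x\<in>S. if x = y then \<mu> y / sqrt (\<mu> y) * f y else 0)"
      unfolding ip_def \<delta>_def by (intro sum.cong) auto
    then show ?thesis using y finite_S sq by simp
  qed
  have r: "unit_residual k \<phi> y = (\<lambda>x. \<delta> x - (\<Sum>i<k. (sqrt (\<mu> y) * \<phi> i y) * \<phi> i x))"
    by (simp add: unit_residual_def \<delta>_def fun_eq_iff)
  show 1: "ip (unit_residual k \<phi> y) (\<phi> j) = 0" if "j < k" for j
  proof -
    have "ip (unit_residual k \<phi> y) (\<phi> j) =
        sqrt (\<mu> y) * \<phi> j y - (\<Sum>i<k. sqrt (\<mu> y) * \<phi> i y * ip (\<phi> i) (\<phi> j))"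
      by (simp only: r ip_lin \<delta>)
    also have "(\<Sum>i<k. sqrt (\<mu> y) * \<phi> i y * ip (\<phi> i) (\<phi> j)) =
        (\<Sum>i<k. if i = j then sqrt (\<mu> y) * \<phi> j y else 0)"
      using o that by (intro sum.cong) (auto simp: orthonormal_def)
    finally show ?thesis using that by simp
  qed
  have "ip (unit_residual k \<phi> y) (unit_residual k \<phi> y) = ip \<delta> (unit_residual k \<phi> y)"
    by (subst (1) r) (simp add: ip_lin 1 ip_commute[of "\<phi> _" "unit_residual k \<phi> y"])
  also have "\<dots> = 1 - (\<Sum>i<k. \<mu> y * (\<phi> i y)\<^sup>2)"
  proof -
    have "sqrt (\<mu> y) * (\<Sum>i<k. sqrt (\<mu> y) * \<phi> i y * \<phi> i y) =
        (\<Sum>i<k. (sqrt (\<mu> y) * sqrt (\<mu> y)) * (\<phi> i y)\<^sup>2)"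
      by (simp only: sum_distrib_left mult_ac power2_eq_square)
    then show ?thesis
      using sq(1,3) by (simp add: \<delta> unit_residual_def right_diff_distrib)
  qed
  finally show "ip (unit_residual k \<phi> y) (unit_residual k \<phi> y) = 1 - (\<Sum>i<k. \<mu> y * (\<phi> i y)\<^sup>2)" .
qed

lemma sum_unit_residual:
  assumes o: "orthonormal k \<phi>"
  shows "(\<Sum>y\<in>S. ip (unit_residual k \<phi> y) (unit_residual k \<phi> y)) = real (card S) - real k"
proof -
  have "(\<Sum>y\<in>S. \<Sum>i<k. \<mu> y * (\<phi> i y)\<^sup>2) = (\<Sum>i<k. ip (\<phi> i) (\<phi> i))"
    unfolding ip_def by (subst sum.swap) (simp add: power2_eq_square mult_ac)
  also have "\<dots> = real k" using o by (simp add: orthonormal_def)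
  finally show ?thesis using unit_residual(2)[OF o] by (simp add: sum_subtractf)
qed

text \<open>
  Spectral theorem: eigenfunctions are found one at a time as maximizers of the Rayleigh quotient on the
  complement of the previous ones.
\<close>

lemma orthonormal_eigenfunctions:
  assumes "k \<le> card S"
  shows "\<exists>\<phi> e. orthonormal k \<phi> \<and> (\<forall>i<k. \<forall>x\<in>S. kernel_op (\<phi> i) x = e i * \<phi> i x)"
  using assms
proof (induction k)
  case 0
  then show ?case by (auto simp: orthonormal_def)
next
  case (Suc k)
  then obtain \<phi> e where o: "orthonormal k \<phi>"
    and ev: "\<And>i x. i < k \<Longrightarrow> x \<in> S \<Longrightarrow> kernel_op (\<phi> i) x = e i * \<phi> i x" by auto
  have "\<exists>y\<in>S. ip (unit_residual k \<phi> y) (unit_residual k \<phi> y) \<noteq> 0"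
  proof (rule ccontr)
    assume "\<not> ?thesis"
    then have "(\<Sum>y\<in>S. ip (unit_residual k \<phi> y) (unit_residual k \<phi> y)) = 0" by simp
    then show False using sum_unit_residual[OF o] Suc.prems by simp
  qed
  then have "\<exists>f. ip f f \<noteq> 0 \<and> (\<forall>i<k. ip f (\<phi> i) = 0)"
    using unit_residual(1)[OF o] by blast
  from exists_rayleigh_maximizer[OF this] obtain f where f: "ip f f = 1" "\<And>i. i < k \<Longrightarrow> ip f (\<phi> i) = 0"
    and mx: "\<And>h. (\<And>i. i < k \<Longrightarrow> ip h (\<phi> i) = 0) \<Longrightarrow> ip (kernel_op h) h \<le> ip (kernel_op f) f * ip h h" by blast
  define l where "l = ip (kernel_op f) f"
  define g where "g x = kernel_op f x - l * f x" for x
  have Tf: "ip (kernel_op f) (\<phi> i) = 0" if "i < k" for i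
  proof -
    have "ip f (kernel_op (\<phi> i)) = ip f (\<lambda>x. e i * \<phi> i x)" using ev[OF that] by (intro ip_cong) auto
    then show ?thesis using f(2)[OF that] by (simp add: kernel_op_self_adjoint ip_lin)
  qed
  have g0: "ip g (\<phi> i) = 0" if "i < k" for i
    unfolding g_def using Tf[OF that] f(2)[OF that] by (simp add: ip_lin)
  define d where "d = l * ip g g - ip (kernel_op g) g"
  \<comment> \<open>The first variation of the Rayleigh quotient at \<open>f\<close> in the direction of the residual \<open>g = Q f - l f\<close>
    is \<open>2 \<parallel>g\<parallel>\<^sup>2\<close>, so maximality forces \<open>g = 0\<close>.\<close>
  have key: "2 * t * ip g g \<le> t\<^sup>2 * d" for t
  proof -
    have gg': "ip g g = ip (kernel_op f) g - l * ip f g"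
    proof -
      have "ip g g = ip (\<lambda>x. kernel_op f x - l * f x) g" by (intro ip_cong) (auto simp: g_def)
      then show ?thesis by (simp only: ip_lin)
    qed
    have "ip (kernel_op g) f = ip (kernel_op f) g"
      by (metis kernel_op_self_adjoint ip_commute)
    then have 1: "ip (kernel_op (\<lambda>x. f x + t * g x)) (\<lambda>x. f x + t * g x) =
        l + 2 * t * ip (kernel_op f) g + t\<^sup>2 * ip (kernel_op g) g"
      by (simp add: kernel_op_lin ip_lin l_def algebra_simps power2_eq_square)
    have 2: "ip (\<lambda>x. f x + t * g x) (\<lambda>x. f x + t * g x) = 1 + 2 * t * ip f g + t\<^sup>2 * ip g g"
      by (simp add: ip_lin f(1) ip_commute[of g f] algebra_simps power2_eq_square)
    have "ip (kernel_op (\<lambda>x. f x + t * g x)) (\<lambda>x. f x + t * g x) \<le> l * ip (\<lambda>x. f x + t * g x) (\<lambda>x. f x + t * g x)"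
      unfolding l_def by (rule mx) (simp add: ip_lin f(2) g0)
    then have "2 * t * (ip (kernel_op f) g - l * ip f g) \<le> t\<^sup>2 * d"
      unfolding 1 2 by (simp add: d_def algebra_simps)
    then show ?thesis by (simp only: gg'[symmetric])
  qed
  have gg: "ip g g = 0"
  proof (rule ccontr)
    assume "ip g g \<noteq> 0"
    then have pos: "ip g g > 0" using ip_nonneg[of g] by simp
    define t where "t = ip g g / (\<bar>d\<bar> + 1)"
    have t: "t > 0" using pos by (simp add: t_def add_nonneg_pos)
    have "t * (2 * ip g g) \<le> t * (t * d)" using key[of t] by (simp add: power2_eq_square mult_ac)
    then have "2 * ip g g \<le> t * d" using t by simp
    also have "\<dots> \<le> t * (\<bar>d\<bar> + 1)" using t by (intro mult_left_mono) auto
    also have "\<dots> = ip g g" unfolding t_def by (simp add: add_nonneg_eq_0_iff)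
    finally show False using pos by simp
  qed
  have evf: "kernel_op f x = l * f x" if "x \<in> S" for x
    using ip_eq_0D[OF gg that] by (simp add: g_def)
  have "orthonormal (Suc k) (\<phi>(k := f))"
    unfolding orthonormal_def
    using o f by (auto simp: orthonormal_def less_Suc_eq ip_commute[of "\<phi> _" f])
  moreover have "\<forall>i<Suc k. \<forall>x\<in>S. kernel_op ((\<phi>(k := f)) i) x = (e(k := l)) i * (\<phi>(k := f)) i x"
    using ev evf by (auto simp: less_Suc_eq)
  ultimately show ?case by blast
qed

lemma orthonormal_complete:
  assumes o: "orthonormal (card S) \<phi>" and x: "x \<in> S" and y: "y \<in> S"
  shows "(\<Sum>i<card S. \<phi> i x * (\<mu> y * \<phi> i y)) = of_bool (x = y)"
proof -
  let ?r = "unit_residual (card S) \<phi> y"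
  have "(\<Sum>y\<in>S. ip (unit_residual (card S) \<phi> y) (unit_residual (card S) \<phi> y)) = 0"
    using sum_unit_residual[OF o] by simp
  then have "ip ?r ?r = 0"
    using y ip_nonneg by (subst (asm) sum_nonneg_eq_0_iff[OF finite_S]) auto
  then have "?r x = 0" using ip_eq_0D x by blast
  then have "(\<Sum>i<card S. sqrt (\<mu> y) * \<phi> i y * \<phi> i x) = of_bool (x = y) / sqrt (\<mu> y)"
    by (simp add: unit_residual_def)
  then have "sqrt (\<mu> y) * (\<Sum>i<card S. sqrt (\<mu> y) * \<phi> i y * \<phi> i x) = of_bool (x = y)"
    using \<mu>_pos[OF y] by simp
  moreover have "sqrt (\<mu> y) * (\<Sum>i<card S. sqrt (\<mu> y) * \<phi> i y * \<phi> i x) =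
      (\<Sum>i<card S. (sqrt (\<mu> y) * sqrt (\<mu> y)) * (\<phi> i y * \<phi> i x))"
    by (simp only: sum_distrib_left mult_ac)
  ultimately show ?thesis using \<mu>_pos[OF y] by (simp add: mult_ac)
qed

text \<open>
  An orthonormal basis of eigenfunctions diagonalizes the matrix of \<open>Q\<close> for the chosen enumeration of
  \<open>S\<close>, so the roots of its characteristic polynomial are the eigenvalues with multiplicity.
\<close>

lemma proots_char_poly_kernel_mat:
  assumes o: "orthonormal (card S) \<phi>"
    and ev: "\<And>i x. i < card S \<Longrightarrow> x \<in> S \<Longrightarrow> kernel_op (\<phi> i) x = e i * \<phi> i x"
  shows "proots (char_poly (kernel_mat S Q)) = mset (map e [0..<card S])"
proof -
  define xs where "xs = (SOME xs. distinct xs \<and> set xs = S)"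
  have xs: "distinct xs" "set xs = S"
    using someI_ex[OF finite_distinct_list[OF finite_S]] by (auto simp: xs_def conj_commute)
  define n where "n = card S"
  have len: "length xs = n" using xs distinct_card[of xs] by (simp add: n_def)
  have mem: "xs ! i \<in> S" if "i < n" for i using that len xs(2) nth_mem by blast
  have reindex: "(\<Sum>i<n. g (xs ! i)) = (\<Sum>x\<in>S. g x)" for g :: "'a \<Rightarrow> real"
    using xs len by (metis bij_betw_nth sum.reindex_bij_betw)
  define M where "M = kernel_mat S Q"
  \<comment> \<open>\<open>\<Psi>\<close> is the inverse of \<open>\<Phi>\<close>: one product is completeness, the other one orthonormality.\<close>
  define \<Phi> where "\<Phi> = mat n n (\<lambda>(i, j). \<phi> j (xs ! i))"
  define \<Psi> where "\<Psi> = mat n n (\<lambda>(j, i). \<mu> (xs ! i) * \<phi> j (xs ! i))"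
  define D where "D = mat n n (\<lambda>(i, j). if i = j then e i else 0)"
  have M: "M = mat n n (\<lambda>(i, j). Q (xs ! i) (xs ! j))"
    by (simp add: M_def kernel_mat_def xs_def[symmetric] len)
  have carr: "\<Phi> \<in> carrier_mat n n" "\<Psi> \<in> carrier_mat n n" "D \<in> carrier_mat n n" "M \<in> carrier_mat n n"
    by (auto simp: \<Phi>_def \<Psi>_def D_def M)
  have "\<Phi> * \<Psi> = 1\<^sub>m n"
  proof (rule eq_matI)
    fix i j assume "i < dim_row (1\<^sub>m n)" "j < dim_col (1\<^sub>m n)"
    then have ij: "i < n" "j < n" by auto
    have "(\<Phi> * \<Psi>) $$ (i, j) = (\<Sum>l<n. \<phi> l (xs ! i) * (\<mu> (xs ! j) * \<phi> l (xs ! j)))"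
      using ij by (simp add: \<Phi>_def \<Psi>_def scalar_prod_def atLeast0LessThan)
    also have "\<dots> = of_bool (xs ! i = xs ! j)"
      using orthonormal_complete[OF o mem mem] ij by (simp add: n_def)
    also have "\<dots> = 1\<^sub>m n $$ (i, j)"
      using ij xs(1) len by (simp add: nth_eq_iff_index_eq)
    finally show "(\<Phi> * \<Psi>) $$ (i, j) = 1\<^sub>m n $$ (i, j)" .
  qed (auto simp: \<Phi>_def \<Psi>_def)
  moreover from mat_mult_left_right_inverse[OF carr(1,2) this] have "\<Psi> * \<Phi> = 1\<^sub>m n" .
  moreover have "M = \<Phi> * D * \<Psi>"
  proof (rule eq_matI)
    fix i j assume "i < dim_row (\<Phi> * D * \<Psi>)" "j < dim_col (\<Phi> * D * \<Psi>)"
    then have ij: "i < n" "j < n" by (auto simp: \<Phi>_def \<Psi>_def)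
    have \<Phi>D: "(\<Phi> * D) $$ (i, l) = e l * \<phi> l (xs ! i)" if "l < n" for l
    proof -
      have "(\<Phi> * D) $$ (i, l) = (\<Sum>r<n. \<phi> r (xs ! i) * (if r = l then e r else 0))"
        using ij that by (simp add: \<Phi>_def D_def scalar_prod_def atLeast0LessThan)
      also have "\<dots> = (\<Sum>r<n. if r = l then e l * \<phi> l (xs ! i) else 0)"
        by (intro sum.cong) auto
      finally show ?thesis using that by simp
    qed
    have "(\<Phi> * D * \<Psi>) $$ (i, j) = (\<Sum>l<n. (\<Phi> * D) $$ (i, l) * (\<mu> (xs ! j) * \<phi> l (xs ! j)))"
      using ij by (simp add: \<Phi>_def \<Psi>_def D_def scalar_prod_def atLeast0LessThan)
    also have "\<dots> = (\<Sum>l<n. kernel_op (\<phi> l) (xs ! i) * (\<mu> (xs ! j) * \<phi> l (xs ! j)))"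
      using ev mem ij by (intro sum.cong) (auto simp: \<Phi>D n_def)
    also have "\<dots> = (\<Sum>y\<in>S. \<Sum>l<n. Q (xs ! i) y * (\<phi> l y * (\<mu> (xs ! j) * \<phi> l (xs ! j))))"
      by (subst sum.swap) (simp add: kernel_op_def sum_distrib_left sum_distrib_right mult_ac)
    also have "\<dots> = (\<Sum>y\<in>S. if y = xs ! j then Q (xs ! i) (xs ! j) else 0)"
      using orthonormal_complete[OF o _ mem[OF ij(2)]]
      by (intro sum.cong) (auto simp: sum_distrib_left[symmetric] n_def)
    also have "\<dots> = M $$ (i, j)" using ij mem finite_S by (simp add: M)
    finally show "M $$ (i, j) = (\<Phi> * D * \<Psi>) $$ (i, j)" by simp
  qed (auto simp: \<Phi>_def \<Psi>_def M)
  ultimately have "similar_mat_wit M D \<Phi> \<Psi>"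
    using carr by (intro similar_mat_witI[of _ _ n]) auto
  then have "char_poly M = char_poly D"
    by (intro char_poly_similar) (auto simp: similar_mat_def)
  also have "\<dots> = (\<Prod>a\<leftarrow>diag_mat D. [:- a, 1:])"
    by (rule char_poly_upper_triangular[OF carr(3)]) (auto simp: D_def upper_triangular_def)
  also have "diag_mat D = map e [0..<n]"
    by (auto simp: diag_mat_def D_def)
  finally have "char_poly M = (\<Prod>a\<leftarrow>map e [0..<n]. [:- a, 1:])" .
  moreover have "proots (\<Prod>a\<leftarrow>as. [:- a, 1:]) = mset as" for as :: "real list"
  proof (induction as)
    case (Cons a as)
    have "(\<Prod>a\<leftarrow>as. [:- a, 1:]) \<noteq> (0 :: real poly)"
      by (auto simp: prod_list_zero_iff)
    then show ?case using Cons by (simp add: proots_mult del: mult_pCons_left)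
  qed simp
  ultimately show ?thesis by (simp only: M_def n_def)
qed

text \<open>
  The eigenfunctions can be enumerated in the order in which \<^const>\<open>kernel_eigenvalues\<close> lists the
  eigenvalues.
\<close>

lemma kernel_eigenvalues_orthonormal:
  "\<exists>\<phi>. orthonormal (card S) \<phi> \<and> length (kernel_eigenvalues S Q) = card S \<and>
     sorted (rev (kernel_eigenvalues S Q)) \<and>
     (\<forall>i<card S. \<forall>x\<in>S. kernel_op (\<phi> i) x = kernel_eigenvalues S Q ! i * \<phi> i x)"
proof -
  define n where "n = card S"
  obtain \<phi> e where o: "orthonormal n \<phi>" and ev: "\<And>i x. i < n \<Longrightarrow> x \<in> S \<Longrightarrow> kernel_op (\<phi> i) x = e i * \<phi> i x"
    using orthonormal_eigenfunctions[of "card S"] by (auto simp: n_def)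
  define L where "L = kernel_eigenvalues S Q"
  have "mset L = mset (map e [0..<n])"
    using proots_char_poly_kernel_mat[OF o[unfolded n_def] ev[unfolded n_def]]
    by (simp add: L_def kernel_eigenvalues_def n_def)
  from mset_eq_permutation[OF this] obtain p where
    p: "p permutes {..<n}" "permute_list p (map e [0..<n]) = L" by auto
  have len: "length L = n" using p(2) by auto
  have pn: "p i < n" if "i < n" for i using permutes_in_image[OF p(1)] that by auto
  have L: "L ! i = e (p i)" if "i < n" for i
    using permute_list_nth[of p "map e [0..<n]" i] p that pn by simp
  have inj: "p i = p j \<longleftrightarrow> i = j" for i j using permutes_inj[OF p(1)] by (auto dest: injD)
  have "orthonormal n (\<lambda>i. \<phi> (p i))" using o pn by (auto simp: orthonormal_def inj)
  moreover have "sorted (rev L)" by (simp add: L_def kernel_eigenvalues_def)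
  ultimately show ?thesis
    using len ev L pn by (intro exI[of _ "\<lambda>i. \<phi> (p i)"]) (auto simp: L_def n_def)
qed

end

section \<open>The spectral gap and Rayleigh quotients\<close>

text \<open>A Markov kernel that is reversible with respect to a probability weight of full support.\<close>

locale reversible_chain = self_adjoint_kernel +
  assumes row_sum: "x \<in> S \<Longrightarrow> (\<Sum>y\<in>S. Q x y) = 1"
    and Q_nonneg: "x \<in> S \<Longrightarrow> y \<in> S \<Longrightarrow> Q x y \<ge> 0"
    and \<mu>_sum: "(\<Sum>x\<in>S. \<mu> x) = 1"
begin

text \<open>The Dirichlet form and the variance of a function on the state space.\<close>

definition dirichlet :: "('a \<Rightarrow> real) \<Rightarrow> real" where
  "dirichlet f = ip f f - ip (kernel_op f) f"

definition var :: "('a \<Rightarrow> real) \<Rightarrow> real" where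
  "var f = ip f f - (ip f (\<lambda>_. 1))\<^sup>2"

lemma S_nonempty: "S \<noteq> {}"
  using \<mu>_sum by auto

lemma ip_one: "ip (\<lambda>_. 1) (\<lambda>_. 1) = 1"
  by (simp add: ip_def \<mu>_sum)

lemma kernel_op_one: "x \<in> S \<Longrightarrow> kernel_op (\<lambda>_. c) x = c"
  by (simp add: kernel_op_def row_sum sum_distrib_right[symmetric])

lemma dirichlet_altdef:
  "dirichlet f = (\<Sum>x\<in>S. \<Sum>y\<in>S. \<mu> x * Q x y * (f x - f y)\<^sup>2) / 2"
proof -
  have 1: "(\<Sum>x\<in>S. \<Sum>y\<in>S. \<mu> x * Q x y * (f x)\<^sup>2) = ip f f"
    unfolding ip_def
  proof (intro sum.cong refl)
    fix x assume x: "x \<in> S"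
    have "(\<Sum>y\<in>S. \<mu> x * Q x y * (f x)\<^sup>2) = \<mu> x * (f x)\<^sup>2 * (\<Sum>y\<in>S. Q x y)"
      unfolding sum_distrib_left by (simp only: mult_ac)
    then show "(\<Sum>y\<in>S. \<mu> x * Q x y * (f x)\<^sup>2) = \<mu> x * f x * f x"
      by (simp add: row_sum x power2_eq_square mult_ac)
  qed
  have "(\<Sum>x\<in>S. \<Sum>y\<in>S. \<mu> x * Q x y * (f y)\<^sup>2) = (\<Sum>x\<in>S. \<Sum>y\<in>S. \<mu> y * Q y x * (f y)\<^sup>2)"
    by (intro sum.cong refl) (simp add: detailed_balance)
  also have "\<dots> = (\<Sum>y\<in>S. \<Sum>x\<in>S. \<mu> y * Q y x * (f y)\<^sup>2)"
    by (rule sum.swap)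
  finally have 2: "(\<Sum>x\<in>S. \<Sum>y\<in>S. \<mu> x * Q x y * (f y)\<^sup>2) = ip f f"
    using 1 by simp
  have 3: "(\<Sum>x\<in>S. \<Sum>y\<in>S. \<mu> x * Q x y * (f x * f y)) = ip (kernel_op f) f"
    by (simp add: ip_def kernel_op_def sum_distrib_left sum_distrib_right mult_ac)
  have "(\<Sum>x\<in>S. \<Sum>y\<in>S. \<mu> x * Q x y * (f x - f y)\<^sup>2) =
     (\<Sum>x\<in>S. \<Sum>y\<in>S. \<mu> x * Q x y * (f x)\<^sup>2) + (\<Sum>x\<in>S. \<Sum>y\<in>S. \<mu> x * Q x y * (f y)\<^sup>2)
     - 2 * (\<Sum>x\<in>S. \<Sum>y\<in>S. \<mu> x * Q x y * (f x * f y))"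
    by (simp add: power2_diff sum.distrib sum_subtractf sum_distrib_left algebra_simps)
  then show ?thesis using 1 2 3 by (simp add: dirichlet_def)
qed

lemma dirichlet_nonneg: "dirichlet f \<ge> 0"
  unfolding dirichlet_altdef using \<mu>_pos Q_nonneg
  by (auto intro!: sum_nonneg mult_nonneg_nonneg dest: less_imp_le)

lemma eigenfunction_expansion:
  assumes o: "orthonormal (card S) \<phi>" and x: "x \<in> S"
  shows "v x = (\<Sum>i<card S. ip v (\<phi> i) * \<phi> i x)"
proof -
  have "(\<Sum>i<card S. ip v (\<phi> i) * \<phi> i x) =
      (\<Sum>y\<in>S. \<Sum>i<card S. v y * (\<phi> i x * (\<mu> y * \<phi> i y)))"
    by (subst sum.swap) (simp add: ip_def sum_distrib_left sum_distrib_right mult_ac)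
  also have "\<dots> = (\<Sum>y\<in>S. if y = x then v x else 0)"
    using orthonormal_complete[OF o x] by (intro sum.cong) (auto simp: sum_distrib_left[symmetric])
  finally show ?thesis using x finite_S by simp
qed

lemma parseval:
  assumes o: "orthonormal (card S) \<phi>"
  shows "ip v w = (\<Sum>i<card S. ip v (\<phi> i) * ip w (\<phi> i))"
proof -
  have "ip v w = ip v (\<lambda>x. \<Sum>i<card S. ip w (\<phi> i) * \<phi> i x)"
    by (intro ip_cong eigenfunction_expansion[OF o]) auto
  also have "\<dots> = (\<Sum>i<card S. ip v (\<phi> i) * ip w (\<phi> i))"
    by (simp only: ip_sum_right ip_scale_right) (simp add: mult.commute)
  finally show ?thesis .
qed

text \<open>
  A Poincare inequality bounds the second eigenvalue: the span of the first two eigenfunctions contains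
  a nonzero function of mean zero.
\<close>

lemma second_eigenvalue_le:
  assumes card: "card S \<ge> 2" and c: "\<And>f. c * var f \<le> dirichlet f"
  shows "kernel_eigenvalues S Q ! 1 \<le> 1 - c"
proof -
  define L where "L i = kernel_eigenvalues S Q ! i" for i
  obtain \<phi> where o: "orthonormal (card S) \<phi>" and len: "length (kernel_eigenvalues S Q) = card S"
    and srt: "sorted (rev (kernel_eigenvalues S Q))"
    and ev: "\<And>i x. i < card S \<Longrightarrow> x \<in> S \<Longrightarrow> kernel_op (\<phi> i) x = L i * \<phi> i x"
    using kernel_eigenvalues_orthonormal unfolding L_def by blast
  have L01: "L 1 \<le> L 0"
    using sorted_rev_nth_mono[OF srt, of 0 1] card len by (simp add: L_def)
  define a where "a = ip (\<phi> 0) (\<lambda>_. 1)"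
  define b where "b = ip (\<phi> 1) (\<lambda>_. 1)"
  define s where "s = (if a = 0 \<and> b = 0 then 0 else b)"
  define t where "t = (if a = 0 \<and> b = 0 then 1 else - a)"
  define g where "g = (\<lambda>x. s * \<phi> 0 x + t * \<phi> 1 x)"
  have pos: "s\<^sup>2 + t\<^sup>2 > 0" and orth: "s * a + t * b = 0"
    by (auto simp: s_def t_def sum_power2_gt_zero_iff)
  have on: "ip (\<phi> 0) (\<phi> 0) = 1" "ip (\<phi> 1) (\<phi> 1) = 1" "ip (\<phi> 0) (\<phi> 1) = 0" "ip (\<phi> 1) (\<phi> 0) = 0"
    using o card by (auto simp: orthonormal_def)
  have gg: "ip g g = s\<^sup>2 + t\<^sup>2"
    by (simp only: g_def ip_lin on) (simp add: power2_eq_square)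
  have "ip g (\<lambda>_. 1) = s * a + t * b" by (simp add: g_def ip_lin a_def b_def)
  then have var: "var g = s\<^sup>2 + t\<^sup>2" by (simp add: var_def gg orth)
  have "ip (kernel_op g) g = ip (\<lambda>x. s * (L 0 * \<phi> 0 x) + t * (L 1 * \<phi> 1 x)) g"
    using ev card by (intro ip_cong) (auto simp: g_def kernel_op_lin)
  also have "\<dots> = L 0 * s\<^sup>2 + L 1 * t\<^sup>2"
    by (simp only: g_def ip_lin on) (simp add: power2_eq_square)
  finally have "dirichlet g = (s\<^sup>2 + t\<^sup>2) - (L 0 * s\<^sup>2 + L 1 * t\<^sup>2)"
    by (simp add: dirichlet_def gg)
  also have "\<dots> \<le> (1 - L 1) * (s\<^sup>2 + t\<^sup>2)"
    using mult_right_mono[OF L01, of "s\<^sup>2"] by (simp add: algebra_simps)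
  finally have "c * (s\<^sup>2 + t\<^sup>2) \<le> (1 - L 1) * (s\<^sup>2 + t\<^sup>2)"
    using c[of g] var by simp
  then show ?thesis using pos by (simp add: L_def)
qed

lemma var_nonneg: "var f \<ge> 0"
proof -
  have "ip (\<lambda>x. f x - ip f (\<lambda>_. 1) * 1) (\<lambda>x. f x - ip f (\<lambda>_. 1) * 1) = var f"
    by (simp only: ip_lin ip_one ip_commute[of "\<lambda>_. 1" f]) (simp add: var_def power2_eq_square algebra_simps)
  then show ?thesis using ip_nonneg by metis
qed

lemma gap_ge:
  assumes "card S \<ge> 2" "\<And>f. c * var f \<le> dirichlet f"
  shows "c \<le> gap S Q"
  using second_eigenvalue_le[OF assms] assms(1) by (simp add: gap_def)

lemma gap_nonneg: "gap S Q \<ge> 0"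
proof (cases "card S = 1")
  case False
  then have "card S \<ge> 2"
    using S_nonempty finite_S by (cases "card S") auto
  then show ?thesis using gap_ge[of 0] dirichlet_nonneg by simp
qed (simp add: gap_def)

text \<open>
  Conversely, the gap is at most every Rayleigh quotient \<open>dirichlet f / var f\<close>. The span of the constant
  \<open>1\<close> and the centred function \<open>h\<close> contains a nonzero function \<open>v\<close> orthogonal to the first eigenfunction, and on
  such functions the form of \<open>Q\<close> is at most the second eigenvalue times the squared norm.
\<close>

lemma gap_var_le: "gap S Q * var f \<le> dirichlet f"
proof (cases "card S = 1")
  case True
  then obtain x where x: "S = {x}" by (auto simp: card_1_singleton_iff)
  then have "var f = 0" using \<mu>_sum unfolding var_def ip_def unfolding x by (simp add: power2_eq_square)
  then show ?thesis using dirichlet_nonneg by simp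
next
  case False
  then have card: "card S \<ge> 2"
    using S_nonempty finite_S by (cases "card S") auto
  define L where "L i = kernel_eigenvalues S Q ! i" for i
  obtain \<phi> where o: "orthonormal (card S) \<phi>" and len: "length (kernel_eigenvalues S Q) = card S"
    and srt: "sorted (rev (kernel_eigenvalues S Q))"
    and ev: "\<And>i x. i < card S \<Longrightarrow> x \<in> S \<Longrightarrow> kernel_op (\<phi> i) x = L i * \<phi> i x"
    using kernel_eigenvalues_orthonormal unfolding L_def by blast
  have L1: "L i \<le> L 1" if "1 \<le> i" "i < card S" for i
    using sorted_rev_nth_mono[OF srt, of 1 i] that len by (simp add: L_def)
  have gap: "gap S Q = 1 - L 1" using False by (simp add: gap_def L_def)
  have minmax: "ip (kernel_op v) v \<le> L 1 * ip v v" if v: "ip v (\<phi> 0) = 0" for v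
  proof -
    have Tv: "ip (kernel_op v) (\<phi> i) = L i * ip v (\<phi> i)" if "i < card S" for i
    proof -
      have "ip v (kernel_op (\<phi> i)) = ip v (\<lambda>x. L i * \<phi> i x)" using ev that by (intro ip_cong) auto
      then show ?thesis by (simp add: kernel_op_self_adjoint ip_lin)
    qed
    have "ip (kernel_op v) v = (\<Sum>i<card S. L i * (ip v (\<phi> i))\<^sup>2)"
      by (subst parseval[OF o]) (intro sum.cong, auto simp: Tv power2_eq_square)
    also have "\<dots> \<le> (\<Sum>i<card S. L 1 * (ip v (\<phi> i))\<^sup>2)"
    proof (rule sum_mono)
      fix i assume "i \<in> {..<card S}"
      then show "L i * (ip v (\<phi> i))\<^sup>2 \<le> L 1 * (ip v (\<phi> i))\<^sup>2"
        using v L1[of i] by (cases "i = 0") (auto intro: mult_right_mono)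
    qed
    also have "\<dots> = L 1 * ip v v"
      by (subst parseval[OF o]) (simp add: sum_distrib_left power2_eq_square)
    finally show ?thesis .
  qed
  define m where "m = ip f (\<lambda>_. 1)"
  define h where "h = (\<lambda>x. f x - m * 1)"
  define V where "V = ip h h"
  define D where "D = dirichlet f"
  have V: "V = var f"
    unfolding V_def h_def by (simp only: ip_lin ip_one ip_commute[of "\<lambda>_. 1" f])
      (simp add: var_def power2_eq_square algebra_simps m_def)
  have h1: "ip h (\<lambda>_. 1) = 0" unfolding h_def by (simp only: ip_lin ip_one) (simp add: m_def)
  have "dirichlet h = D" unfolding D_def dirichlet_altdef h_def by simp
  then have Th: "ip (kernel_op h) h = V - D" by (simp add: dirichlet_def V_def)
  define \<alpha> where "\<alpha> = ip (\<lambda>_. 1) (\<phi> 0)"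
  define \<beta> where "\<beta> = ip h (\<phi> 0)"
  define a where "a = (if \<alpha> = 0 \<and> \<beta> = 0 then 0 else \<beta>)"
  define b where "b = (if \<alpha> = 0 \<and> \<beta> = 0 then 1 else - \<alpha>)"
  have ab: "a * \<alpha> + b * \<beta> = 0" "a \<noteq> 0 \<or> b \<noteq> 0" by (auto simp: a_def b_def)
  define v where "v = (\<lambda>x. a * 1 + b * h x)"
  have "ip v (\<phi> 0) = 0"
    unfolding v_def by (simp only: ip_lin \<alpha>_def[symmetric] \<beta>_def[symmetric] ab)
  moreover have vv: "ip v v = a\<^sup>2 + b\<^sup>2 * V"
    unfolding v_def by (simp only: ip_lin ip_one h1 ip_commute[of "\<lambda>_. 1" h] V_def[symmetric])
      (simp add: power2_eq_square algebra_simps)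
  moreover have "ip (kernel_op v) v = a\<^sup>2 + b\<^sup>2 * (V - D)"
  proof -
    have "ip (kernel_op v) v = ip (\<lambda>x. a * 1 + b * kernel_op h x) v"
      using kernel_op_one[of _ 1] by (intro ip_cong) (auto simp: v_def kernel_op_lin simp del: mult_1_right)
    moreover have "ip (kernel_op h) (\<lambda>_. 1) = ip h (kernel_op (\<lambda>_. 1))" by (rule kernel_op_self_adjoint)
    moreover have "ip h (kernel_op (\<lambda>_. 1)) = ip h (\<lambda>_. 1)" by (intro ip_cong) (auto simp: kernel_op_one)
    ultimately have "ip (kernel_op v) v = a * (a * 1) + b * (b * (V - D))"
      unfolding v_def by (simp only: ip_lin ip_one h1 ip_commute[of "\<lambda>_. 1" h] Th) simp
    then show ?thesis by (simp add: power2_eq_square)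
  qed
  ultimately have key: "(1 - L 1) * a\<^sup>2 + b\<^sup>2 * ((1 - L 1) * V) \<le> b\<^sup>2 * D"
    using minmax[of v] by (simp add: algebra_simps)
  have L1': "1 - L 1 \<ge> 0" using gap_nonneg gap by simp
  have "(1 - L 1) * V \<le> D"
  proof (cases "b = 0")
    case True
    then have "L 1 = 1" using key ab(2) L1' by (simp add: mult_le_0_iff)
    then show ?thesis using dirichlet_nonneg by (simp add: D_def)
  next
    case False
    then have "b\<^sup>2 * ((1 - L 1) * V) \<le> b\<^sup>2 * D"
      using key mult_nonneg_nonneg[OF L1' zero_le_power2[of a]] by linarith
    then show ?thesis using False by (simp add: mult_le_cancel_left)
  qed
  then show ?thesis by (simp add: gap V D_def)
qed

text \<open>If \<open>f\<close> vanishes at \<open>z\<close>, the Cauchy--Schwarz inequality on \<open>S - {z}\<close> gives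
  \<open>(E f)\<^sup>2 \<le> (1 - \<mu> z) E f\<^sup>2\<close>.\<close>

lemma var_ge_of_zero:
  assumes z: "z \<in> S" and fz: "f z = 0"
  shows "\<mu> z * ip f f \<le> var f"
proof -
  have "(ip f (\<lambda>_. 1))\<^sup>2 = (\<Sum>x\<in>S-{z}. (sqrt (\<mu> x) * f x) * sqrt (\<mu> x))\<^sup>2"
  proof -
    have "ip f (\<lambda>_. 1) = (\<Sum>x\<in>S-{z}. \<mu> x * f x)"
      unfolding ip_def using z fz finite_S by (simp add: sum.remove[of S z])
    also have "\<dots> = (\<Sum>x\<in>S-{z}. (sqrt (\<mu> x) * f x) * sqrt (\<mu> x))"
      using \<mu>_pos by (intro sum.cong) (auto simp: mult.commute mult.left_commute less_imp_le simp flip: mult.assoc)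
    finally show ?thesis by simp
  qed
  also have "\<dots> \<le> (\<Sum>x\<in>S-{z}. (sqrt (\<mu> x) * f x)\<^sup>2) * (\<Sum>x\<in>S-{z}. (sqrt (\<mu> x))\<^sup>2)"
    by (rule Cauchy_Schwarz_ineq_sum)
  also have "(\<Sum>x\<in>S-{z}. (sqrt (\<mu> x) * f x)\<^sup>2) = (\<Sum>x\<in>S-{z}. \<mu> x * f x * f x)"
    using \<mu>_pos by (intro sum.cong) (auto simp: power_mult_distrib less_imp_le power2_eq_square[of "f _"])
  also have "\<dots> = ip f f" unfolding ip_def using z fz finite_S by (simp add: sum.remove[of S z])
  also have "(\<Sum>x\<in>S-{z}. (sqrt (\<mu> x))\<^sup>2) = (\<Sum>x\<in>S-{z}. \<mu> x)"
    using \<mu>_pos by (intro sum.cong) (auto simp: less_imp_le)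
  also have "\<dots> = 1 - \<mu> z" using \<mu>_sum z finite_S by (simp add: sum.remove[of S z])
  finally show ?thesis by (simp add: var_def algebra_simps)
qed

end

section \<open>Paths of the chain and the count kernel\<close>

lemma irreducible_reversible_support:
  assumes "irreducible_reversible \<Omega> P \<pi>"
  shows "set_pmf \<pi> = \<Omega>"
proof
  show sub: "set_pmf \<pi> \<subseteq> \<Omega>"
    using assms by (simp add: irreducible_reversible_def stationary_law_def)
  obtain x where x: "x \<in> set_pmf \<pi>" using set_pmf_not_empty[of \<pi>] by blast
  show "\<Omega> \<subseteq> set_pmf \<pi>"
  proof
    fix y assume y: "y \<in> \<Omega>"
    have "(x, y) \<in> {(a, b). pmf (P a) b > 0}\<^sup>*"
      using assms x y sub by (auto simp: irreducible_reversible_def irreducible_kernel_def)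
    then show "y \<in> set_pmf \<pi>"
    proof (induction rule: rtrancl_induct)
      case base
      then show ?case by (rule x)
    next
      case (step y z)
      have "z \<in> set_pmf (P y)" using step by (simp add: set_pmf_iff)
      then have "z \<in> set_pmf (bind_pmf \<pi> P)" using step.IH by auto
      then show ?case
        using assms by (simp del: set_bind_pmf add: irreducible_reversible_def stationary_law_def)
    qed
  qed
qed

lemma irreducible_reversible_detailed_balance:
  assumes "irreducible_reversible \<Omega> P \<pi>"
  shows "pmf \<pi> x * pmf (P x) y = pmf \<pi> y * pmf (P y) x"
proof -
  have supp: "set_pmf \<pi> = \<Omega>" by (rule irreducible_reversible_support[OF assms])
  have out: "pmf \<pi> u * pmf (P u) v = pmf \<pi> v * pmf (P v) u" if "u \<in> \<Omega>" "v \<notin> \<Omega>" for u v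
  proof -
    have "v \<notin> set_pmf (P u)"
      using assms that by (auto simp: irreducible_reversible_def markov_kernel_def)
    moreover have "v \<notin> set_pmf \<pi>" using that supp by simp
    ultimately show ?thesis by (simp add: set_pmf_iff)
  qed
  have in\<pi>: "pmf \<pi> u = 0" if "u \<notin> \<Omega>" for u using that supp by (simp add: pmf_eq_0_set_pmf)
  consider "x \<in> \<Omega>" "y \<in> \<Omega>" | "x \<in> \<Omega>" "y \<notin> \<Omega>" | "x \<notin> \<Omega>" "y \<in> \<Omega>" | "x \<notin> \<Omega>" "y \<notin> \<Omega>" by blast
  then show ?thesis
  proof cases
    case 1
    then show ?thesis using assms by (simp add: irreducible_reversible_def reversible_kernel_def)
  next
    case 2
    then show ?thesis by (rule out)
  next
    case 3
    then show ?thesis using out[of y x] by simp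
  qed (simp add: in\<pi>)
qed

lemma irreducible_reversible_chain:
  assumes ir: "irreducible_reversible \<Omega> P \<pi>"
  shows "reversible_chain \<Omega> (pmf \<pi>) (\<lambda>x y. pmf (P x) y)"
proof
  have fin: "finite \<Omega>" and P: "\<And>x. x \<in> \<Omega> \<Longrightarrow> set_pmf (P x) \<subseteq> \<Omega>"
    using ir by (auto simp: irreducible_reversible_def markov_kernel_def)
  show "finite \<Omega>" by (rule fin)
  show "pmf \<pi> x > 0" if "x \<in> \<Omega>" for x
    using that irreducible_reversible_support[OF ir] by (simp add: pmf_positive)
  show "pmf \<pi> x * pmf (P x) y = pmf \<pi> y * pmf (P y) x" for x y
    by (rule irreducible_reversible_detailed_balance[OF ir])
  show "(\<Sum>y\<in>\<Omega>. pmf (P x) y) = 1" if "x \<in> \<Omega>" for x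
    using P[OF that] fin by (intro sum_pmf_eq_1)
  show "(\<Sum>x\<in>\<Omega>. pmf \<pi> x) = 1"
    using irreducible_reversible_support[OF ir] fin by (intro sum_pmf_eq_1) auto
qed simp

lemma length_walk: "xs \<in> set_pmf (walk P n x) \<Longrightarrow> length xs = Suc n"
  by (induction n arbitrary: xs x) auto

lemma length_chain_law: "xs \<in> set_pmf (chain_law P \<pi> n) \<Longrightarrow> length xs = Suc n"
  by (auto simp: chain_law_def length_walk)

lemma set_walk: 
  assumes "\<And>x. x \<in> \<Omega> \<Longrightarrow> set_pmf (P x) \<subseteq> \<Omega>"
  shows "x \<in> \<Omega> \<Longrightarrow> xs \<in> set_pmf (walk P n x) \<Longrightarrow> set xs \<subseteq> \<Omega>"
proof (induction n arbitrary: xs x)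
  case (Suc n)
  then show ?case using assms[OF Suc.prems(1)] by fastforce
qed auto

lemma finite_walk:
  assumes "finite \<Omega>" "\<And>x. x \<in> \<Omega> \<Longrightarrow> set_pmf (P x) \<subseteq> \<Omega>" "x \<in> \<Omega>"
  shows "finite (set_pmf (walk P n x))"
proof (rule finite_subset[OF _ finite_lists_length_eq[OF assms(1), of "Suc n"]])
  show "set_pmf (walk P n x) \<subseteq> {xs. set xs \<subseteq> \<Omega> \<and> length xs = Suc n}"
    using set_walk[of \<Omega> P x _ n, OF assms(2,3)] length_walk[of _ P n x] by blast
qed

lemma finite_chain_law:
  assumes "finite \<Omega>" "\<And>x. x \<in> \<Omega> \<Longrightarrow> set_pmf (P x) \<subseteq> \<Omega>" "set_pmf \<pi> \<subseteq> \<Omega>"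
  shows "finite (set_pmf (chain_law P \<pi> n))"
proof -
  have "finite (set_pmf (walk P n x))" if "x \<in> set_pmf \<pi>" for x
    using finite_walk[of \<Omega> P x n] assms that by blast
  then show ?thesis
    using finite_subset[OF assms(3,1)] by (auto simp: chain_law_def)
qed

lemma pmf_chain_law_rev:
  assumes db: "\<And>x y. pmf \<pi> x * pmf (P x) y = pmf \<pi> y * pmf (P y) x"
  shows "length xs = Suc n \<Longrightarrow> pmf (chain_law P \<pi> n) (rev xs) = pmf (chain_law P \<pi> n) xs"
proof (induction n arbitrary: xs)
  case 0
  then show ?case by (cases xs) auto
next
  case (Suc n)
  then obtain x y zs where xs: "xs = x # y # zs" "length zs = n"
    by (cases xs; cases "tl xs") auto
  have "pmf (chain_law P \<pi> (Suc n)) (x # y # zs) =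
      pmf \<pi> x * pmf (P x) y * pmf (walk P n y) (y # zs)"
    unfolding chain_law_def pmf_bind_walk walk.simps(2) pmf_map_Cons by simp
  also have "\<dots> = pmf (chain_law P \<pi> n) (y # zs) * pmf (P y) x"
    unfolding chain_law_def pmf_bind_walk db[of x y] by simp
  also have "\<dots> = pmf (chain_law P \<pi> n) (rev zs @ [y]) * pmf (P y) x"
    using Suc.IH[of "y # zs"] xs by simp
  also have "\<dots> = pmf (chain_law P \<pi> (Suc n)) (rev xs)"
    using pmf_chain_law_snoc[of "rev zs" n P \<pi> y x] xs by simp
  finally show ?case using xs by simp
qed

lemma map_rev_chain_law:
  assumes db: "\<And>x y. pmf \<pi> x * pmf (P x) y = pmf \<pi> y * pmf (P y) x"
  shows "map_pmf rev (chain_law P \<pi> n) = chain_law P \<pi> n"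
proof (rule pmf_eqI)
  fix xs
  have "pmf (map_pmf rev (chain_law P \<pi> n)) (rev (rev xs)) = pmf (chain_law P \<pi> n) (rev xs)"
    by (rule pmf_map_inj') (auto intro: injI)
  also have "\<dots> = pmf (chain_law P \<pi> n) xs"
  proof (cases "length xs = Suc n")
    case False
    then have "xs \<notin> set_pmf (chain_law P \<pi> n)" "rev xs \<notin> set_pmf (chain_law P \<pi> n)"
      using length_chain_law by fastforce+
    then show ?thesis by (simp add: set_pmf_iff)
  qed (rule pmf_chain_law_rev[OF db])
  finally show "pmf (map_pmf rev (chain_law P \<pi> n)) xs = pmf (chain_law P \<pi> n) xs" by simp
qed

lemma window_count_rev:
  assumes "length xs = Suc n"
  shows "window_count n 0 (rev xs) = window_count n 1 xs"
proof
  fix x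
  have "window_count n 0 (rev xs) x = (\<Sum>j<n. of_bool (xs ! (1 + (n - Suc j)) = x))"
    unfolding window_count_def using assms by (intro sum.cong) (auto simp: rev_nth Suc_diff_Suc)
  also have "\<dots> = window_count n 1 xs x"
    unfolding window_count_def by (rule sum.nat_diff_reindex)
  finally show "window_count n 0 (rev xs) x = window_count n 1 xs x" .
qed

text \<open>
  Reversing the path exchanges the two windows, so the joint law of their counts is symmetric. In
  particular the two counts have the same law.
\<close>

lemma count_joint_law_swap:
  assumes db: "\<And>x y. pmf \<pi> x * pmf (P x) y = pmf \<pi> y * pmf (P y) x"
  shows "map_pmf prod.swap (count_joint_law P \<pi> n) = count_joint_law P \<pi> n"
proof -
  have "count_joint_law P \<pi> n =
      map_pmf (\<lambda>xs. (window_count n 0 xs, window_count n 1 xs)) (map_pmf rev (chain_law P \<pi> n))"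
    by (simp add: count_joint_law_def map_rev_chain_law[OF db])
  also have "\<dots> = map_pmf prod.swap (count_joint_law P \<pi> n)"
    unfolding count_joint_law_def map_pmf_comp
  proof (rule map_pmf_cong)
    fix xs assume "xs \<in> set_pmf (chain_law P \<pi> n)"
    then have "length xs = Suc n" by (rule length_chain_law)
    then show "(window_count n 0 (rev xs), window_count n 1 (rev xs)) =
        prod.swap (window_count n 0 xs, window_count n 1 xs)"
      using window_count_rev[of xs n] window_count_rev[of "rev xs" n] by simp
  qed simp
  finally show ?thesis by simp
qed

lemma map_fst_count_joint_law: "map_pmf fst (count_joint_law P \<pi> n) = count_law P \<pi> n"
  by (simp add: count_joint_law_def count_law_def map_pmf_comp)

lemma map_snd_count_joint_law:
  assumes db: "\<And>x y. pmf \<pi> x * pmf (P x) y = pmf \<pi> y * pmf (P y) x"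
  shows "map_pmf snd (count_joint_law P \<pi> n) = count_law P \<pi> n"
proof -
  have "map_pmf snd (count_joint_law P \<pi> n) = map_pmf fst (map_pmf prod.swap (count_joint_law P \<pi> n))"
    by (simp add: map_pmf_comp)
  then show ?thesis by (simp add: count_joint_law_swap[OF db] map_fst_count_joint_law)
qed

lemma set_count_joint_law:
  assumes db: "\<And>x y. pmf \<pi> x * pmf (P x) y = pmf \<pi> y * pmf (P y) x"
  shows "set_pmf (count_joint_law P \<pi> n) \<subseteq> set_pmf (count_law P \<pi> n) \<times> set_pmf (count_law P \<pi> n)"
proof
  fix z assume z: "z \<in> set_pmf (count_joint_law P \<pi> n)"
  then have "fst z \<in> set_pmf (map_pmf fst (count_joint_law P \<pi> n))"
    "snd z \<in> set_pmf (map_pmf snd (count_joint_law P \<pi> n))" by auto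
  then show "z \<in> set_pmf (count_law P \<pi> n) \<times> set_pmf (count_law P \<pi> n)"
    unfolding map_fst_count_joint_law map_snd_count_joint_law[OF db] by (simp add: mem_Times_iff)
qed

lemma finite_count_law:
  assumes ir: "irreducible_reversible \<Omega> P \<pi>"
  shows "finite (set_pmf (count_law P \<pi> n))"
  using ir irreducible_reversible_support[OF ir]
  by (auto simp: count_law_def irreducible_reversible_def markov_kernel_def intro!: finite_imageI finite_chain_law[of \<Omega>])

lemma count_kernel_reversible_chain:
  assumes ir: "irreducible_reversible \<Omega> P \<pi>"
  shows "reversible_chain (set_pmf (count_law P \<pi> n)) (pmf (count_law P \<pi> n)) (count_kernel P \<pi> n)"
proof
  let ?S = "set_pmf (count_law P \<pi> n)" and ?J = "count_joint_law P \<pi> n"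
  note db = irreducible_reversible_detailed_balance[OF ir]
  show fin: "finite ?S" by (rule finite_count_law[OF ir])
  show pos: "pmf (count_law P \<pi> n) k > 0" if "k \<in> ?S" for k
    using that by (rule pmf_positive)
  have sym: "pmf ?J (k, l) = pmf ?J (l, k)" for k l
  proof -
    have "pmf (map_pmf prod.swap ?J) (prod.swap (k, l)) = pmf ?J (k, l)"
      by (rule pmf_map_inj') (auto intro: injI)
    then show ?thesis by (simp add: count_joint_law_swap[OF db])
  qed
  show "pmf (count_law P \<pi> n) k * count_kernel P \<pi> n k l =
      pmf (count_law P \<pi> n) l * count_kernel P \<pi> n l k" if "k \<in> ?S" "l \<in> ?S" for k l
    using pos[OF that(1)] pos[OF that(2)] sym[of k l] by (simp add: count_kernel_def)
  show "(\<Sum>l\<in>?S. count_kernel P \<pi> n k l) = 1" if k: "k \<in> ?S" for k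
  proof -
    have "pmf (count_law P \<pi> n) k = measure ?J (fst -` {k})"
      by (simp add: map_fst_count_joint_law[symmetric] pmf_map)
    also have "\<dots> = measure ?J (fst -` {k} \<inter> set_pmf ?J)"
      by (rule measure_Int_set_pmf[symmetric])
    also have "fst -` {k} \<inter> set_pmf ?J = ({k} \<times> ?S) \<inter> set_pmf ?J"
      using set_count_joint_law[OF db, of n] by auto
    also have "measure ?J \<dots> = measure ?J ({k} \<times> ?S)"
      by (rule measure_Int_set_pmf)
    also have "\<dots> = (\<Sum>z\<in>{k} \<times> ?S. pmf ?J z)"
      using fin by (simp add: measure_measure_pmf_finite)
    also have "\<dots> = (\<Sum>l\<in>?S. pmf ?J (k, l))"
      by (simp add: sum.cartesian_product')
    finally show ?thesis
      using pos[OF k] by (simp add: count_kernel_def sum_divide_distrib[symmetric])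
  qed
  show "(\<Sum>k\<in>?S. pmf (count_law P \<pi> n) k) = 1"
    using fin by (intro sum_pmf_eq_1) auto
qed (simp add: count_kernel_def)

text \<open>
  The variational bound for the count kernel, in terms of the law of the path. A path \<open>ys\<close> at whose count
  \<open>f\<close> vanishes serves to bound the variance of \<open>f\<close> from below by its second moment.
\<close>

lemma count_gap_le:
  assumes ir: "irreducible_reversible \<Omega> P \<pi>"
    and zero: "f (window_count n 0 ys) = 0"
  shows "gap (set_pmf (count_law P \<pi> n)) (count_kernel P \<pi> n) *
      (pmf (chain_law P \<pi> n) ys *
        measure_pmf.expectation (chain_law P \<pi> n) (\<lambda>xs. (f (window_count n 1 xs))\<^sup>2))
    \<le> measure_pmf.expectation (chain_law P \<pi> n)
        (\<lambda>xs. (f (window_count n 0 xs) - f (window_count n 1 xs))\<^sup>2) / 2"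
proof -
  let ?S = "set_pmf (count_law P \<pi> n)" and ?J = "count_joint_law P \<pi> n"
  let ?C = "chain_law P \<pi> n"
  note db = irreducible_reversible_detailed_balance[OF ir]
  interpret reversible_chain ?S "pmf (count_law P \<pi> n)" "count_kernel P \<pi> n"
    by (rule count_kernel_reversible_chain[OF ir])
  have "dirichlet f = (\<Sum>k\<in>?S. \<Sum>l\<in>?S. (f k - f l)\<^sup>2 * pmf ?J (k, l)) / 2"
  proof -
    have "pmf (count_law P \<pi> n) k * count_kernel P \<pi> n k l = pmf ?J (k, l)" if "k \<in> ?S" for k l
      using \<mu>_pos[OF that] by (simp add: count_kernel_def)
    then have "(\<Sum>k\<in>?S. \<Sum>l\<in>?S. pmf (count_law P \<pi> n) k * count_kernel P \<pi> n k l * (f k - f l)\<^sup>2) =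
        (\<Sum>k\<in>?S. \<Sum>l\<in>?S. (f k - f l)\<^sup>2 * pmf ?J (k, l))"
      by (intro sum.cong refl) (simp add: mult.commute)
    then show ?thesis unfolding dirichlet_altdef by simp
  qed
  also have "(\<Sum>k\<in>?S. \<Sum>l\<in>?S. (f k - f l)\<^sup>2 * pmf ?J (k, l)) =
      (\<Sum>z\<in>?S \<times> ?S. (f (fst z) - f (snd z))\<^sup>2 * pmf ?J z)"
    by (simp add: sum.cartesian_product case_prod_beta)
  also have "\<dots> = measure_pmf.expectation ?J (\<lambda>z. (f (fst z) - f (snd z))\<^sup>2)"
    using finite_S set_count_joint_law[OF db, of n]
    by (intro integral_measure_pmf_real[symmetric]) auto
  also have "\<dots> = measure_pmf.expectation ?C
      (\<lambda>xs. (f (window_count n 0 xs) - f (window_count n 1 xs))\<^sup>2)"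
    by (simp add: count_joint_law_def)
  finally have D: "dirichlet f = measure_pmf.expectation ?C
      (\<lambda>xs. (f (window_count n 0 xs) - f (window_count n 1 xs))\<^sup>2) / 2" .
  have "ip f f = (\<Sum>k\<in>?S. (f k)\<^sup>2 * pmf (count_law P \<pi> n) k)"
    by (simp add: ip_def power2_eq_square mult_ac)
  also have "\<dots> = measure_pmf.expectation (map_pmf snd ?J) (\<lambda>k. (f k)\<^sup>2)"
    using finite_S unfolding map_snd_count_joint_law[OF db]
    by (intro integral_measure_pmf_real[symmetric]) auto
  also have "\<dots> = measure_pmf.expectation ?C (\<lambda>xs. (f (window_count n 1 xs))\<^sup>2)"
    by (simp add: count_joint_law_def)
  finally have I: "ip f f = measure_pmf.expectation ?C (\<lambda>xs. (f (window_count n 1 xs))\<^sup>2)" .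
  have "pmf ?C ys * ip f f \<le> var f"
  proof (cases "pmf ?C ys = 0")
    case True
    then show ?thesis using var_nonneg by simp
  next
    case False
    have "ys \<in> set_pmf ?C" using False by (simp add: set_pmf_iff)
    then have z: "window_count n 0 ys \<in> ?S" by (simp add: count_law_def)
    have "pmf ?C ys = measure ?C {ys}" by (simp add: measure_pmf_single)
    also have "\<dots> \<le> measure ?C (window_count n 0 -` {window_count n 0 ys})"
      by (rule measure_pmf.finite_measure_mono) auto
    also have "\<dots> = pmf (count_law P \<pi> n) (window_count n 0 ys)"
      by (simp add: count_law_def pmf_map)
    finally have "pmf ?C ys * ip f f \<le> pmf (count_law P \<pi> n) (window_count n 0 ys) * ip f f"
      using ip_nonneg by (intro mult_right_mono)
    also have "\<dots> \<le> var f" by (intro var_ge_of_zero z zero)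
    finally show ?thesis .
  qed
  then have "gap ?S (count_kernel P \<pi> n) * (pmf ?C ys * ip f f) \<le> gap ?S (count_kernel P \<pi> n) * var f"
    using gap_nonneg by (intro mult_left_mono)
  also have "\<dots> \<le> dirichlet f" by (rule gap_var_le)
  finally show ?thesis unfolding D I .
qed

lemma gap_ratio_nonneg:
  assumes ir: "irreducible_reversible \<Omega> P \<pi>"
  shows "gap_ratio \<Omega> P \<pi> n \<ge> 0"
  unfolding gap_ratio_def
  using reversible_chain.gap_nonneg[OF irreducible_reversible_chain[OF ir]]
    reversible_chain.gap_nonneg[OF count_kernel_reversible_chain[OF ir, of n]]
  by simp

section \<open>The hierarchical kernel\<close>

text \<open>
  The off-diagonal entries of the kernel on \<open>{0..N}\<close>. A state is left downwards to its neighbour with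
  probability \<open>p\<close> and to any other lower state with probability \<open>\<epsilon>\<close>; the entries above the diagonal make the weight
  \<open>\<epsilon>\<^bsup>x\<^esup>\<close> reversible. The diagonal is filled up so that rows sum to one. At \<open>\<epsilon> = 0\<close> only steps \<open>x \<rightarrow> x - 1\<close> are
  left, with probability \<open>p\<close>, and the state \<open>0\<close> is absorbing.
\<close>

definition jump :: "real \<Rightarrow> real \<Rightarrow> nat \<Rightarrow> nat \<Rightarrow> real" where
  "jump p \<epsilon> x y =
     (if y < x then if x = Suc y then p else \<epsilon>
      else if x < y then \<epsilon> ^ (y - x) * (if y = Suc x then p else \<epsilon>) else 0)"

definition hkernel :: "nat \<Rightarrow> real \<Rightarrow> real \<Rightarrow> nat \<Rightarrow> nat \<Rightarrow> real" where
  "hkernel N p \<epsilon> x y = (if x = y then 1 - (\<Sum>z\<le>N. jump p \<epsilon> x z) else jump p \<epsilon> x y)"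

lemma jump_balance: "\<epsilon> ^ x * jump p \<epsilon> x y = \<epsilon> ^ y * jump p \<epsilon> y x"
proof -
  have "\<epsilon> ^ x * \<epsilon> ^ (y - x) = \<epsilon> ^ y" if "x < y" for x y
    using that by (simp flip: power_add)
  then show ?thesis
    by (cases x y rule: linorder_cases) (auto simp: jump_def mult.assoc[symmetric])
qed

lemma hkernel_balance: "\<epsilon> ^ x * hkernel N p \<epsilon> x y = \<epsilon> ^ y * hkernel N p \<epsilon> y x"
  by (simp add: hkernel_def jump_balance)

lemma hkernel_sum:
  assumes "x \<le> N"
  shows "(\<Sum>y\<le>N. hkernel N p \<epsilon> x y) = 1"
proof -
  have "(\<Sum>y\<le>N. hkernel N p \<epsilon> x y) =
      (\<Sum>y\<le>N. jump p \<epsilon> x y + (if x = y then 1 - (\<Sum>z\<le>N. jump p \<epsilon> x z) else 0))"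
    by (intro sum.cong) (auto simp: hkernel_def jump_def)
  also have "\<dots> = 1" using assms by (simp add: sum.distrib)
  finally show ?thesis .
qed

lemma hkernel_0:
  assumes "x \<le> N"
  shows "hkernel N p 0 x y =
    (if x = y then (if x = 0 then 1 else 1 - p) else if x = Suc y then p else 0)"
proof -
  have jump0: "jump p 0 x z = (if x = Suc z then p else 0)" for x z
    by (auto simp: jump_def)
  have *: "(\<Sum>z\<le>N. jump p 0 x z) = (if x = 0 then 0 else p)"
  proof (cases x)
    case (Suc x')
    have "(\<Sum>z\<le>N. jump p 0 x z) = (\<Sum>z\<le>N. if z = x' then p else 0)"
      unfolding jump0 using Suc by (intro sum.cong) auto
    then show ?thesis using assms Suc by simp
  next
    case 0
    then show ?thesis unfolding jump0 by simp
  qed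
  show ?thesis unfolding hkernel_def * by (simp add: jump0)
qed

lemma tendsto_jump: "((\<lambda>\<epsilon>. jump p \<epsilon> x y) \<longlongrightarrow> jump p 0 x y) (at_right 0)"
proof (cases "x < y")
  case True
  have "((\<lambda>\<epsilon>. \<epsilon> ^ (y - x) * p) \<longlongrightarrow> 0 ^ (y - x) * p) (at_right 0)"
    "((\<lambda>\<epsilon>. \<epsilon> ^ (y - x) * \<epsilon>) \<longlongrightarrow> 0 ^ (y - x) * 0) (at_right (0::real))"
    by (intro tendsto_intros)+
  then show ?thesis using True by (cases "y = Suc x") (auto simp: jump_def)
next
  case False
  then consider "x = Suc y" | "x \<noteq> Suc y" "y < x" | "x = y" by linarith
  then show ?thesis by cases (simp_all add: jump_def)
qed

lemma tendsto_hkernel: "((\<lambda>\<epsilon>. hkernel N p \<epsilon> x y) \<longlongrightarrow> hkernel N p 0 x y) (at_right 0)"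
  unfolding hkernel_def by (cases "x = y") (auto intro!: tendsto_intros tendsto_jump)

lemma eventually_hkernel_pos:
  assumes "0 < p" "p < 1"
  shows "\<forall>\<^sub>F \<epsilon> in at_right 0. \<forall>x\<le>N. \<forall>y\<le>N. hkernel N p \<epsilon> x y > 0"
proof -
  have "\<forall>\<^sub>F \<epsilon> in at_right 0. hkernel N p \<epsilon> x y > 0" if "x \<le> N" for x y
  proof (cases "x = y")
    case True
    have "hkernel N p 0 x y > 0" using assms that True by (simp add: hkernel_0)
    then show ?thesis using tendsto_hkernel order_tendstoD(1) by blast
  next
    case False
    then show ?thesis
      using assms eventually_at_right_less[of "0::real"]
      by (auto simp: hkernel_def jump_def elim!: eventually_mono)
  qed
  then have "\<forall>\<^sub>F \<epsilon> in at_right 0. \<forall>x\<in>{..N}. \<forall>y\<in>{..N}. hkernel N p \<epsilon> x y > 0"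
    by (intro eventually_ball_finite ballI) auto
  then show ?thesis by (simp add: Ball_def)
qed

lemma exists_pmf_of_weights:
  fixes f :: "'a \<Rightarrow> real"
  assumes "finite A" "\<And>x. x \<in> A \<Longrightarrow> f x \<ge> 0" "sum f A = 1"
  shows "\<exists>p. \<forall>x. pmf p x = (if x \<in> A then f x else 0)"
proof -
  let ?g = "\<lambda>x. if x \<in> A then f x else 0"
  have "(\<integral>\<^sup>+ x. ennreal (?g x) \<partial>count_space UNIV) = (\<integral>\<^sup>+ x. ennreal (f x) * indicator A x \<partial>count_space UNIV)"
    by (intro nn_integral_cong) (auto simp: indicator_def)
  also have "\<dots> = (\<Sum>x\<in>A. ennreal (f x))"
    using assms(1) by (subst nn_integral_indicator_finite) auto
  also have "\<dots> = 1" using assms by (simp add: sum_ennreal)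
  finally have "pmf (embed_pmf ?g) x = ?g x" for x
    using assms by (intro pmf_embed_pmf) auto
  then show ?thesis by blast
qed

text \<open>
  The kernel as a family of probability mass functions, with stationary law proportional to \<open>\<epsilon>\<^bsup>x\<^esup>\<close>.
\<close>

locale hierarchical_chain =
  fixes N :: nat and p \<epsilon> :: real and P :: "nat \<Rightarrow> nat pmf" and \<pi> :: "nat pmf"
  assumes N_pos: "1 \<le> N" and p: "0 < p" "p < 1" and \<epsilon>: "0 < \<epsilon>" "\<epsilon> < 1"
    and pmf_\<pi>: "\<And>x. pmf \<pi> x = (if x \<le> N then \<epsilon> ^ x / (\<Sum>i\<le>N. \<epsilon> ^ i) else 0)"
    and pmf_P: "\<And>x y. x \<le> N \<Longrightarrow> pmf (P x) y = (if y \<le> N then hkernel N p \<epsilon> x y else 0)"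
    and hkernel_pos: "\<And>x y. x \<le> N \<Longrightarrow> y \<le> N \<Longrightarrow> hkernel N p \<epsilon> x y > 0"

lemma exists_hierarchical_chain:
  assumes "1 \<le> N" "0 < p" "p < 1"
  shows "\<forall>\<^sub>F \<epsilon> in at_right 0. \<exists>P \<pi>. hierarchical_chain N p \<epsilon> P \<pi>"
proof -
  have "\<forall>\<^sub>F \<epsilon> in at_right 0. (0::real) < \<epsilon> \<and> \<epsilon> < 1"
    by (auto simp: eventually_at_right_field intro!: exI[of _ 1])
  with eventually_hkernel_pos[OF assms(2,3), of N] show ?thesis
  proof eventually_elim
    case (elim \<epsilon>)
    have Z: "(\<Sum>i\<le>N. \<epsilon> ^ i) > 0" using elim by (intro sum_pos) auto
    have "\<exists>\<pi>. \<forall>x. pmf \<pi> x = (if x \<in> {..N} then \<epsilon> ^ x / (\<Sum>i\<le>N. \<epsilon> ^ i) else 0)"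
      using Z elim by (intro exists_pmf_of_weights) (auto simp: sum_divide_distrib[symmetric] intro: less_imp_le)
    moreover have "\<exists>q. \<forall>y. pmf q y = (if y \<in> {..N} then hkernel N p \<epsilon> x y else 0)" if "x \<le> N" for x
      using elim that by (intro exists_pmf_of_weights) (auto simp: hkernel_sum intro: less_imp_le)
    then have "\<exists>P. \<forall>x\<in>{..N}. \<forall>y. pmf (P x) y = (if y \<in> {..N} then hkernel N p \<epsilon> x y else 0)"
      by (intro bchoice) auto
    ultimately obtain \<pi> P where
      "\<And>x. pmf \<pi> x = (if x \<in> {..N} then \<epsilon> ^ x / (\<Sum>i\<le>N. \<epsilon> ^ i) else 0)"
      "\<And>x y. x \<in> {..N} \<Longrightarrow> pmf (P x) y = (if y \<in> {..N} then hkernel N p \<epsilon> x y else 0)"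
      by blast
    then have "hierarchical_chain N p \<epsilon> P \<pi>"
      using assms elim by (simp add: hierarchical_chain_def)
    then show ?case by blast
  qed
qed

context hierarchical_chain begin

lemma set_P: "x \<le> N \<Longrightarrow> set_pmf (P x) = {..N}"
  using hkernel_pos[of x] by (force simp: set_pmf_eq pmf_P)

lemma Z_pos: "(\<Sum>i\<le>N. \<epsilon> ^ i) > 0"
  using \<epsilon> by (intro sum_pos) auto

lemma set_\<pi>: "set_pmf \<pi> = {..N}"
  using \<epsilon> Z_pos by (auto simp: set_pmf_eq pmf_\<pi>)

lemma detailed_balance: "x \<le> N \<Longrightarrow> y \<le> N \<Longrightarrow> pmf \<pi> x * pmf (P x) y = pmf \<pi> y * pmf (P y) x"
  using hkernel_balance[of \<epsilon> x N p y] by (simp add: pmf_\<pi> pmf_P)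

lemma stationary: "bind_pmf \<pi> P = \<pi>"
proof (rule pmf_eqI)
  fix y
  have "pmf (bind_pmf \<pi> P) y = (\<Sum>x\<le>N. pmf (P x) y * pmf \<pi> x)"
    unfolding pmf_bind by (rule integral_measure_pmf_real) (auto simp: set_\<pi>)
  also have "\<dots> = pmf \<pi> y"
  proof (cases "y \<le> N")
    case True
    have "(\<Sum>x\<le>N. pmf (P x) y * pmf \<pi> x) = (\<Sum>x\<le>N. pmf \<pi> y * hkernel N p \<epsilon> y x)"
      using True detailed_balance by (intro sum.cong) (auto simp: pmf_P mult.commute)
    then show ?thesis using True by (simp add: sum_distrib_left[symmetric] hkernel_sum)
  next
    case False
    then show ?thesis by (simp add: pmf_P pmf_\<pi>)
  qed
  finally show "pmf (bind_pmf \<pi> P) y = pmf \<pi> y" .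
qed

lemma irreducible_reversible: "irreducible_reversible {..N} P \<pi>"
  unfolding irreducible_reversible_def
proof (intro conjI)
  show "markov_kernel {..N} P" by (simp add: markov_kernel_def set_P)
  show "irreducible_kernel {..N} P"
    using hkernel_pos by (auto simp: irreducible_kernel_def pmf_P intro!: r_into_rtrancl)
  show "stationary_law {..N} P \<pi>" by (simp add: stationary_law_def set_\<pi> stationary)
  show "reversible_kernel {..N} P \<pi>"
    using detailed_balance by (simp add: reversible_kernel_def)
qed

end

lemma shifted_square_le:
  fixes a d s :: real
  assumes "s > 0"
  shows "(a + d)\<^sup>2 \<le> (1 + s) * d\<^sup>2 + (1 + 1 / s) * a\<^sup>2"
proof -
  have "0 \<le> (s * d - a)\<^sup>2 / s" using assms by simp
  also have "\<dots> = s * d\<^sup>2 - 2 * (a * d) + a\<^sup>2 / s"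
    using assms by (simp add: field_simps power2_eq_square)
  finally show ?thesis by (simp add: power2_sum algebra_simps)
qed

text \<open>
  A lower bound for the right gap of the kernel; with \<open>s = sqrt \<epsilon>\<close> it tends to \<open>p\<close> as \<open>\<epsilon> \<rightarrow> 0\<close>. Only the
  steps between neighbours are used; each state carries \<open>\<epsilon>\<close> times the mass of the one below, so in
  \<open>f (i+1) - f 0 = (f i - f 0) + (f (i+1) - f i)\<close> the first term costs a factor \<open>\<epsilon>\<close>.
\<close>

context hierarchical_chain begin

lemma gap_lower_bound:
  assumes s: "s > 0"
  shows "p * (1 - (1 + 1 / s) * \<epsilon>) / (1 + s) \<le> gap {..N} (\<lambda>x y. pmf (P x) y)"
proof -
  interpret R: reversible_chain "{..N}" "pmf \<pi>" "\<lambda>x y. pmf (P x) y"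
    by (rule irreducible_reversible_chain[OF irreducible_reversible])
  have step: "pmf \<pi> (Suc i) = \<epsilon> * pmf \<pi> i" if "i < N" for i
    using that by (simp add: pmf_\<pi>)
  show ?thesis
  proof (rule R.gap_ge)
    show "2 \<le> card {..N}" using N_pos by simp
    fix f :: "nat \<Rightarrow> real"
    \<comment> \<open>\<open>D\<close> is the energy of the neighbour steps, and \<open>V\<close> is the second moment of \<open>f - f 0\<close>.\<close>
    define D where "D = (\<Sum>i<N. pmf \<pi> (Suc i) * (f (Suc i) - f i)\<^sup>2)"
    define V where "V = (\<Sum>i<N. pmf \<pi> (Suc i) * (f (Suc i) - f 0)\<^sup>2)"
    have pD: "p * D \<le> R.dirichlet f"
    proof -
      define a where "a z = pmf \<pi> (fst z) * pmf (P (fst z)) (snd z) * (f (fst z) - f (snd z))\<^sup>2" for z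
      define U where "U = (\<lambda>i. (Suc i, i)) ` {..<N}"
      define U' where "U' = (\<lambda>i. (i, Suc i)) ` {..<N}"
      have down: "pmf (P (Suc i)) i = p" if "i < N" for i
        using that by (simp add: pmf_P hkernel_def jump_def)
      have 1: "sum a U = p * D"
        unfolding U_def by (subst sum.reindex) (auto simp: inj_on_def a_def D_def down sum_distrib_left mult_ac intro!: sum.cong)
      have 2: "sum a U' = p * D"
      proof -
        have "a (i, Suc i) = p * (pmf \<pi> (Suc i) * (f (Suc i) - f i)\<^sup>2)" if "i < N" for i
          using detailed_balance[of i "Suc i"] that by (simp add: a_def down power2_commute mult_ac)
        then show ?thesis
          unfolding U'_def by (subst sum.reindex) (auto simp: inj_on_def D_def sum_distrib_left intro!: sum.cong)
      qed
      have "sum a U + sum a U' = sum a (U \<union> U')"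
        by (intro sum.union_disjoint[symmetric]) (auto simp: U_def U'_def)
      also have "\<dots> \<le> sum a ({..N} \<times> {..N})"
        by (intro sum_mono2) (auto simp: U_def U'_def a_def)
      also have "\<dots> = 2 * R.dirichlet f"
        by (simp add: R.dirichlet_altdef a_def sum.cartesian_product')
      finally show ?thesis using 1 2 by linarith
    qed
    have VD: "V * (1 - (1 + 1 / s) * \<epsilon>) \<le> (1 + s) * D"
    proof -
      have "V \<le> (\<Sum>i<N. (1 + s) * (pmf \<pi> (Suc i) * (f (Suc i) - f i)\<^sup>2)
          + (1 + 1 / s) * (pmf \<pi> (Suc i) * (f i - f 0)\<^sup>2))"
        unfolding V_def
      proof (rule sum_mono)
        fix i
        have "(f (Suc i) - f 0)\<^sup>2 = ((f i - f 0) + (f (Suc i) - f i))\<^sup>2" by simp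
        also have "\<dots> \<le> (1 + s) * (f (Suc i) - f i)\<^sup>2 + (1 + 1 / s) * (f i - f 0)\<^sup>2"
          by (rule shifted_square_le[OF s])
        finally have "pmf \<pi> (Suc i) * (f (Suc i) - f 0)\<^sup>2 \<le>
            pmf \<pi> (Suc i) * ((1 + s) * (f (Suc i) - f i)\<^sup>2 + (1 + 1 / s) * (f i - f 0)\<^sup>2)"
          by (intro mult_left_mono) auto
        then show "pmf \<pi> (Suc i) * (f (Suc i) - f 0)\<^sup>2 \<le> (1 + s) * (pmf \<pi> (Suc i) * (f (Suc i) - f i)\<^sup>2)
            + (1 + 1 / s) * (pmf \<pi> (Suc i) * (f i - f 0)\<^sup>2)"
          by (simp only: distrib_left mult.left_commute)
      qed
      also have "\<dots> = (1 + s) * D + (1 + 1 / s) * (\<Sum>i<N. pmf \<pi> (Suc i) * (f i - f 0)\<^sup>2)"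
        by (simp only: sum.distrib D_def sum_distrib_left)
      also have "(\<Sum>i<N. pmf \<pi> (Suc i) * (f i - f 0)\<^sup>2) = \<epsilon> * (\<Sum>i<N. pmf \<pi> i * (f i - f 0)\<^sup>2)"
        by (simp add: step sum_distrib_left mult_ac)
      finally have "V \<le> (1 + s) * D + (1 + 1 / s) * (\<epsilon> * (\<Sum>i<N. pmf \<pi> i * (f i - f 0)\<^sup>2))" .
      moreover have "(\<Sum>i<N. pmf \<pi> i * (f i - f 0)\<^sup>2) \<le> V"
      proof -
        have "(\<Sum>i<N. pmf \<pi> i * (f i - f 0)\<^sup>2) \<le> (\<Sum>i<Suc N. pmf \<pi> i * (f i - f 0)\<^sup>2)"
          by simp
        also have "\<dots> = V" unfolding V_def by (subst sum.lessThan_Suc_shift) simp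
        finally show ?thesis .
      qed
      then have "(1 + 1 / s) * (\<epsilon> * (\<Sum>i<N. pmf \<pi> i * (f i - f 0)\<^sup>2)) \<le> (1 + 1 / s) * (\<epsilon> * V)"
        using s \<epsilon> by (intro mult_left_mono) auto
      ultimately show ?thesis by (simp add: algebra_simps)
    qed
    have "R.var f \<le> V"
    proof -
      define m where "m = R.ip f (\<lambda>_. 1)"
      have "V = R.ip (\<lambda>x. f x - f 0) (\<lambda>x. f x - f 0)"
        unfolding V_def R.ip_def unfolding lessThan_Suc_atMost[symmetric]
        by (subst sum.lessThan_Suc_shift) (simp add: power2_eq_square mult_ac)
      also have "\<dots> = R.ip (\<lambda>x. f x - f 0 * 1) (\<lambda>x. f x - f 0 * 1)" by simp
      also have "\<dots> = R.ip f f - m\<^sup>2 + (m - f 0)\<^sup>2"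
        by (simp only: R.ip_lin R.ip_one R.ip_commute[of "\<lambda>_. 1" f])
          (simp add: m_def power2_eq_square algebra_simps)
      also have "\<dots> \<ge> R.var f" by (simp add: R.var_def m_def)
      finally show ?thesis .
    qed
    show "p * (1 - (1 + 1 / s) * \<epsilon>) / (1 + s) * R.var f \<le> R.dirichlet f"
    proof (cases "1 - (1 + 1 / s) * \<epsilon> \<ge> 0")
      case True
      have "p * (1 - (1 + 1 / s) * \<epsilon>) / (1 + s) * R.var f \<le> p * (1 - (1 + 1 / s) * \<epsilon>) / (1 + s) * V"
        using True p s \<open>R.var f \<le> V\<close> by (intro mult_left_mono) auto
      also have "\<dots> = p / (1 + s) * (V * (1 - (1 + 1 / s) * \<epsilon>))" by simp
      also have "\<dots> \<le> p / (1 + s) * ((1 + s) * D)"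
        using VD p s by (intro mult_left_mono) auto
      also have "\<dots> = p * D" using s by simp
      finally show ?thesis using pD by simp
    next
      case False
      then have "p * (1 - (1 + 1 / s) * \<epsilon>) / (1 + s) \<le> 0"
        using p s by (intro divide_nonpos_pos mult_nonneg_nonpos) auto
      then have "p * (1 - (1 + 1 / s) * \<epsilon>) / (1 + s) * R.var f \<le> 0"
        using R.var_nonneg by (rule mult_nonpos_nonneg)
      then show ?thesis using R.dirichlet_nonneg[of f] by linarith
    qed
  qed
qed

end

section \<open>The test function\<close>

text \<open>
  \<open>path_weight N K v k x\<close> is the expectation, for the chain with kernel \<open>K\<close> started at \<open>x\<close>, of
  \<open>v(X\<^sub>1) \<cdots> v(X\<^sub>k)\<close>.
\<close>

primrec path_weight :: "nat \<Rightarrow> (nat \<Rightarrow> nat \<Rightarrow> real) \<Rightarrow> (nat \<Rightarrow> real) \<Rightarrow> nat \<Rightarrow> nat \<Rightarrow> real" where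
  "path_weight N K v 0 x = 1"
| "path_weight N K v (Suc k) x = (\<Sum>y\<le>N. K x y * v y * path_weight N K v k y)"

text \<open>
  For \<open>K = hkernel N p \<epsilon>\<close>, \<open>hit_weight N K v k x\<close> is the same expectation restricted to paths that visit
  \<open>N\<close> at a time in \<open>0..k\<close>, rescaled by \<open>\<epsilon>\<^bsup>x-N\<^esup>\<close>: from \<open>x\<close> the top state is reached with a probability of order \<open>\<epsilon>\<^bsup>N-x\<^esup>\<close>. By reversibility the
  rescaling turns \<open>K\<close> into its transpose.
\<close>

primrec hit_weight :: "nat \<Rightarrow> (nat \<Rightarrow> nat \<Rightarrow> real) \<Rightarrow> (nat \<Rightarrow> real) \<Rightarrow> nat \<Rightarrow> nat \<Rightarrow> real" where
  "hit_weight N K v 0 x = of_bool (x = N)"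
| "hit_weight N K v (Suc k) x =
     (if x = N then path_weight N K v (Suc k) x else \<Sum>y\<le>N. K y x * v y * hit_weight N K v k y)"

lemma sum_of_bool_nth: "(\<Sum>j<length ys. of_bool (ys ! j = x)) = count_list ys x"
  by (induction ys) (auto simp: sum.lessThan_Suc_shift simp del: sum.lessThan_Suc)

lemma window_count_0: "length xs = Suc n \<Longrightarrow> window_count n 0 xs = count_list (butlast xs)"
  unfolding window_count_def
  by (rule ext, subst sum_of_bool_nth[symmetric]) (auto simp: nth_butlast intro!: sum.cong)

lemma window_count_1: "length xs = Suc n \<Longrightarrow> window_count n 1 xs = count_list (tl xs)"
  unfolding window_count_def
  by (rule ext, subst sum_of_bool_nth[symmetric]) (auto simp: nth_tl intro!: sum.cong)

lemma prod_power_count_list: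
  fixes g :: "'a \<Rightarrow> 'b :: comm_monoid_mult"
  assumes "finite A"
  shows "set ys \<subseteq> A \<Longrightarrow> (\<Prod>x\<in>A. g x ^ count_list ys x) = prod_list (map g ys)"
proof (induction ys)
  case (Cons y ys)
  have "(\<Prod>x\<in>A. g x ^ count_list (y # ys) x) =
      (\<Prod>x\<in>A. (if x = y then g y else 1) * g x ^ count_list ys x)"
    by (intro prod.cong) auto
  also have "\<dots> = g y * (\<Prod>x\<in>A. g x ^ count_list ys x)"
    using Cons.prems assms by (simp add: prod.distrib)
  finally show ?case using Cons by simp
qed simp

text \<open>
  The test function on counts: it vanishes unless the top state \<open>N\<close> has been visited, and is then a product
  of one factor \<open>g x\<close> for each visit to \<open>x\<close>.
\<close>

definition test_function :: "nat \<Rightarrow> (nat \<Rightarrow> real) \<Rightarrow> (nat \<Rightarrow> nat) \<Rightarrow> real" where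
  "test_function N g K = of_bool (K N > 0) * (\<Prod>x\<le>N. g x ^ K x)"

lemma test_function_count_list:
  "set ys \<subseteq> {..N} \<Longrightarrow> test_function N g (count_list ys) = of_bool (N \<in> set ys) * prod_list (map g ys)"
  using count_list_0_iff[of ys N] by (auto simp: test_function_def prod_power_count_list)

text \<open>
  An upper bound for the part of the squared change of the test function that is due to the state leaving
  the window: the first summand is for paths that visit \<open>N\<close>, the second one for paths that start at \<open>N\<close>
  and leave it at once, so that the visit may be lost.
\<close>

definition path_cost :: "nat \<Rightarrow> (nat \<Rightarrow> real) \<Rightarrow> nat list \<Rightarrow> real" where
  "path_cost N g xs =
     ((g (hd xs) - 1)\<^sup>2 * of_bool (N \<in> set xs) + (g N)\<^sup>2 * of_bool (hd xs = N \<and> xs ! 1 \<noteq> N))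
     * prod_list (map (\<lambda>x. (g x)\<^sup>2) (tl xs))"

text \<open>
  The two windows share the middle part of the path. If it visits \<open>N\<close>, the increment is a common factor
  times \<open>g a - g b\<close> with \<open>a\<close>, \<open>b\<close> the end points, and \<open>(g a - g b)\<^sup>2 \<le> (g a - 1)\<^sup>2 + (g b - 1)\<^sup>2\<close>; otherwise only end
  points at \<open>N\<close> contribute. The two end points are exchanged by reversing the path.
\<close>

lemma test_function_increment_le:
  assumes g: "\<And>x. g x \<ge> 1" and n: "n \<ge> 2" and len: "length xs = Suc n" and sub: "set xs \<subseteq> {..N}"
  shows "(test_function N g (window_count n 0 xs) - test_function N g (window_count n 1 xs))\<^sup>2
    \<le> path_cost N g xs + path_cost N g (rev xs)"
proof -
  obtain a ys where ys: "xs = a # ys" "length ys = n" using len by (cases xs) auto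
  then obtain mid b where xs: "xs = a # mid @ [b]" using n by (cases ys rule: rev_cases) auto
  have mid: "length mid = n - 1" "mid \<noteq> []" using ys xs n by auto
  define W where "W = prod_list (map g mid)"
  have W: "W \<ge> 1" unfolding W_def using g by (induction mid) (auto intro: mult_ge1_I)
  have W2: "prod_list (map (\<lambda>x. (g x)\<^sup>2) mid) = W\<^sup>2"
    unfolding W_def by (induction mid) (auto simp: power_mult_distrib)
  have revW: "prod_list (map h (rev mid)) = prod_list (map h mid)" for h :: "nat \<Rightarrow> real"
    by (induction mid) auto
  have g0: "g x \<ge> 0" for x using g[of x] by simp
  have g2: "(g x)\<^sup>2 \<ge> 1" for x using g[of x] by simp
  have f0: "test_function N g (window_count n 0 xs) = of_bool (N = a \<or> N \<in> set mid) * (g a * W)"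
    using sub by (subst window_count_0[OF len]) (auto simp: xs test_function_count_list W_def)
  have f1: "test_function N g (window_count n 1 xs) = of_bool (N \<in> set mid \<or> N = b) * (W * g b)"
    using sub unfolding window_count_1[OF len] by (auto simp: xs test_function_count_list W_def)
  have hd_mid: "(mid @ [b]) ! 0 \<in> set mid" "(rev mid @ [a]) ! 0 \<in> set mid"
    using mid(2) by (auto simp: nth_append rev_nth)
  have c0: "path_cost N g xs = ((g a - 1)\<^sup>2 * of_bool (N \<in> set xs)
      + (g N)\<^sup>2 * of_bool (a = N \<and> (mid @ [b]) ! 0 \<noteq> N)) * (W\<^sup>2 * (g b)\<^sup>2)"
    by (simp add: path_cost_def xs W2)
  have c1: "path_cost N g (rev xs) = ((g b - 1)\<^sup>2 * of_bool (N \<in> set xs)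
      + (g N)\<^sup>2 * of_bool (b = N \<and> (rev mid @ [a]) ! 0 \<noteq> N)) * (W\<^sup>2 * (g a)\<^sup>2)"
    by (simp add: path_cost_def xs revW W2 disj_commute disj_left_commute)
  have scale: "c * W\<^sup>2 \<le> c * (W\<^sup>2 * (g x)\<^sup>2)" if "c \<ge> 0" for c x
    using that mult_left_mono[OF g2[of x], of "W\<^sup>2"] by (intro mult_left_mono) auto
  show ?thesis
  proof (cases "N \<in> set mid")
    case True
    have "(g a - g b)\<^sup>2 \<le> (g a - 1)\<^sup>2 + (g b - 1)\<^sup>2"
      using mult_nonneg_nonneg[of "g a - 1" "g b - 1"] g by (simp add: power2_eq_square algebra_simps)
    then have "(g a - g b)\<^sup>2 * W\<^sup>2 \<le> ((g a - 1)\<^sup>2 + (g b - 1)\<^sup>2) * W\<^sup>2"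
      by (rule mult_right_mono) simp
    also have "\<dots> = (g a - 1)\<^sup>2 * W\<^sup>2 + (g b - 1)\<^sup>2 * W\<^sup>2" by (rule distrib_right)
    also have "\<dots> \<le> (g a - 1)\<^sup>2 * (W\<^sup>2 * (g b)\<^sup>2) + (g b - 1)\<^sup>2 * (W\<^sup>2 * (g a)\<^sup>2)"
      by (intro add_mono scale) auto
    also have "\<dots> \<le> path_cost N g xs + path_cost N g (rev xs)"
      unfolding c0 c1 using True by (intro add_mono mult_right_mono) (auto simp: xs)
    also have "(g a - g b)\<^sup>2 * W\<^sup>2 =
        (test_function N g (window_count n 0 xs) - test_function N g (window_count n 1 xs))\<^sup>2"
      unfolding f0 f1 using True by (simp add: power2_eq_square algebra_simps)
    finally show ?thesis .
  next
    case False
    then have ne: "(mid @ [b]) ! 0 \<noteq> N" "(rev mid @ [a]) ! 0 \<noteq> N" using hd_mid by auto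
    define u where "u = of_bool (a = N) * (g N * W)"
    define w where "w = of_bool (b = N) * (g N * W)"
    have "u \<ge> 0" "w \<ge> 0" using W g0[of N] by (auto simp: u_def w_def)
    then have "(u - w)\<^sup>2 \<le> u\<^sup>2 + w\<^sup>2"
      using mult_nonneg_nonneg[of u w] by (simp add: power2_diff)
    moreover have "u\<^sup>2 \<le> path_cost N g xs"
    proof -
      have "u\<^sup>2 = ((g N)\<^sup>2 * of_bool (a = N)) * W\<^sup>2" by (simp add: u_def power_mult_distrib)
      also have "\<dots> \<le> ((g N)\<^sup>2 * of_bool (a = N)) * (W\<^sup>2 * (g b)\<^sup>2)" by (rule scale) simp
      also have "\<dots> \<le> path_cost N g xs" unfolding c0 using ne by (intro mult_right_mono) auto
      finally show ?thesis .
    qed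
    moreover have "w\<^sup>2 \<le> path_cost N g (rev xs)"
    proof -
      have "w\<^sup>2 = ((g N)\<^sup>2 * of_bool (b = N)) * W\<^sup>2" by (simp add: w_def power_mult_distrib)
      also have "\<dots> \<le> ((g N)\<^sup>2 * of_bool (b = N)) * (W\<^sup>2 * (g a)\<^sup>2)" by (rule scale) simp
      also have "\<dots> \<le> path_cost N g (rev xs)" unfolding c1 using ne by (intro mult_right_mono) auto
      finally show ?thesis .
    qed
    moreover have "test_function N g (window_count n 0 xs) = u" "test_function N g (window_count n 1 xs) = w"
      unfolding f0 f1 u_def w_def using False by auto
    ultimately show ?thesis by simp
  qed
qed

lemma expectation_pmf_cong:
  "(\<And>ys. ys \<in> set_pmf M \<Longrightarrow> F ys = (G ys :: real)) \<Longrightarrow>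
    measure_pmf.expectation M F = measure_pmf.expectation M G"
  by (rule integral_cong_AE) (auto simp: AE_measure_pmf_iff)

context hierarchical_chain begin

lemma finite_walk_pmf: "x \<le> N \<Longrightarrow> finite (set_pmf (walk P n x))"
  using finite_walk[of "{..N}" P x n] set_P by simp

lemma set_walk_pmf: "x \<le> N \<Longrightarrow> xs \<in> set_pmf (walk P n x) \<Longrightarrow> set xs \<subseteq> {..N}"
  using set_walk[of "{..N}" P x xs n] set_P by simp

lemma expectation_walk_Suc:
  fixes F :: "nat list \<Rightarrow> real"
  assumes "x \<le> N"
  shows "measure_pmf.expectation (walk P (Suc k) x) F =
    (\<Sum>y\<le>N. hkernel N p \<epsilon> x y * measure_pmf.expectation (walk P k y) (\<lambda>ys. F (x # ys)))"
proof -
  have "measure_pmf.expectation (walk P (Suc k) x) F =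
      measure_pmf.expectation (bind_pmf (P x) (walk P k)) (\<lambda>ys. F (x # ys))"
    by simp
  also have "\<dots> = (\<Sum>y\<le>N. pmf (P x) y *\<^sub>R measure_pmf.expectation (walk P k y) (\<lambda>ys. F (x # ys)))"
    using assms finite_walk_pmf by (intro pmf_expectation_bind) (auto simp: set_P)
  finally show ?thesis using assms by (simp add: pmf_P)
qed

lemma expectation_chain_law:
  fixes F :: "nat list \<Rightarrow> real"
  shows "measure_pmf.expectation (chain_law P \<pi> n) F =
    (\<Sum>x\<le>N. pmf \<pi> x * measure_pmf.expectation (walk P n x) F)"
proof -
  have "measure_pmf.expectation (chain_law P \<pi> n) F =
      (\<Sum>x\<le>N. pmf \<pi> x *\<^sub>R measure_pmf.expectation (walk P n x) F)"
    unfolding chain_law_def using finite_walk_pmf by (intro pmf_expectation_bind) (auto simp: set_\<pi>)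
  then show ?thesis by simp
qed

lemma hd_walk: "ys \<in> set_pmf (walk P n x) \<Longrightarrow> \<exists>zs. ys = x # zs"
  by (cases n) auto

lemma expectation_walk_prod:
  "x \<le> N \<Longrightarrow> measure_pmf.expectation (walk P k x) (\<lambda>xs. prod_list (map v (tl xs))) = path_weight N (hkernel N p \<epsilon>) v k x"
proof (induction k arbitrary: x)
  case (Suc k)
  have "measure_pmf.expectation (walk P k y) (\<lambda>ys. prod_list (map v ys)) = v y * path_weight N (hkernel N p \<epsilon>) v k y"
    if "y \<le> N" for y
  proof -
    have "measure_pmf.expectation (walk P k y) (\<lambda>ys. prod_list (map v ys)) =
        measure_pmf.expectation (walk P k y) (\<lambda>ys. v y * prod_list (map v (tl ys)))"
      by (rule expectation_pmf_cong) (auto dest!: hd_walk)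
    then show ?thesis using Suc.IH[OF that] by simp
  qed
  then show ?case
    unfolding expectation_walk_Suc[OF Suc.prems] by (simp add: mult.assoc)
qed simp

text \<open>
  Multiplying by \<open>\<epsilon>\<^bsup>x\<^esup>\<close> and using detailed balance passes to the transposed kernel.
\<close>

lemma expectation_walk_hit:
  "x \<le> N \<Longrightarrow> \<epsilon> ^ x * measure_pmf.expectation (walk P k x)
      (\<lambda>xs. of_bool (N \<in> set xs) * prod_list (map v (tl xs))) =
    \<epsilon> ^ N * hit_weight N (hkernel N p \<epsilon>) v k x"
proof (induction k arbitrary: x)
  case (Suc k)
  show ?case
  proof (cases "x = N")
    case True
    have "measure_pmf.expectation (walk P (Suc k) N)
        (\<lambda>xs. of_bool (N \<in> set xs) * prod_list (map v (tl xs))) =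
       measure_pmf.expectation (walk P (Suc k) N) (\<lambda>xs. prod_list (map v (tl xs)))"
      by (rule expectation_pmf_cong) (auto simp del: walk.simps dest!: hd_walk)
    also have "\<dots> = hit_weight N (hkernel N p \<epsilon>) v (Suc k) N"
      by (subst expectation_walk_prod) auto
    finally show ?thesis using True by simp
  next
    case False
    define E where "E y = measure_pmf.expectation (walk P k y)
        (\<lambda>xs. of_bool (N \<in> set xs) * prod_list (map v (tl xs)))" for y
    have "measure_pmf.expectation (walk P k y) (\<lambda>ys. of_bool (N \<in> set (x # ys)) * prod_list (map v ys)) = v y * E y"
      if "y \<le> N" for y
    proof -
      have "measure_pmf.expectation (walk P k y) (\<lambda>ys. of_bool (N \<in> set (x # ys)) * prod_list (map v ys)) =
          measure_pmf.expectation (walk P k y) (\<lambda>ys. v y * (of_bool (N \<in> set ys) * prod_list (map v (tl ys))))"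
        using False by (intro expectation_pmf_cong) (auto dest!: hd_walk)
      then show ?thesis by (simp add: E_def)
    qed
    then have "\<epsilon> ^ x * measure_pmf.expectation (walk P (Suc k) x)
        (\<lambda>xs. of_bool (N \<in> set xs) * prod_list (map v (tl xs))) =
      (\<Sum>y\<le>N. (\<epsilon> ^ x * hkernel N p \<epsilon> x y) * (v y * E y))"
      unfolding expectation_walk_Suc[OF Suc.prems] by (simp add: sum_distrib_left mult.assoc)
    also have "\<dots> = (\<Sum>y\<le>N. hkernel N p \<epsilon> y x * v y * (\<epsilon> ^ y * E y))"
      by (simp add: hkernel_balance mult_ac)
    also have "\<dots> = (\<Sum>y\<le>N. \<epsilon> ^ N * (hkernel N p \<epsilon> y x * v y * hit_weight N (hkernel N p \<epsilon>) v k y))"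
      using Suc.IH by (intro sum.cong) (auto simp: E_def)
    finally show ?thesis using False by (simp add: sum_distrib_left)
  qed
qed auto

lemma pmf_walk_constant: "x \<le> N \<Longrightarrow> pmf (walk P n x) (replicate (Suc n) x) = hkernel N p \<epsilon> x x ^ n"
proof (induction n)
  case (Suc n)
  have "pmf (walk P (Suc n) x) (replicate (Suc (Suc n)) x) =
      pmf (bind_pmf (P x) (walk P n)) (x # replicate n x)"
    by (simp add: pmf_map_Cons)
  also have "\<dots> = hkernel N p \<epsilon> x x * pmf (walk P n x) (x # replicate n x)"
    using Suc.prems by (simp add: pmf_bind_walk pmf_P)
  finally show ?case using Suc by simp
qed simp

text \<open>
  The variational bound for the test function with \<open>v = g\<^sup>2\<close>. The factor \<open>\<epsilon>\<^bsup>N\<^esup>\<close>, the order of the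
  probability that a window meets the top state, cancels. The path constantly \<open>0\<close> is the zero of the test
  function.
\<close>

lemma count_gap_bound:
  assumes v: "\<And>x. v x \<ge> 1" "v 0 = 1" and n: "n \<ge> 2"
  shows "gap (set_pmf (count_law P \<pi> n)) (count_kernel P \<pi> n)
      * (hkernel N p \<epsilon> 0 0 ^ n / (\<Sum>i\<le>N. \<epsilon> ^ i) * hit_weight N (hkernel N p \<epsilon>) v n 0)
    \<le> (\<Sum>x\<in>{1..N}. (sqrt (v x) - 1)\<^sup>2 * hit_weight N (hkernel N p \<epsilon>) v n x)
      + v N * (\<Sum>y<N. hkernel N p \<epsilon> N y * v y * path_weight N (hkernel N p \<epsilon>) v (n - 1) y)"
proof -
  let ?G = "gap (set_pmf (count_law P \<pi> n)) (count_kernel P \<pi> n)"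
  define g where "g x = sqrt (v x)" for x
  have g: "g x \<ge> 1" "(g x)\<^sup>2 = v x" for x using v(1)[of x] by (auto simp: g_def)
  define Z where "Z = (\<Sum>i\<le>N. \<epsilon> ^ i)"
  have Z: "Z > 0" using Z_pos by (simp add: Z_def)
  define B where "B x = hit_weight N (hkernel N p \<epsilon>) v n x" for x
  define A' where "A' = (\<Sum>y<N. hkernel N p \<epsilon> N y * v y * path_weight N (hkernel N p \<epsilon>) v (n - 1) y)"
  define H where "H x = measure_pmf.expectation (walk P n x)
      (\<lambda>xs. of_bool (N \<in> set xs) * prod_list (map v (tl xs)))" for x
  have H: "pmf \<pi> x * H x = \<epsilon> ^ N / Z * B x" if "x \<le> N" for x
    using expectation_walk_hit[OF that, of n v] that by (simp add: H_def B_def pmf_\<pi> Z_def)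
  let ?ys = "replicate (Suc n) (0::nat)"
  have len: "length xs = Suc n" "set xs \<subseteq> {..N}" if "xs \<in> set_pmf (chain_law P \<pi> n)" for xs
    using that length_chain_law[OF that] set_walk_pmf[of _ xs n]
    by (auto simp: chain_law_def set_\<pi>)
  have int: "integrable (measure_pmf (chain_law P \<pi> n)) F" for F :: "nat list \<Rightarrow> real"
    using set_P set_\<pi> by (intro integrable_measure_pmf_finite finite_chain_law[of "{..N}"]) auto
  have zero: "test_function N g (window_count n 0 ?ys) = 0"
  proof -
    have "butlast ?ys = replicate n 0" by (simp add: butlast_conv_take del: replicate.simps)
    then have "N \<notin> set (butlast ?ys)" using N_pos by auto
    then show ?thesis
      by (subst window_count_0) (simp_all add: test_function_def count_notin del: replicate.simps)
  qed
  have ys: "pmf (chain_law P \<pi> n) ?ys = hkernel N p \<epsilon> 0 0 ^ n / Z"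
    using pmf_bind_walk[of \<pi> P n 0 "replicate n 0"] pmf_walk_constant[of 0 n]
    by (simp add: chain_law_def pmf_\<pi> Z_def)
  have den: "\<epsilon> ^ N / Z * B 0 \<le>
      measure_pmf.expectation (chain_law P \<pi> n) (\<lambda>xs. (test_function N g (window_count n 1 xs))\<^sup>2)"
  proof -
    have "\<epsilon> ^ N / Z * B 0 = pmf \<pi> 0 * H 0" using H[of 0] by simp
    also have "H 0 = measure_pmf.expectation (walk P n 0) (\<lambda>xs. (test_function N g (window_count n 1 xs))\<^sup>2)"
      unfolding H_def
    proof (rule expectation_pmf_cong)
      fix xs assume xs: "xs \<in> set_pmf (walk P n 0)"
      have l: "length xs = Suc n" by (rule length_walk[OF xs])
      have s: "set (tl xs) \<subseteq> {..N}"
        using set_walk_pmf[OF _ xs] by (cases xs) auto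
      have "N \<in> set xs \<longleftrightarrow> N \<in> set (tl xs)"
        using hd_walk[OF xs] N_pos by auto
      moreover have "(prod_list (map g zs))\<^sup>2 = prod_list (map v zs)" for zs
        by (induction zs) (auto simp: power_mult_distrib g)
      ultimately show "of_bool (N \<in> set xs) * prod_list (map v (tl xs)) =
          (test_function N g (window_count n 1 xs))\<^sup>2"
        by (simp add: window_count_1[OF l, simplified] test_function_count_list[OF s] power_mult_distrib)
    qed
    also have "pmf \<pi> 0 * \<dots> \<le> (\<Sum>x\<le>N. pmf \<pi> x *
        measure_pmf.expectation (walk P n x) (\<lambda>xs. (test_function N g (window_count n 1 xs))\<^sup>2))"
      by (rule member_le_sum) (auto intro!: mult_nonneg_nonneg Bochner_Integration.integral_nonneg)
    finally show ?thesis by (simp add: expectation_chain_law)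
  qed
  have num: "measure_pmf.expectation (chain_law P \<pi> n) (path_cost N g) =
      \<epsilon> ^ N / Z * ((\<Sum>x\<in>{1..N}. (g x - 1)\<^sup>2 * B x) + v N * A')"
  proof -
    define H' where "H' = measure_pmf.expectation (walk P n N)
        (\<lambda>xs. of_bool (xs ! 1 \<noteq> N) * prod_list (map v (tl xs)))"
    have "measure_pmf.expectation (walk P n x) (path_cost N g) =
        (g x - 1)\<^sup>2 * H x + v N * (of_bool (x = N) * H')" if "x \<le> N" for x
    proof -
      have "measure_pmf.expectation (walk P n x) (path_cost N g) =
          measure_pmf.expectation (walk P n x) (\<lambda>xs.
            (g x - 1)\<^sup>2 * (of_bool (N \<in> set xs) * prod_list (map v (tl xs))) +
            v N * (of_bool (x = N) * (of_bool (xs ! 1 \<noteq> N) * prod_list (map v (tl xs)))))"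
        by (rule expectation_pmf_cong) (auto dest!: hd_walk simp: path_cost_def g algebra_simps)
      also have "\<dots> = (g x - 1)\<^sup>2 * H x + v N * (of_bool (x = N) * H')"
        using finite_walk_pmf[OF that, of n]
        by (subst Bochner_Integration.integral_add)
          (auto simp: H_def H'_def intro!: integrable_measure_pmf_finite)
      finally show ?thesis .
    qed
    then have "measure_pmf.expectation (chain_law P \<pi> n) (path_cost N g) =
        (\<Sum>x\<le>N. (g x - 1)\<^sup>2 * (pmf \<pi> x * H x) + v N * (if x = N then pmf \<pi> N * H' else 0))"
      unfolding expectation_chain_law by (intro sum.cong) (auto simp: algebra_simps)
    also have "\<dots> = (\<Sum>x\<le>N. (g x - 1)\<^sup>2 * (\<epsilon> ^ N / Z * B x)) + v N * (pmf \<pi> N * H')"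
      by (simp add: sum.distrib sum_distrib_left[symmetric] H)
    also have "(\<Sum>x\<le>N. (g x - 1)\<^sup>2 * (\<epsilon> ^ N / Z * B x)) =
        (\<Sum>x\<in>{1..N}. (g x - 1)\<^sup>2 * (\<epsilon> ^ N / Z * B x))"
      by (rule sum.mono_neutral_right) (auto simp: g_def v Suc_le_eq)
    also have "H' = A'"
    proof -
      obtain k where k: "n = Suc k" using n by (cases n) auto
      have "H' = (\<Sum>y\<le>N. hkernel N p \<epsilon> N y * measure_pmf.expectation (walk P k y)
          (\<lambda>ys. of_bool (ys ! 0 \<noteq> N) * prod_list (map v ys)))"
        unfolding H'_def k by (subst expectation_walk_Suc) auto
      also have "\<dots> = (\<Sum>y\<le>N. if y = N then 0 else hkernel N p \<epsilon> N y * v y * path_weight N (hkernel N p \<epsilon>) v k y)"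
      proof (intro sum.cong refl)
        fix y assume y: "y \<in> {..N}"
        have "measure_pmf.expectation (walk P k y) (\<lambda>ys. of_bool (ys ! 0 \<noteq> N) * prod_list (map v ys)) =
          measure_pmf.expectation (walk P k y) (\<lambda>ys. (of_bool (y \<noteq> N) * v y) * prod_list (map v (tl ys)))"
          by (rule expectation_pmf_cong) (auto dest!: hd_walk)
        also have "\<dots> = of_bool (y \<noteq> N) * v y * path_weight N (hkernel N p \<epsilon>) v k y"
          using y by (simp add: expectation_walk_prod)
        finally show "hkernel N p \<epsilon> N y * measure_pmf.expectation (walk P k y)
            (\<lambda>ys. of_bool (ys ! 0 \<noteq> N) * prod_list (map v ys)) =
          (if y = N then 0 else hkernel N p \<epsilon> N y * v y * path_weight N (hkernel N p \<epsilon>) v k y)" by simp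
      qed
      also have "\<dots> = A'"
        unfolding lessThan_Suc_atMost[symmetric] by (simp add: A'_def k)
      finally show ?thesis .
    qed
    finally show ?thesis
      by (simp add: pmf_\<pi> Z_def algebra_simps sum_distrib_left)
  qed
  have half: "a \<le> b + b \<Longrightarrow> a / 2 \<le> b" for a b :: real by simp
  have "measure_pmf.expectation (chain_law P \<pi> n)
        (\<lambda>xs. (test_function N g (window_count n 0 xs) - test_function N g (window_count n 1 xs))\<^sup>2)
      \<le> measure_pmf.expectation (chain_law P \<pi> n) (\<lambda>xs. path_cost N g xs + path_cost N g (rev xs))"
    using len test_function_increment_le[OF g(1) n]
    by (intro integral_mono_AE int) (auto simp: AE_measure_pmf_iff)
  also have "\<dots> = measure_pmf.expectation (chain_law P \<pi> n) (path_cost N g)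
      + measure_pmf.expectation (map_pmf rev (chain_law P \<pi> n)) (path_cost N g)"
    by (subst Bochner_Integration.integral_add[OF int int]) simp
  also have "map_pmf rev (chain_law P \<pi> n) = chain_law P \<pi> n"
    by (intro map_rev_chain_law irreducible_reversible_detailed_balance[OF irreducible_reversible])
  finally have up: "measure_pmf.expectation (chain_law P \<pi> n)
        (\<lambda>xs. (test_function N g (window_count n 0 xs) - test_function N g (window_count n 1 xs))\<^sup>2) / 2
      \<le> \<epsilon> ^ N / Z * ((\<Sum>x\<in>{1..N}. (g x - 1)\<^sup>2 * B x) + v N * A')"
    unfolding num by (rule half)
  have "?G \<ge> 0"
    by (rule reversible_chain.gap_nonneg[OF count_kernel_reversible_chain[OF irreducible_reversible]])
  moreover have "hkernel N p \<epsilon> 0 0 ^ n / Z \<ge> 0" using hkernel_pos[of 0 0] Z by simp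
  ultimately have "?G * (hkernel N p \<epsilon> 0 0 ^ n / Z * (\<epsilon> ^ N / Z * B 0)) \<le>
      ?G * (hkernel N p \<epsilon> 0 0 ^ n / Z * measure_pmf.expectation (chain_law P \<pi> n)
        (\<lambda>xs. (test_function N g (window_count n 1 xs))\<^sup>2))"
    using den by (intro mult_left_mono)
  also have "\<dots> \<le> \<epsilon> ^ N / Z * ((\<Sum>x\<in>{1..N}. (g x - 1)\<^sup>2 * B x) + v N * A')"
    using count_gap_le[OF irreducible_reversible, of "test_function N g", OF zero] up unfolding ys by linarith
  finally have "\<epsilon> ^ N / Z * (?G * (hkernel N p \<epsilon> 0 0 ^ n / Z * B 0))
      \<le> \<epsilon> ^ N / Z * ((\<Sum>x\<in>{1..N}. (g x - 1)\<^sup>2 * B x) + v N * A')"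
    by (simp only: mult_ac)
  moreover have "\<epsilon> ^ N / Z > 0" using Z \<epsilon> by simp
  ultimately have "?G * (hkernel N p \<epsilon> 0 0 ^ n / Z * B 0) \<le> (\<Sum>x\<in>{1..N}. (g x - 1)\<^sup>2 * B x) + v N * A'"
    by (simp only: mult_le_cancel_left_pos)
  then show ?thesis by (simp only: B_def A'_def Z_def g_def)
qed

end

section \<open>Limits of recursions\<close>

lemma linear_recurrence_null:
  fixes e d :: "nat \<Rightarrow> real"
  assumes \<beta>: "0 \<le> \<beta>" "\<beta> < 1" and rec: "\<And>k. e (Suc k) = \<beta> * e k + d k" and d: "d \<longlonglongrightarrow> 0"
  shows "e \<longlonglongrightarrow> 0"
proof (rule LIMSEQ_I)
  fix r :: real assume r: "r > 0"
  define \<eta> where "\<eta> = r / 2 * (1 - \<beta>)"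
  have "\<eta> > 0" using r \<beta> by (simp add: \<eta>_def)
  then obtain k0 where k0: "\<And>k. k \<ge> k0 \<Longrightarrow> \<bar>d k\<bar> < \<eta>"
    using LIMSEQ_D[OF d] by auto
  have bound: "\<bar>e (k0 + j)\<bar> \<le> r / 2 + \<beta> ^ j * \<bar>e k0\<bar>" for j
  proof (induction j)
    case 0
    then show ?case using r by simp
  next
    case (Suc j)
    have "\<bar>e (k0 + Suc j)\<bar> \<le> \<beta> * \<bar>e (k0 + j)\<bar> + \<bar>d (k0 + j)\<bar>"
      using \<beta> abs_triangle_ineq[of "\<beta> * e (k0 + j)" "d (k0 + j)"] by (simp add: rec abs_mult)
    also have "\<dots> \<le> \<beta> * (r / 2 + \<beta> ^ j * \<bar>e k0\<bar>) + \<eta>"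
      using Suc.IH \<beta> k0[of "k0 + j"] by (intro add_mono mult_left_mono) auto
    also have "\<dots> = r / 2 + \<beta> ^ Suc j * \<bar>e k0\<bar>" by (simp add: \<eta>_def field_simps)
    finally show ?case .
  qed
  have "(\<lambda>j. \<beta> ^ j * \<bar>e k0\<bar>) \<longlonglongrightarrow> 0 * \<bar>e k0\<bar>"
    using \<beta> by (intro tendsto_intros LIMSEQ_power_zero) auto
  then have "(\<lambda>j. \<beta> ^ j * \<bar>e k0\<bar>) \<longlonglongrightarrow> 0" by simp
  then obtain j0 where j0: "\<And>j. j \<ge> j0 \<Longrightarrow> \<beta> ^ j * \<bar>e k0\<bar> < r / 2"
    using LIMSEQ_D[of "\<lambda>j. \<beta> ^ j * \<bar>e k0\<bar>" 0 "r / 2"] r \<beta> by (auto simp: abs_mult)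
  have "norm (e k - 0) < r" if "k \<ge> k0 + j0" for k
  proof -
    have "k0 + (k - k0) = k" "k - k0 \<ge> j0" using that by auto
    then have "\<bar>e k\<bar> \<le> r / 2 + \<beta> ^ (k - k0) * \<bar>e k0\<bar>" "\<beta> ^ (k - k0) * \<bar>e k0\<bar> < r / 2"
      using bound[of "k - k0"] j0[of "k - k0"] by simp_all
    then show ?thesis by simp
  qed
  then show "\<exists>no. \<forall>n\<ge>no. norm (e n - 0) < r" by blast
qed

lemma linear_recurrence_limit:
  fixes a c :: "nat \<Rightarrow> real"
  assumes \<beta>: "0 \<le> \<beta>" "\<beta> < 1" and rec: "\<And>k. a (Suc k) = \<beta> * a k + c k" and c: "c \<longlonglongrightarrow> C"
    and L: "L * (1 - \<beta>) = C"
  shows "a \<longlonglongrightarrow> L"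
proof -
  have "(\<lambda>k. a k - L) \<longlonglongrightarrow> 0"
  proof (rule linear_recurrence_null[OF \<beta>])
    show "a (Suc k) - L = \<beta> * (a k - L) + (c k - C)" for k
      using L by (simp add: rec algebra_simps)
    show "(\<lambda>k. c k - C) \<longlonglongrightarrow> 0" using c by (simp add: LIM_zero)
  qed
  then show ?thesis by (rule LIM_zero_cancel)
qed

lemma increments_limit:
  fixes a :: "nat \<Rightarrow> real"
  assumes "(\<lambda>k. a (Suc k) - a k) \<longlonglongrightarrow> D"
  shows "(\<lambda>k. a k / real k) \<longlonglongrightarrow> D"
proof (rule LIMSEQ_I)
  fix r :: real assume r: "r > 0"
  obtain k0 where k0: "\<And>k. k \<ge> k0 \<Longrightarrow> \<bar>a (Suc k) - a k - D\<bar> < r / 2"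
    using LIMSEQ_D[OF assms, of "r / 2"] r by auto
  have bound: "\<bar>a (k0 + j) - D * real (k0 + j)\<bar> \<le> \<bar>a k0 - D * real k0\<bar> + r / 2 * real j" for j
  proof (induction j)
    case (Suc j)
    have "a (k0 + Suc j) - D * real (k0 + Suc j) =
        (a (k0 + j) - D * real (k0 + j)) + (a (Suc (k0 + j)) - a (k0 + j) - D)"
      by (simp add: algebra_simps)
    then have "\<bar>a (k0 + Suc j) - D * real (k0 + Suc j)\<bar> \<le>
        \<bar>a (k0 + j) - D * real (k0 + j)\<bar> + \<bar>a (Suc (k0 + j)) - a (k0 + j) - D\<bar>" by simp
    moreover have "r / 2 * real (Suc j) = r / 2 * real j + r / 2" by (simp add: algebra_simps)
    ultimately show ?case using Suc.IH k0[of "k0 + j"] by linarith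
  qed simp
  define M where "M = \<bar>a k0 - D * real k0\<bar>"
  obtain k1 :: nat where k1: "real k1 > 2 * M / r" using reals_Archimedean2 by blast
  have "norm (a k / real k - D) < r" if k: "k \<ge> max (Suc k0) k1" for k
  proof -
    have kpos: "real k > 0" using k by simp
    have "\<bar>a k - D * real k\<bar> \<le> M + r / 2 * real (k - k0)"
      using bound[of "k - k0"] k by (simp add: M_def)
    also have "\<dots> \<le> M + r / 2 * real k" using r by simp
    also have "M < r / 2 * real k"
    proof -
      have "2 * M / r < real k" using k1 k by linarith
      then show ?thesis using r by (simp add: field_simps)
    qed
    finally have "\<bar>a k - D * real k\<bar> < r * real k" by simp
    moreover have "a k / real k - D = (a k - D * real k) / real k"
      using kpos by (simp add: field_simps)
    ultimately show ?thesis using kpos by (simp add: abs_divide field_simps)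
  qed
  then show "\<exists>no. \<forall>n\<ge>no. norm (a n / real n - D) < r" by blast
qed

section \<open>The sequence of quadratic iterates\<close>

lemma q_seq_bounds: "0 < q_seq r \<and> q_seq r \<le> 1 / 4"
proof (induction r)
  case (Suc r)
  have "q_seq (Suc r) \<le> q_seq r * 1" using Suc unfolding q_seq.simps by (intro mult_left_mono) auto
  also have "\<dots> \<le> 1 / 4" using Suc by simp
  finally show ?case using Suc by simp
qed simp

text \<open>
  The recursion \<open>q\<^sub>r\<^sub>+\<^sub>1 = q\<^sub>r\<^sup>2 + (1 - 2 q\<^sub>r) q\<^sub>r\<close>, unrolled from \<open>q\<^sub>0 = 1/4\<close>.
\<close>

lemma q_seq_expand:
  assumes "1 \<le> x" "x \<le> N"
  shows "(\<Sum>y=x..<N. (q_seq (N - 1 - y))\<^sup>2 * (\<Prod>i=x..<y. 1 - 2 * q_seq (N - 1 - i)))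
    + 1 / 4 * (\<Prod>i=x..<N. 1 - 2 * q_seq (N - 1 - i)) = q_seq (N - x)"
  using assms(2,1)
proof (induction x rule: inc_induct)
  case (step x)
  let ?w = "\<lambda>i. q_seq (N - 1 - i)" and ?s = "\<lambda>i. 1 - 2 * q_seq (N - 1 - i)"
  have pr: "(\<Prod>i=x..<y. ?s i) = ?s x * (\<Prod>i=Suc x..<y. ?s i)" if "x < y" for y
    using that by (rule prod.atLeast_Suc_lessThan)
  have "(\<Sum>y=x..<N. (?w y)\<^sup>2 * (\<Prod>i=x..<y. ?s i)) =
      (?w x)\<^sup>2 + (\<Sum>y=Suc x..<N. (?w y)\<^sup>2 * (\<Prod>i=x..<y. ?s i))"
    using step.hyps by (simp add: sum.atLeast_Suc_lessThan)
  also have "(\<Sum>y=Suc x..<N. (?w y)\<^sup>2 * (\<Prod>i=x..<y. ?s i)) =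
      ?s x * (\<Sum>y=Suc x..<N. (?w y)\<^sup>2 * (\<Prod>i=Suc x..<y. ?s i))"
    unfolding sum_distrib_left
  proof (intro sum.cong refl)
    fix y assume "y \<in> {Suc x..<N}"
    then have "x < y" by simp
    show "(?w y)\<^sup>2 * (\<Prod>i=x..<y. ?s i) = ?s x * ((?w y)\<^sup>2 * (\<Prod>i=Suc x..<y. ?s i))"
      unfolding pr[OF \<open>x < y\<close>] by (rule mult.left_commute)
  qed
  finally have "(\<Sum>y=x..<N. (?w y)\<^sup>2 * (\<Prod>i=x..<y. ?s i)) + 1 / 4 * (\<Prod>i=x..<N. ?s i) =
      (?w x)\<^sup>2 + ?s x * ((\<Sum>y=Suc x..<N. (?w y)\<^sup>2 * (\<Prod>i=Suc x..<y. ?s i)) + 1 / 4 * (\<Prod>i=Suc x..<N. ?s i))"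
    by (simp only: pr[OF step.hyps(2)] distrib_left add.assoc mult.left_commute)
  also have "\<dots> = (?w x)\<^sup>2 + ?s x * ?w x"
    using step.IH step.prems by simp
  also have "\<dots> = q_seq (Suc (N - 1 - x))"
    by (simp add: power2_eq_square algebra_simps)
  also have "Suc (N - 1 - x) = N - x" using step.hyps by simp
  finally show ?case .
qed simp

text \<open>
  With \<open>b\<^sub>r = 1/q\<^sub>r - 1\<close> the recursion becomes \<open>b\<^sub>r\<^sub>+\<^sub>1 = b\<^sub>r + 1 + 1/b\<^sub>r\<close>. Then \<open>b\<^sub>r - ln b\<^sub>r\<close> increases by
  \<open>1 + O(1/b\<^sub>r\<^sup>2)\<close> in each step, and these errors are summable because \<open>b\<^sub>r \<ge> r + 3\<close>.
\<close>

lemma q_seq_asymptotics: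
  "\<exists>\<epsilon> :: nat \<Rightarrow> real. \<epsilon> \<in> O(\<lambda>_. 1) \<and>
     (\<forall>\<^sub>F r in sequentially. q_seq r = 1 / (real r + ln (real r) + \<epsilon> r))"
proof -
  define b where "b r = 1 / q_seq r - 1" for r
  have qpos: "q_seq r > 0" for r using q_seq_bounds by simp
  have b_rec: "b (Suc r) = b r + 1 + 1 / b r" for r
    using q_seq_bounds[of r] by (simp add: b_def field_simps power2_eq_square)
  have b_ge: "b r \<ge> real r + 3" for r
  proof (induction r)
    case (Suc r)
    then show ?case using b_rec[of r] by (simp add: add_increasing2)
  qed (simp add: b_def)
  have b_le: "b r \<le> 2 * (real r + 3)" for r
  proof (induction r)
    case (Suc r)
    have "1 / b r \<le> 1" using b_ge[of r] by simp
    then show ?case using Suc b_rec[of r] by simp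
  qed (simp add: b_def)
  define \<phi> where "\<phi> r = b r - ln (b r) - real r" for r
  have step: "\<bar>\<phi> (Suc r) - \<phi> r\<bar> \<le> 2 / (real r + 3) ^ 2" for r
  proof -
    define u where "u = 1 / b r"
    have bpos: "b r > 0" using b_ge[of r] by linarith
    have u: "0 < u" "u \<le> 1 / 3" using b_ge[of r] bpos by (auto simp: u_def field_simps)
    have "b (Suc r) = b r * (1 + (u + u\<^sup>2))"
      using bpos by (simp add: b_rec u_def field_simps power2_eq_square)
    then have "ln (b (Suc r)) = ln (b r * (1 + (u + u\<^sup>2)))" by simp
    also have "\<dots> = ln (b r) + ln (1 + (u + u\<^sup>2))"
      using bpos u by (intro ln_mult_pos) (auto intro!: add_pos_pos)
    finally have eq: "\<phi> (Suc r) - \<phi> r = u - ln (1 + (u + u\<^sup>2))"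
      by (simp add: \<phi>_def b_rec u_def)
    have x: "0 \<le> u + u\<^sup>2" using u by simp
    have "ln (1 + (u + u\<^sup>2)) \<le> u + u\<^sup>2" using x by (rule ln_add_one_self_le_self)
    moreover have "u + u\<^sup>2 - (u + u\<^sup>2)\<^sup>2 \<le> ln (1 + (u + u\<^sup>2))"
    proof (rule ln_one_plus_pos_lower_bound[OF x])
      have "u * u \<le> 1/3 * (1/3)" using u by (intro mult_mono) auto
      then show "u + u\<^sup>2 \<le> 1" using u by (simp add: power2_eq_square)
    qed
    moreover have "(u + u\<^sup>2)\<^sup>2 \<le> 2 * u\<^sup>2"
    proof -
      have "(u + u\<^sup>2)\<^sup>2 = u\<^sup>2 * (1 + u)\<^sup>2" by (simp add: power2_eq_square algebra_simps)
      also have "\<dots> \<le> u\<^sup>2 * 2"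
      proof (rule mult_left_mono)
        have "(1 + u)\<^sup>2 \<le> (4/3)\<^sup>2" using u by (intro power_mono) auto
        then show "(1 + u)\<^sup>2 \<le> 2" by (simp add: power2_eq_square)
      qed simp
      finally show ?thesis by simp
    qed
    ultimately have "\<bar>\<phi> (Suc r) - \<phi> r\<bar> \<le> 2 * u\<^sup>2"
      unfolding eq using u by (simp add: abs_le_iff)
    also have "u\<^sup>2 \<le> (1 / (real r + 3))\<^sup>2"
      using b_ge[of r] u unfolding u_def by (intro power_mono divide_left_mono) auto
    finally show ?thesis by (simp add: power_divide)
  qed
  \<comment> \<open>The increments are dominated by a telescoping sum: \<open>2/(r+3)\<^sup>2 \<le> 2/(r+2) - 2/(r+3)\<close>.\<close>
  have summ: "\<bar>\<phi> r - \<phi> 0\<bar> \<le> 1 - 2 / (real r + 2)" for r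
  proof (induction r)
    case (Suc r)
    have "2 / (real r + 3) ^ 2 \<le> 2 / ((real r + 2) * (real r + 3))"
      unfolding power2_eq_square by (intro divide_left_mono mult_right_mono) auto
    also have "\<dots> = 2 / (real r + 2) - 2 / (real r + 3)"
      by (simp add: field_simps)
    finally have "2 / (real r + 3) ^ 2 \<le> 2 / (real r + 2) - 2 / (real r + 3)" .
    then show ?case using Suc step[of r] by (simp add: algebra_simps)
  qed simp
  define e where "e r = 1 / q_seq r - real r - ln (real r)" for r
  have "\<bar>e r\<bar> \<le> \<bar>\<phi> 0\<bar> + 3 + ln 8" if r: "r \<ge> 1" for r
  proof -
    have pos: "real r > 0" "b r > 0" using r b_ge[of r] by auto
    have "e r = \<phi> r + 1 + (ln (b r) - ln (real r))" by (simp add: e_def \<phi>_def b_def)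
    moreover have "\<bar>\<phi> r\<bar> \<le> \<bar>\<phi> 0\<bar> + 2"
    proof -
      have "2 / (real r + 2) \<ge> 0" by simp
      then show ?thesis using summ[of r] by linarith
    qed
    moreover have "ln (real r) \<le> ln (b r)"
      using b_ge[of r] pos by (subst ln_le_cancel_iff) auto
    moreover have "ln (b r) \<le> ln (8 * real r)"
      using b_le[of r] r pos by (subst ln_le_cancel_iff) auto
    moreover have "ln (8 * real r) = ln 8 + ln (real r)" using pos by (intro ln_mult_pos) auto
    ultimately show ?thesis by linarith
  qed
  then have "e \<in> O(\<lambda>_. 1)"
    by (intro bigoI[of _ "\<bar>\<phi> 0\<bar> + 3 + ln 8"] eventually_sequentiallyI[of 1]) simp
  moreover have "\<forall>\<^sub>F r in sequentially. q_seq r = 1 / (real r + ln (real r) + e r)"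
    by (simp add: e_def)
  ultimately show ?thesis by blast
qed

lemma q_seq_le: "q_seq r \<le> 1 / (real r + 4)"
proof (induction r)
  case (Suc r)
  have q: "0 < q_seq r" "q_seq r \<le> 1 / 4" using q_seq_bounds by auto
  have "1 / q_seq (Suc r) = 1 / q_seq r + 1 / (1 - q_seq r)"
    using q by (simp add: field_simps)
  moreover have "1 / q_seq r \<ge> real r + 4" using Suc q by (simp add: field_simps)
  moreover have "1 / (1 - q_seq r) \<ge> 1" using q by simp
  ultimately have *: "1 / q_seq (Suc r) \<ge> real (Suc r) + 4" by simp
  have "q_seq (Suc r) > 0" using q_seq_bounds by blast
  then show ?case using * by (simp add: field_simps del: q_seq.simps)
qed simp

section \<open>Vanishing mass of the upper states and growing windows\<close>

lemma tendsto_path_weight: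
  "((\<lambda>\<epsilon>. path_weight N (hkernel N p \<epsilon>) v k x) \<longlongrightarrow> path_weight N (hkernel N p 0) v k x) (at_right 0)"
  by (induction k arbitrary: x) (auto intro!: tendsto_intros tendsto_hkernel)

lemma tendsto_hit_weight:
  "((\<lambda>\<epsilon>. hit_weight N (hkernel N p \<epsilon>) v k x) \<longlongrightarrow> hit_weight N (hkernel N p 0) v k x) (at_right 0)"
proof (induction k arbitrary: x)
  case (Suc k)
  show ?case
  proof (cases "x = N")
    case True
    then show ?thesis using tendsto_path_weight[of N p v "Suc k" N] by simp
  next
    case False
    then show ?thesis by (auto intro!: tendsto_intros tendsto_hkernel Suc.IH)
  qed
qed simp

lemma path_weight_limit_kernel:
  assumes "x \<le> N"
  shows "path_weight N (hkernel N p 0) v (Suc k) x =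
    (if x = 0 then v 0 * path_weight N (hkernel N p 0) v k 0
     else (1 - p) * v x * path_weight N (hkernel N p 0) v k x + p * v (x - 1) * path_weight N (hkernel N p 0) v k (x - 1))"
proof -
  let ?F = "path_weight N (hkernel N p 0) v k"
  have "path_weight N (hkernel N p 0) v (Suc k) x =
      (\<Sum>y\<le>N. (if y = x then (if x = 0 then 1 else 1 - p) * v x * ?F x else 0)
        + (if y = x - 1 then (if x = 0 then 0 else p * v (x - 1) * ?F (x - 1)) else 0))"
    unfolding path_weight.simps using assms by (intro sum.cong) (auto simp: hkernel_0)
  then show ?thesis using assms by (auto simp: sum.distrib)
qed

lemma hit_weight_limit_kernel:
  assumes "x < N"
  shows "hit_weight N (hkernel N p 0) v (Suc k) x =
    (if x = 0 then 1 else 1 - p) * v x * hit_weight N (hkernel N p 0) v k x + p * v (Suc x) * hit_weight N (hkernel N p 0) v k (Suc x)"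
proof -
  let ?F = "hit_weight N (hkernel N p 0) v k"
  have "hit_weight N (hkernel N p 0) v (Suc k) x =
      (\<Sum>y\<le>N. (if y = x then (if x = 0 then 1 else 1 - p) * v x * ?F x else 0)
        + (if y = Suc x then p * v (Suc x) * ?F (Suc x) else 0))"
    using assms unfolding hit_weight.simps by (auto simp: hkernel_0 intro!: sum.cong)
  then show ?thesis using assms by (simp add: sum.distrib)
qed

text \<open>
  To leading order as \<open>\<epsilon> \<rightarrow> 0\<close>, an excursion that meets \<open>N\<close> climbs to it through \<open>1, \<dots>, N - 1\<close> and descends
  again, staying in each state for a geometric time of parameter \<open>p\<close>. With visit weight \<open>v x = 1 / (1 - p + p \<sigma> x)\<close> such a stay contributes
  the factor \<open>1 / \<sigma> x\<close>, because \<open>p v x / (1 - (1 - p) v x) = 1 / \<sigma> x\<close>. The value \<open>\<sigma> 0\<close> does not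
  enter.
\<close>

locale stage_weights =
  fixes N :: nat and p :: real and \<sigma> v :: "nat \<Rightarrow> real"
  assumes N_pos: "1 \<le> N" and p: "0 < p" "p < 1"
    and \<sigma>: "\<And>x. 0 < \<sigma> x" "\<And>x. \<sigma> x \<le> 1"
    and v_0: "v 0 = 1" and v_eq: "\<And>x. x \<ge> 1 \<Longrightarrow> v x = 1 / (1 - p + p * \<sigma> x)"
begin

text \<open>The total factor of one stay in each state of \<open>I\<close>.\<close>

definition \<rho> :: "nat set \<Rightarrow> real" where
  "\<rho> I = (\<Prod>i\<in>I. 1 / \<sigma> i)"

lemma \<rho>_pos: "\<rho> I > 0"
  using \<sigma> by (simp add: \<rho>_def prod_pos)

lemma v_denom: "1 - p + p * \<sigma> x > 0"
  using p \<sigma>(1)[of x] by (simp add: add_pos_pos)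

lemma v_ge_1: "v x \<ge> 1"
proof (cases "x = 0")
  case False
  then have "v x = 1 / (1 - p + p * \<sigma> x)" using v_eq by simp
  moreover have "p * \<sigma> x \<le> p * 1" using \<sigma> p by (intro mult_left_mono) auto
  ultimately show ?thesis using v_denom[of x] by simp
qed (simp add: v_0)

lemma v_pos: "v x > 0"
  using v_ge_1[of x] by simp

lemma stay_weight:
  assumes "x \<ge> 1"
  shows "0 \<le> (1 - p) * v x" "(1 - p) * v x < 1" "1 - (1 - p) * v x = p * \<sigma> x * v x"
  using assms v_denom[of x] p \<sigma>(1)[of x] by (auto simp: v_eq field_simps)

lemma path_weight_limit: "x \<le> N \<Longrightarrow> (\<lambda>k. path_weight N (hkernel N p 0) v k x) \<longlonglongrightarrow> \<rho> {1..x} / v x"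
proof (induction x)
  case 0
  have "path_weight N (hkernel N p 0) v k 0 = 1" for k
    by (induction k) (simp_all add: path_weight_limit_kernel v_0 del: path_weight.simps(2))
  then show ?case by (simp add: \<rho>_def v_0)
next
  case (Suc x)
  show ?case
  proof (rule linear_recurrence_limit[of "(1 - p) * v (Suc x)"])
    show "path_weight N (hkernel N p 0) v (Suc k) (Suc x) =
        (1 - p) * v (Suc x) * path_weight N (hkernel N p 0) v k (Suc x) + p * v x * path_weight N (hkernel N p 0) v k x" for k
      using Suc.prems by (simp add: path_weight_limit_kernel del: path_weight.simps(2))
    show "(\<lambda>k. p * v x * path_weight N (hkernel N p 0) v k x) \<longlonglongrightarrow> p * v x * (\<rho> {1..x} / v x)"
      using Suc by (intro tendsto_intros) auto
    have "\<rho> {1..Suc x} = \<rho> {1..x} / \<sigma> (Suc x)" by (simp add: \<rho>_def)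
    then show "\<rho> {1..Suc x} / v (Suc x) * (1 - (1 - p) * v (Suc x)) = p * v x * (\<rho> {1..x} / v x)"
      using v_pos[of x] v_pos[of "Suc x"] \<sigma>(1)[of "Suc x"] by (simp add: stay_weight)
  qed (use stay_weight in auto)
qed

lemma hit_weight_limit:
  assumes "1 \<le> x" "x \<le> N"
  shows "(\<lambda>k. hit_weight N (hkernel N p 0) v k x) \<longlonglongrightarrow> \<rho> {x..N} * \<rho> {1..<N} / v x"
  using assms(2,1)
proof (induction x rule: inc_induct)
  case base
  have "hit_weight N (hkernel N p 0) v k N = path_weight N (hkernel N p 0) v k N" for k
    by (cases k) auto
  moreover have "\<rho> {1..N} = \<rho> {N..N} * \<rho> {1..<N}"
  proof -
    have "{1..N} = insert N {1..<N}" using N_pos by auto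
    then show ?thesis by (simp add: \<rho>_def)
  qed
  ultimately show ?case using path_weight_limit[of N] by simp
next
  case (step x)
  show ?case
  proof (rule linear_recurrence_limit[of "(1 - p) * v x"])
    show "hit_weight N (hkernel N p 0) v (Suc k) x =
        (1 - p) * v x * hit_weight N (hkernel N p 0) v k x + p * v (Suc x) * hit_weight N (hkernel N p 0) v k (Suc x)" for k
      using step by (simp add: hit_weight_limit_kernel del: hit_weight.simps(2))
    show "(\<lambda>k. p * v (Suc x) * hit_weight N (hkernel N p 0) v k (Suc x)) \<longlonglongrightarrow>
        p * v (Suc x) * (\<rho> {Suc x..N} * \<rho> {1..<N} / v (Suc x))"
      using step by (intro tendsto_intros) auto
    have "{x..N} = insert x {Suc x..N}" using step by auto
    then have "\<rho> {x..N} = \<rho> {Suc x..N} / \<sigma> x" by (simp add: \<rho>_def)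
    then show "\<rho> {x..N} * \<rho> {1..<N} / v x * (1 - (1 - p) * v x) =
        p * v (Suc x) * (\<rho> {Suc x..N} * \<rho> {1..<N} / v (Suc x))"
      using v_pos[of x] v_pos[of "Suc x"] \<sigma>(1)[of x] step by (simp add: stay_weight)
  qed (use stay_weight step in auto)
qed

text \<open>
  An excursion from \<open>0\<close> passes once through \<open>N\<close> and twice through each of \<open>1, \<dots>, N - 1\<close>, and it can begin
  at any of \<open>k\<close> times.
\<close>

lemma hit_weight_0_growth: "(\<lambda>k. hit_weight N (hkernel N p 0) v k 0 / real k) \<longlonglongrightarrow> p * (\<rho> {1..N} * \<rho> {1..<N})"
proof (rule increments_limit)
  have "hit_weight N (hkernel N p 0) v (Suc k) 0 - hit_weight N (hkernel N p 0) v k 0 = p * v 1 * hit_weight N (hkernel N p 0) v k 1" for k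
    using N_pos by (subst hit_weight_limit_kernel) (auto simp: v_0)
  moreover have "(\<lambda>k. p * v 1 * hit_weight N (hkernel N p 0) v k 1) \<longlonglongrightarrow> p * v 1 * (\<rho> {1..N} * \<rho> {1..<N} / v 1)"
    using N_pos by (intro tendsto_intros hit_weight_limit) auto
  ultimately show "(\<lambda>k. hit_weight N (hkernel N p 0) v (Suc k) 0 - hit_weight N (hkernel N p 0) v k 0) \<longlonglongrightarrow> p * (\<rho> {1..N} * \<rho> {1..<N})"
    using v_pos[of 1] by simp
qed

text \<open>The right-hand side of the variational bound for windows of length \<open>n\<close>.\<close>

definition numerator :: "real \<Rightarrow> nat \<Rightarrow> real" where
  "numerator \<epsilon> n = (\<Sum>x\<in>{1..N}. (sqrt (v x) - 1)\<^sup>2 * hit_weight N (hkernel N p \<epsilon>) v n x)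
      + v N * (\<Sum>y<N. hkernel N p \<epsilon> N y * v y * path_weight N (hkernel N p \<epsilon>) v (n - 1) y)"

lemma tendsto_numerator: "((\<lambda>\<epsilon>. numerator \<epsilon> n) \<longlongrightarrow> numerator 0 n) (at_right 0)"
  unfolding numerator_def by (intro tendsto_intros tendsto_path_weight tendsto_hit_weight tendsto_hkernel)

text \<open>
  The limit of the bound for \<open>n Gap / p\<close> as \<open>\<epsilon> \<rightarrow> 0\<close> and then \<open>n \<rightarrow> \<infinity>\<close>. Here
  \<open>1 - sqrt (1 - p + p \<sigma> x) = 1 - 1 / sqrt (v x)\<close>.
\<close>

definition ratio_limit :: real where
  "ratio_limit = (\<Sum>x\<in>{1..N}. ((1 - sqrt (1 - p + p * \<sigma> x)) / p)\<^sup>2 * (\<Prod>i\<in>{1..<x}. \<sigma> i))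
     + v N * (\<Prod>i\<in>{1..N}. \<sigma> i) / p"

lemma numerator_limit:
  "(\<lambda>n. numerator 0 n) \<longlonglongrightarrow> ratio_limit * (p * (p * (\<rho> {1..N} * \<rho> {1..<N})))"
proof -
  have tail: "(\<Sum>y<N. hkernel N p 0 N y * v y * path_weight N (hkernel N p 0) v (n - 1) y) =
      p * v (N - 1) * path_weight N (hkernel N p 0) v (n - 1) (N - 1)" for n
  proof -
    have "(\<Sum>y<N. hkernel N p 0 N y * v y * path_weight N (hkernel N p 0) v (n - 1) y) =
      (\<Sum>y<N. if y = N - 1 then p * v (N - 1) * path_weight N (hkernel N p 0) v (n - 1) (N - 1) else 0)"
      using N_pos by (intro sum.cong) (auto simp: hkernel_0)
    then show ?thesis using N_pos by simp
  qed
  have "(\<lambda>n. path_weight N (hkernel N p 0) v (n - 1) (N - 1)) \<longlonglongrightarrow> \<rho> {1..N - 1} / v (N - 1)"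
  proof -
    have "(\<lambda>n. path_weight N (hkernel N p 0) v n (N - 1)) \<longlonglongrightarrow> \<rho> {1..N - 1} / v (N - 1)"
      by (rule path_weight_limit) simp
    then have "(\<lambda>n. path_weight N (hkernel N p 0) v (Suc n - 1) (N - 1)) \<longlonglongrightarrow> \<rho> {1..N - 1} / v (N - 1)" by simp
    then show ?thesis by (rule LIMSEQ_imp_Suc)
  qed
  then have "(\<lambda>n. numerator 0 n) \<longlonglongrightarrow>
      (\<Sum>x\<in>{1..N}. (sqrt (v x) - 1)\<^sup>2 * (\<rho> {x..N} * \<rho> {1..<N} / v x))
      + v N * (p * v (N - 1) * (\<rho> {1..N - 1} / v (N - 1)))"
    unfolding numerator_def tail by (intro tendsto_intros hit_weight_limit) auto
  moreover have "(\<Sum>x\<in>{1..N}. (sqrt (v x) - 1)\<^sup>2 * (\<rho> {x..N} * \<rho> {1..<N} / v x)) =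
      (\<Sum>x\<in>{1..N}. ((1 - sqrt (1 - p + p * \<sigma> x)) / p)\<^sup>2 * (\<Prod>i\<in>{1..<x}. \<sigma> i)) *
        (p * (p * (\<rho> {1..N} * \<rho> {1..<N})))"
    unfolding sum_distrib_right
  proof (intro sum.cong refl)
    fix x assume x: "x \<in> {1..N}"
    have inv: "sqrt (1 - p + p * \<sigma> x) = 1 / sqrt (v x)"
      using x by (simp add: v_eq real_sqrt_divide)
    have "(sqrt (v x) - 1)\<^sup>2 / v x = (1 - sqrt (1 - p + p * \<sigma> x))\<^sup>2"
    proof -
      have "(sqrt (v x) - 1)\<^sup>2 / v x = ((sqrt (v x) - 1) / sqrt (v x))\<^sup>2"
        using v_pos[of x] by (simp add: power_divide)
      also have "(sqrt (v x) - 1) / sqrt (v x) = 1 - 1 / sqrt (v x)"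
        using v_pos[of x] by (simp add: diff_divide_distrib)
      finally show ?thesis by (simp add: inv)
    qed
    moreover have "\<rho> {x..N} = (\<Prod>i\<in>{1..<x}. \<sigma> i) * \<rho> {1..N}"
    proof -
      have "{1..N} = {1..<x} \<union> {x..N}" using x by auto
      then have "\<rho> {1..N} = \<rho> {1..<x} * \<rho> {x..N}"
        unfolding \<rho>_def by (simp only:) (rule prod.union_disjoint, auto)
      moreover have "(\<Prod>i\<in>{1..<x}. \<sigma> i) * \<rho> {1..<x} = 1"
        using \<sigma>(1) by (simp add: \<rho>_def less_imp_neq[symmetric] flip: prod.distrib)
      ultimately show ?thesis by (simp add: mult.assoc[symmetric])
    qed
    ultimately have "(sqrt (v x) - 1)\<^sup>2 / v x * \<rho> {x..N} * \<rho> {1..<N} =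
        (1 - sqrt (1 - p + p * \<sigma> x))\<^sup>2 * ((\<Prod>i\<in>{1..<x}. \<sigma> i) * \<rho> {1..N}) * \<rho> {1..<N}"
      by simp
    then show "(sqrt (v x) - 1)\<^sup>2 * (\<rho> {x..N} * \<rho> {1..<N} / v x) =
        ((1 - sqrt (1 - p + p * \<sigma> x)) / p)\<^sup>2 * (\<Prod>i\<in>{1..<x}. \<sigma> i) * (p * (p * (\<rho> {1..N} * \<rho> {1..<N})))"
      using p by (simp add: power_divide power2_eq_square[of p] mult_ac)
  qed
  moreover have "v N * (p * v (N - 1) * (\<rho> {1..N - 1} / v (N - 1))) =
      v N * (\<Prod>i\<in>{1..N}. \<sigma> i) / p * (p * (p * (\<rho> {1..N} * \<rho> {1..<N})))"
  proof -
    define X where "X = \<rho> {1..<N}"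
    define R where "R = \<rho> {1..N}"
    define S where "S = (\<Prod>i\<in>{1..N}. \<sigma> i)"
    have SR: "S * R = 1"
      using \<sigma>(1) by (simp add: S_def R_def \<rho>_def less_imp_neq[symmetric] flip: prod.distrib)
    have "{1..N - 1} = {1..<N}" using N_pos by auto
    then have "v N * (p * v (N - 1) * (\<rho> {1..N - 1} / v (N - 1))) = v N * (p * X) * (S * R)"
      using v_pos[of "N - 1"] by (simp add: X_def SR)
    also have "\<dots> = v N * S / p * (p * (p * (R * X)))"
      using p by simp
    finally show ?thesis by (simp only: X_def R_def S_def)
  qed
  ultimately show ?thesis by (simp add: ratio_limit_def distrib_right)
qed

lemma window_ratio_limit:
  "(\<lambda>n. real n * numerator 0 n / (p * hit_weight N (hkernel N p 0) v n 0)) \<longlonglongrightarrow> ratio_limit"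
proof -
  define D where "D = p * (\<rho> {1..N} * \<rho> {1..<N})"
  have D: "D > 0" using p \<rho>_pos by (simp add: D_def)
  have "(\<lambda>n. numerator 0 n / (p * (hit_weight N (hkernel N p 0) v n 0 / real n))) \<longlonglongrightarrow> ratio_limit * (p * D) / (p * D)"
    using D p hit_weight_0_growth numerator_limit unfolding D_def by (intro tendsto_intros) auto
  moreover have "ratio_limit * (p * D) / (p * D) = ratio_limit" using D p by simp
  moreover have "numerator 0 n / (p * (hit_weight N (hkernel N p 0) v n 0 / real n)) =
      real n * numerator 0 n / (p * hit_weight N (hkernel N p 0) v n 0)" for n
    by simp
  ultimately show ?thesis by (simp only:)
qed

lemma hit_weight_eventually_pos: "\<forall>\<^sub>F n in sequentially. hit_weight N (hkernel N p 0) v n 0 > 0"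
proof -
  have "p * (\<rho> {1..N} * \<rho> {1..<N}) > 0" using p \<rho>_pos by simp
  from order_tendstoD(1)[OF hit_weight_0_growth this] show ?thesis
    by (rule eventually_mono) (auto simp: zero_less_divide_iff)
qed

end

section \<open>Choice of the growth rates\<close>

text \<open>
  The choice of the stage factors. The growth rate in state \<open>i\<close> is \<open>q\<^bsub>N-1-i\<^esub>\<close>; in the top state it is
  \<open>(1 - p\<^sup>2)/2\<close>, just below the critical value \<open>1/2\<close> at which the second moment of the test function diverges.
  The deficit \<open>p\<^sup>2\<close> tends to zero faster than \<open>p\<close>, so that the cost \<open>v N \<Prod>\<sigma> / p\<close> of the jump of the test
  function at the first visit to the top is negligible.
\<close>

definition stage_sigma :: "nat \<Rightarrow> real \<Rightarrow> nat \<Rightarrow> real" where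
  "stage_sigma N p i = (if i = N then p\<^sup>2 else 1 - 2 * q_seq (N - 1 - i))"

definition stage_v :: "nat \<Rightarrow> real \<Rightarrow> nat \<Rightarrow> real" where
  "stage_v N p x = (if x = 0 then 1 else 1 / (1 - p + p * stage_sigma N p x))"

lemma stage_weights_q_seq:
  assumes "1 \<le> N" "0 < p" "p < 1"
  shows "stage_weights N p (stage_sigma N p) (stage_v N p)"
proof
  fix x
  show "0 < stage_sigma N p x"
    using assms q_seq_bounds[of "N - 1 - x"] by (auto simp: stage_sigma_def)
  have "p\<^sup>2 \<le> 1" using assms by (simp add: power_le_one)
  then show "stage_sigma N p x \<le> 1"
    using q_seq_bounds[of "N - 1 - x"] by (auto simp: stage_sigma_def)
qed (use assms in \<open>auto simp: stage_v_def\<close>)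

lemma sqrt_quotient_limit:
  assumes s: "(s \<longlongrightarrow> s0) (at_right (0::real))" and nonneg: "\<And>p. s p \<ge> 0"
  shows "((\<lambda>p. (1 - sqrt (1 - p + p * s p)) / p) \<longlongrightarrow> (1 - s0) / 2) (at_right 0)"
proof (rule Lim_transform_eventually)
  have "((\<lambda>p. (1 - s p) / (1 + sqrt (1 - p + p * s p))) \<longlongrightarrow>
      (1 - s0) / (1 + sqrt (1 - 0 + 0 * s0))) (at_right 0)"
    by (intro tendsto_intros s) auto
  then show "((\<lambda>p. (1 - s p) / (1 + sqrt (1 - p + p * s p))) \<longlongrightarrow> (1 - s0) / 2) (at_right 0)"
    by simp
  have "\<forall>\<^sub>F p in at_right 0. (0::real) < p \<and> p < 1"
    by (auto simp: eventually_at_right_field intro!: exI[of _ 1])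
  then show "\<forall>\<^sub>F p in at_right 0. (1 - s p) / (1 + sqrt (1 - p + p * s p)) =
      (1 - sqrt (1 - p + p * s p)) / p"
  proof eventually_elim
    case (elim p)
    define z where "z = 1 - p + p * s p"
    have z: "z \<ge> 0" using elim nonneg[of p] by (simp add: z_def)
    then have "(1 - sqrt z) * (1 + sqrt z) = p * (1 - s p)"
      by (simp add: algebra_simps z_def)
    moreover have "1 + sqrt z > 0" using real_sqrt_ge_zero[OF z] by linarith
    ultimately show ?case using elim by (simp add: frac_eq_eq z_def[symmetric] mult.commute)
  qed
qed

text \<open>
  As \<open>p \<rightarrow> 0\<close> the stage \<open>x < N\<close> contributes \<open>q\<^sup>2\<close> with \<open>q = (1 - \<sigma> x)/2\<close> and the top stage \<open>1/4\<close>, each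
  discounted by the factors of the lower stages; this is the expansion of \<open>q\<^bsub>N-1\<^esub>\<close>.
\<close>

lemma ratio_limit_tendsto:
  assumes N: "1 \<le> N"
  shows "((\<lambda>p. stage_weights.ratio_limit N p (stage_sigma N p) (stage_v N p)) \<longlongrightarrow> q_seq (N - 1)) (at_right 0)"
proof (rule Lim_transform_eventually)
  define \<sigma>0 where "\<sigma>0 i = 1 - 2 * q_seq (N - 1 - i)" for i
  define s0 where "s0 i = (if i = N then 0 else \<sigma>0 i)" for i
  define F where "F p = (\<Sum>x\<in>{1..N}. ((1 - sqrt (1 - p + p * stage_sigma N p x)) / p)\<^sup>2 * (\<Prod>i\<in>{1..<x}. \<sigma>0 i))
     + 1 / (1 - p + p * p\<^sup>2) * (\<Prod>i\<in>{1..<N}. \<sigma>0 i) * p" for p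
  have ev: "\<forall>\<^sub>F p in at_right 0. (0::real) < p \<and> p < 1"
    by (auto simp: eventually_at_right_field intro!: exI[of _ 1])
  then show "\<forall>\<^sub>F p in at_right 0. F p = stage_weights.ratio_limit N p (stage_sigma N p) (stage_v N p)"
  proof eventually_elim
    case (elim p)
    then interpret stage_weights N p "stage_sigma N p" "stage_v N p"
      by (intro stage_weights_q_seq N) auto
    have "(\<Prod>i\<in>{1..<x}. stage_sigma N p i) = (\<Prod>i\<in>{1..<x}. \<sigma>0 i)" if "x \<le> N" for x
      using that by (intro prod.cong) (auto simp: stage_sigma_def \<sigma>0_def)
    moreover have "(\<Prod>i\<in>{1..N}. stage_sigma N p i) = (\<Prod>i\<in>{1..<N}. \<sigma>0 i) * p\<^sup>2"
    proof -
      have "{1..N} = insert N {1..<N}" using N by auto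
      then show ?thesis
        by (simp add: stage_sigma_def[of N p N] mult.commute)
          (intro disjI2 prod.cong, auto simp: stage_sigma_def \<sigma>0_def)
    qed
    ultimately show ?case
      using elim N unfolding ratio_limit_def F_def
      by (simp add: stage_v_def stage_sigma_def[of N p N] power2_eq_square[of p])
  qed
  have sig: "((\<lambda>p. stage_sigma N p x) \<longlongrightarrow> s0 x) (at_right 0)" for x
  proof (cases "x = N")
    case True
    have "((\<lambda>p::real. p\<^sup>2) \<longlongrightarrow> 0\<^sup>2) (at_right 0)" by (intro tendsto_intros)
    then show ?thesis using True by (simp add: stage_sigma_def s0_def)
  qed (simp add: stage_sigma_def s0_def \<sigma>0_def)
  have sig_nonneg: "stage_sigma N p x \<ge> 0" for p x
    using q_seq_bounds[of "N - 1 - x"] by (simp add: stage_sigma_def)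
  have "(F \<longlongrightarrow> (\<Sum>x\<in>{1..N}. ((1 - s0 x) / 2)\<^sup>2 * (\<Prod>i\<in>{1..<x}. \<sigma>0 i))
      + 1 / (1 - 0 + 0 * 0\<^sup>2) * (\<Prod>i\<in>{1..<N}. \<sigma>0 i) * 0) (at_right 0)"
    unfolding F_def by (intro tendsto_intros sqrt_quotient_limit sig sig_nonneg) auto
  also have "(\<Sum>x\<in>{1..N}. ((1 - s0 x) / 2)\<^sup>2 * (\<Prod>i\<in>{1..<x}. \<sigma>0 i))
      + 1 / (1 - 0 + 0 * 0\<^sup>2) * (\<Prod>i\<in>{1..<N}. \<sigma>0 i) * 0 = q_seq (N - 1)"
  proof -
    have "{1..N} = insert N {1..<N}" using N by auto
    then have "(\<Sum>x\<in>{1..N}. ((1 - s0 x) / 2)\<^sup>2 * (\<Prod>i\<in>{1..<x}. \<sigma>0 i)) =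
        1 / 4 * (\<Prod>i\<in>{1..<N}. \<sigma>0 i) + (\<Sum>x\<in>{1..<N}. ((1 - s0 x) / 2)\<^sup>2 * (\<Prod>i\<in>{1..<x}. \<sigma>0 i))"
      by (simp add: s0_def power2_eq_square)
    also have "(\<Sum>x\<in>{1..<N}. ((1 - s0 x) / 2)\<^sup>2 * (\<Prod>i\<in>{1..<x}. \<sigma>0 i)) =
        (\<Sum>x=1..<N. (q_seq (N - 1 - x))\<^sup>2 * (\<Prod>i=1..<x. \<sigma>0 i))"
      by (intro sum.cong) (auto simp: s0_def \<sigma>0_def)
    finally show ?thesis using q_seq_expand[of 1 N] N by (simp add: \<sigma>0_def)
  qed
  finally show "(F \<longlongrightarrow> q_seq (N - 1)) (at_right 0)" .
qed

context stage_weights begin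

lemma exists_gap_ratio_less:
  assumes n: "n \<ge> 2" and hit_pos: "hit_weight N (hkernel N p 0) v n 0 > 0"
    and less: "real n * numerator 0 n / (p * hit_weight N (hkernel N p 0) v n 0) < c"
  shows "\<exists>\<epsilon> P \<pi>. hierarchical_chain N p \<epsilon> P \<pi> \<and> gap_ratio {..N} P \<pi> n < c"
proof -
  define \<kappa> where "\<kappa> \<epsilon> = hkernel N p \<epsilon> 0 0 ^ n / (\<Sum>i\<le>N. \<epsilon> ^ i)" for \<epsilon>
  define b where "b \<epsilon> = hit_weight N (hkernel N p \<epsilon>) v n 0" for \<epsilon>
  define d where "d \<epsilon> = p * ((1 - (1 + 1 / sqrt \<epsilon>) * \<epsilon>) / (1 + sqrt \<epsilon>))" for \<epsilon>
  have sum0: "(\<Sum>i\<le>N. 0 ^ i) = (1 :: real)"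
    by (induction N) auto
  have "(\<kappa> \<longlongrightarrow> hkernel N p 0 0 0 ^ n / (\<Sum>i\<le>N. 0 ^ i)) (at_right 0)"
    unfolding \<kappa>_def by (intro tendsto_intros tendsto_hkernel) (simp add: sum0)
  then have \<kappa>: "(\<kappa> \<longlongrightarrow> 1) (at_right 0)"
    by (simp add: sum0 hkernel_0)
  have b: "(b \<longlongrightarrow> b 0) (at_right 0)" unfolding b_def by (rule tendsto_hit_weight)
  have "((\<lambda>\<epsilon>::real. (1 - (1 + 1 / sqrt \<epsilon>) * \<epsilon>) / (1 + sqrt \<epsilon>)) \<longlongrightarrow> 1) (at_right 0)"
    by real_asymp
  from tendsto_mult[OF tendsto_const[of p] this] have d: "(d \<longlongrightarrow> p) (at_right 0)"
    by (simp add: d_def[abs_def])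
  have "((\<lambda>\<epsilon>. real n * numerator \<epsilon> n / (\<kappa> \<epsilon> * b \<epsilon> * d \<epsilon>)) \<longlongrightarrow>
      real n * numerator 0 n / (1 * b 0 * p)) (at_right 0)"
    using hit_pos p by (intro tendsto_intros tendsto_numerator \<kappa> b d) (auto simp: b_def)
  moreover have "real n * numerator 0 n / (1 * b 0 * p) < c"
    using less by (simp add: b_def mult.commute)
  ultimately have "\<forall>\<^sub>F \<epsilon> in at_right 0. real n * numerator \<epsilon> n / (\<kappa> \<epsilon> * b \<epsilon> * d \<epsilon>) < c"
    by (rule order_tendstoD(2))
  moreover have "\<forall>\<^sub>F \<epsilon> in at_right 0. \<kappa> \<epsilon> > 0"
    using order_tendstoD(1)[OF \<kappa>, of 0] by simp
  moreover have "\<forall>\<^sub>F \<epsilon> in at_right 0. b \<epsilon> > 0"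
    using order_tendstoD(1)[OF b, of 0] hit_pos by (simp add: b_def)
  moreover have "\<forall>\<^sub>F \<epsilon> in at_right 0. d \<epsilon> > 0"
    using order_tendstoD(1)[OF d p(1)] .
  moreover note exists_hierarchical_chain[OF N_pos p]
  moreover have "\<forall>\<^sub>F \<epsilon> in at_right 0. (\<epsilon>::real) > 0" by (rule eventually_at_right_less)
  ultimately have "\<forall>\<^sub>F \<epsilon> in at_right 0. \<exists>P \<pi>. hierarchical_chain N p \<epsilon> P \<pi> \<and> gap_ratio {..N} P \<pi> n < c"
  proof eventually_elim
    case (elim \<epsilon>)
    then obtain P \<pi> where hc: "hierarchical_chain N p \<epsilon> P \<pi>" by blast
    interpret C: hierarchical_chain N p \<epsilon> P \<pi> by (rule hc)
    define G where "G = gap (set_pmf (count_law P \<pi> n)) (count_kernel P \<pi> n)"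
    define g where "g = gap {..N} (\<lambda>x y. pmf (P x) y)"
    have "G * (\<kappa> \<epsilon> * b \<epsilon>) \<le> numerator \<epsilon> n"
      using C.count_gap_bound[of v n, OF v_ge_1 v_0 n] by (simp only: G_def \<kappa>_def b_def numerator_def)
    then have G: "G \<le> numerator \<epsilon> n / (\<kappa> \<epsilon> * b \<epsilon>)"
      using elim by (simp add: pos_le_divide_eq)
    have G0: "G \<ge> 0" unfolding G_def
      by (rule reversible_chain.gap_nonneg[OF count_kernel_reversible_chain[OF C.irreducible_reversible]])
    have "d \<epsilon> \<le> g"
      using C.gap_lower_bound[of "sqrt \<epsilon>"] elim by (simp add: d_def g_def)
    then have "real n * G / g \<le> real n * G / d \<epsilon>"
      using elim G0 by (intro divide_left_mono mult_nonneg_nonneg mult_pos_pos) auto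
    also have "\<dots> \<le> real n * (numerator \<epsilon> n / (\<kappa> \<epsilon> * b \<epsilon>)) / d \<epsilon>"
      using elim G by (intro divide_right_mono mult_left_mono) auto
    also have "\<dots> < c" using elim by simp
    finally have "gap_ratio {..N} P \<pi> n < c" by (simp add: gap_ratio_def G_def g_def)
    then show ?case using hc by blast
  qed
  from eventually_happens'[OF trivial_limit_at_right_real this] show ?thesis .
qed

end

text \<open>
  The parameters are chosen in the order \<open>p\<close>, \<open>n\<close>, \<open>\<epsilon>\<close>.
\<close>

lemma exists_positive_kernel_gap_ratio:
  assumes m: "m \<ge> 2" and \<delta>: "\<delta> > 0"
  shows "\<exists>(\<Omega> :: nat set) P \<pi> n.
    card \<Omega> = m \<and> irreducible_reversible \<Omega> P \<pi> \<and> n \<ge> 2 \<and>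
    (\<forall>x\<in>\<Omega>. \<forall>y\<in>\<Omega>. pmf (P x) y > 0) \<and> gap_ratio \<Omega> P \<pi> n \<le> q_seq (m - 2) + \<delta>"
proof -
  define N where "N = m - 1"
  have N: "1 \<le> N" using m by (simp add: N_def)
  have "\<forall>\<^sub>F p in at_right 0. (0::real) < p \<and> p < 1"
    by (auto simp: eventually_at_right_field intro!: exI[of _ 1])
  moreover have "\<forall>\<^sub>F p in at_right 0.
      stage_weights.ratio_limit N p (stage_sigma N p) (stage_v N p) < q_seq (N - 1) + \<delta>"
    using \<delta> by (intro order_tendstoD(2)[OF ratio_limit_tendsto[OF N]]) simp
  ultimately have "\<forall>\<^sub>F p in at_right 0. 0 < p \<and> p < 1 \<and>
      stage_weights.ratio_limit N p (stage_sigma N p) (stage_v N p) < q_seq (N - 1) + \<delta>"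
    by eventually_elim auto
  from eventually_happens'[OF trivial_limit_at_right_real this] obtain p where p: "0 < p" "p < 1"
    and lim: "stage_weights.ratio_limit N p (stage_sigma N p) (stage_v N p) < q_seq (N - 1) + \<delta>"
    by blast
  interpret stage_weights N p "stage_sigma N p" "stage_v N p"
    by (rule stage_weights_q_seq[OF N p])
  have "\<forall>\<^sub>F n in sequentially. real n * numerator 0 n / (p * hit_weight N (hkernel N p 0) (stage_v N p) n 0)
      < q_seq (N - 1) + \<delta>"
    by (rule order_tendstoD(2)[OF window_ratio_limit lim])
  with hit_weight_eventually_pos eventually_ge_at_top[of 2] have "\<forall>\<^sub>F n in sequentially. n \<ge> 2 \<and>
      hit_weight N (hkernel N p 0) (stage_v N p) n 0 > 0 \<and>
      real n * numerator 0 n / (p * hit_weight N (hkernel N p 0) (stage_v N p) n 0) < q_seq (N - 1) + \<delta>"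
    by eventually_elim auto
  from eventually_happens'[OF sequentially_bot this] obtain n where n: "n \<ge> 2" "hit_weight N (hkernel N p 0) (stage_v N p) n 0 > 0"
    "real n * numerator 0 n / (p * hit_weight N (hkernel N p 0) (stage_v N p) n 0) < q_seq (N - 1) + \<delta>"
    by blast
  obtain \<epsilon> P \<pi> where hc: "hierarchical_chain N p \<epsilon> P \<pi>"
    and less: "gap_ratio {..N} P \<pi> n < q_seq (N - 1) + \<delta>"
    using exists_gap_ratio_less[OF n] by blast
  interpret C: hierarchical_chain N p \<epsilon> P \<pi> by (rule hc)
  have "\<forall>x\<in>{..N}. \<forall>y\<in>{..N}. pmf (P x) y > 0"
    using C.hkernel_pos by (simp add: C.pmf_P)
  moreover have "N - 1 = m - 2" "card {..N} = m" using m by (auto simp: N_def)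
  ultimately show ?thesis
    using C.irreducible_reversible n(1) less by (intro exI[of _ "{..N}"] exI) (auto intro: less_imp_le)
qed

section \<open>The optimal constant\<close>

lemma c_star_le:
  assumes "m \<ge> 2"
  shows "c_star m \<le> ereal (q_seq (m - 2))"
proof (rule ereal_le_epsilon2)
  fix \<delta> :: real assume "\<delta> > 0"
  then obtain \<Omega> :: "nat set" and P \<pi> n where
    *: "card \<Omega> = m" "irreducible_reversible \<Omega> P \<pi>" "n \<ge> 2" "gap_ratio \<Omega> P \<pi> n \<le> q_seq (m - 2) + \<delta>"
    using exists_positive_kernel_gap_ratio[OF assms] by blast
  then have "c_star m \<le> ereal (gap_ratio \<Omega> P \<pi> n)"
    unfolding c_star_def by (intro Inf_lower) blast
  also have "\<dots> \<le> ereal (q_seq (m - 2)) + ereal \<delta>" using * by simp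
  finally show "c_star m \<le> ereal (q_seq (m - 2)) + ereal \<delta>" .
qed

lemma c_star_nonneg: "c_star m \<ge> 0"
  unfolding c_star_def by (intro Inf_greatest) (auto simp: gap_ratio_nonneg)

lemma C_opt_ge:
  assumes "m \<ge> 2"
  shows "C_opt m \<ge> ereal (inverse (q_seq (m - 2)))"
proof -
  have "inverse (ereal (q_seq (m - 2))) \<le> inverse (c_star m)"
    using c_star_nonneg c_star_le[OF assms] by (rule ereal_inverse_antimono)
  moreover have "q_seq (m - 2) \<noteq> 0" using q_seq_bounds[of "m - 2"] by simp
  ultimately show ?thesis by (simp add: C_opt_def)
qed

theorem theorem11p1:
  shows "(\<forall>m\<ge>2. c_star m \<le> ereal (q_seq (m - 2))) \<and>
    (\<forall>m\<ge>2. \<forall>\<delta>>0. \<exists>(\<Omega> :: nat set) P \<pi> n.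
        card \<Omega> = m \<and> irreducible_reversible \<Omega> P \<pi> \<and> n \<ge> 2 \<and>
        gap_ratio \<Omega> P \<pi> n \<le> q_seq (m - 2) + \<delta>) \<and>
    (\<forall>m\<ge>2. \<forall>\<delta>>0. \<exists>(\<Omega> :: nat set) P \<pi> n.
        card \<Omega> = m \<and> irreducible_reversible \<Omega> P \<pi> \<and> n \<ge> 2 \<and>
        (\<forall>x\<in>\<Omega>. \<forall>y\<in>\<Omega>. pmf (P x) y > 0) \<and>
        gap_ratio \<Omega> P \<pi> n \<le> q_seq (m - 2) + \<delta>) \<and>
    (\<exists>\<epsilon> :: nat \<Rightarrow> real. \<epsilon> \<in> O(\<lambda>_. 1) \<and>
        (\<forall>\<^sub>F r in sequentially. q_seq r = 1 / (real r + ln (real r) + \<epsilon> r))) \<and>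
    (\<forall>m\<ge>2. q_seq (m - 2) \<le> 1 / (real m + 2)) \<and>
    (\<forall>m\<ge>2. C_opt m \<ge> ereal (inverse (q_seq (m - 2))))"
proof (intro conjI allI impI)
  fix m :: nat and \<delta> :: real
  assume m: "m \<ge> 2"
  show "c_star m \<le> ereal (q_seq (m - 2))" by (rule c_star_le[OF m])
  show "C_opt m \<ge> ereal (inverse (q_seq (m - 2)))" by (rule C_opt_ge[OF m])
  show "q_seq (m - 2) \<le> 1 / (real m + 2)"
    using q_seq_le[of "m - 2"] m by (simp add: of_nat_diff add.commute)
  assume \<delta>: "\<delta> > 0"
  show "\<exists>(\<Omega> :: nat set) P \<pi> n. card \<Omega> = m \<and> irreducible_reversible \<Omega> P \<pi> \<and> n \<ge> 2 \<and>
        (\<forall>x\<in>\<Omega>. \<forall>y\<in>\<Omega>. pmf (P x) y > 0) \<and> gap_ratio \<Omega> P \<pi> n \<le> q_seq (m - 2) + \<delta>"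
    by (rule exists_positive_kernel_gap_ratio[OF m \<delta>])
  then show "\<exists>(\<Omega> :: nat set) P \<pi> n. card \<Omega> = m \<and> irreducible_reversible \<Omega> P \<pi> \<and> n \<ge> 2 \<and>
        gap_ratio \<Omega> P \<pi> n \<le> q_seq (m - 2) + \<delta>" by blast
qed (rule q_seq_asymptotics)

end
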